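(* Let $b:\mathbb{R}^d\times\mathbb{R}^d\to\mathbb{R}^d$, $\sigma:\mathbb{R}^d\times\mathbb{R}^d\to\mathbb{R}^{d\times d}$, $\Phi:\mathbb{R}^d\times\mathbb{R}^d\to\mathbb{R}$ and $f:(\mathbb{R}^d\times\mathbb{R}\times\mathbb{R}^d)^2\to\mathbb{R}$ be bounded, continuously differentiable with bounded first derivatives, with $f((x,y,z),(x',y',z'))$ not depending on $z'$; let $x_0\in\mathbb{R}^d$. Let $X^N$ solve $X^N_t=x_0+\int_0^t\frac1N\sum_{k=1}^Nb(X^N_s,\Theta^k(X^N_s))ds+\int_0^t\frac1N\sum_{k=1}^N\sigma(X^N_s,\Theta^k(X^N_s))dW_s$, and let $(Y^N,Z^N)\in\mathcal{S}^2_{\mathbf{F}}([0,T];\mathbb{R})\times L^2_{\mathbf{F}}([0,T];\mathbb{R}^d)$ solve $$Y^N_t=\frac1N\sum_{k=1}^N\Phi(X^N_T,\Theta^k(X^N_T))+\int_t^T\frac1N\sum_{k=1}^Nf(\Lambda^N_s,\Theta^k(\Lambda^N_s))ds-\int_t^TZ^N_sdW_s,\quad\Lambda^N=(X^N,Y^N,Z^N).$$ Let $X$ solve $X_t=x_0+\int_0^tE[b(x,X_s)]|_{x=X_s}ds+\int_0^tE[\sigma(x,X_s)]|_{x=X_s}dW_s$ and $(Y,Z)$ solve $Y_t=E[\Phi(x,X_T)]|_{x=X_T}+\int_t^TE[f(\lambda,\Lambda_s)]|_{\lambda=\Lambda_s}ds-\int_t^TZ_sdW_s$, $\Lambda=(X,Y,Z)$.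 Then there exists a constant $C$ such that, $dt\,dP$-a.e., $|Z_t|\le C$ and $|Z^N_t|\le C$ for all $N\ge1$.
   Context: Fix $T>0$, $d\ge1$. Let $I=\{0\}\cup\bigcup_{k\ge1}\{1,2,3,\dots\}^k$ with concatenation $i\oplus i'$ (conventions $(0)\oplus i=i$, $(k)\oplus0=(k)$). $\Omega=C_0([0,T];\mathbb{R}^d)^I$, $W^i_t(\omega)=\omega^i_t$, $P$ the probability making $(W^i)_{i\in I}$ independent $d$-dimensional Brownian motions, $\mathcal{F}$ the completed Borel $\sigma$-field, $W=W^0$, $\mathcal{G}=\sigma\{W^i_t:t\in[0,T],i\ne0\}$, $\mathcal{F}_t=\mathcal{F}^W_t\vee\mathcal{G}$ with $\mathcal{F}^W$ the completed natural filtration of $W$, $\mathbf{F}=(\mathcal{F}_t)$. Shift operators $\Theta^k(\omega)=(\omega^{(k)\oplus j})_{j\in I}$, $k\ge0$; for random variables $\Theta^k(\zeta)=\zeta\circ\Theta^k$ (for $k\ge1$: i.i.d. copies of $\zeta$, independent of $W$). $\mathcal{S}^2_{\mathbf{F}}$: continuous adapted processes with $E\sup_t|\cdot|^2<\infty$; $L^2_{\mathbf{F}}$: progressively measurable processes with $E\int_0^T|\cdot|^2dt<\infty$. *)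

theory Defs
  imports "HOL-Probability.Probability"
begin

text \<open>The index set I: the empty list encodes the index 0, nonempty lists of
positive naturals encode the tuples (k1,...,km). Concatenation is list append;
with this encoding (0)+i = i and (k)+0 = (k) hold automatically.\<close>

definition Iset :: "nat list set" where
  "Iset = {[]} \<union> {l. l \<noteq> [] \<and> (\<forall>k\<in>set l. 1 \<le> k)}"

type_synonym 'd omega = "nat list \<Rightarrow> real \<Rightarrow> real^'d"

text \<open>Omega = C_0([0,T];R^d)^I; paths are extended by 0 outside [0,T] and
coordinates outside I are identically 0 (normalisation).\<close>

definition Omega :: "real \<Rightarrow> ('d::finite) omega set" where
  "Omega T = {\<omega>. (\<forall>i\<in>Iset. continuous_on {0..T} (\<omega> i) \<and> \<omega> i 0 = 0
                    \<and> (\<forall>t. t \<notin> {0..T} \<longrightarrow> \<omega> i t = 0))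
              \<and> (\<forall>i. i \<notin> Iset \<longrightarrow> \<omega> i = (\<lambda>_. 0))}"

definition gen :: "real \<Rightarrow> (nat list \<times> real) set \<Rightarrow> ('d::finite) omega set set" where
  "gen T S = sigma_sets (Omega T)
     {{\<omega> \<in> Omega T. \<omega> i t \<in> B} | i t B. (i, t) \<in> S \<and> B \<in> sets borel}"

definition Theta :: "nat \<Rightarrow> 'd omega \<Rightarrow> 'd omega" where
  "Theta k \<omega> = (if k = 0 then \<omega> else (\<lambda>j. \<omega> (k # j)))"

text \<open>The base measure (Borel sigma-algebra, before completion) under which the
coordinate processes (W^i)_{i in I} are independent d-dimensional standard Brownian
motions: all increments of all components over any partition are jointly
independent centred Gaussians with variance equal to the time increment.\<close>
definition canonical_BM_measure :: "real \<Rightarrow> ('d::finite) omega measure \<Rightarrow> bool" where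
  "canonical_BM_measure T M0 \<longleftrightarrow>
     space M0 = Omega T \<and> sets M0 = gen T (Iset \<times> {0..T}) \<and> prob_space M0 \<and>
     (\<forall>(n::nat) (p::nat \<Rightarrow> real). p 0 = 0 \<and> p n \<le> T \<and> (\<forall>k<n. p k < p (Suc k)) \<longrightarrow>
        prob_space.indep_vars M0 (\<lambda>_. borel)
          (\<lambda>((i, j), k) \<omega>. \<omega> i (p (Suc k)) $ j - \<omega> i (p k) $ j)
          ((Iset \<times> (UNIV :: 'd set)) \<times> {..<n}) \<and>
        (\<forall>i\<in>Iset. \<forall>j::'d. \<forall>k<n.
           distributed M0 lborel (\<lambda>\<omega>. \<omega> i (p (Suc k)) $ j - \<omega> i (p k) $ j)
             (\<lambda>x. ennreal (normal_density 0 (sqrt (p (Suc k) - p k)) x))))"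

text \<open>F_t = F^W_t \/ G, F^W the P-completed natural filtration of W = W^0,
G generated by all W^i, i \<noteq> 0.\<close>
definition Filt :: "real \<Rightarrow> ('d::finite) omega measure \<Rightarrow> real \<Rightarrow> 'd omega measure" where
  "Filt T P t = sigma (Omega T)
     (gen T ({[]} \<times> {0..t}) \<union> null_sets P \<union> gen T ((Iset - {[]}) \<times> {0..T}))"

definition adapted :: "real \<Rightarrow> ('d::finite) omega measure \<Rightarrow> (real \<Rightarrow> 'd omega \<Rightarrow> 'b::topological_space) \<Rightarrow> bool" where
  "adapted T P X \<longleftrightarrow> (\<forall>t\<in>{0..T}. X t \<in> borel_measurable (Filt T P t))"

definition progressive :: "real \<Rightarrow> ('d::finite) omega measure \<Rightarrow> (real \<Rightarrow> 'd omega \<Rightarrow> 'b::topological_space) \<Rightarrow> bool" where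
  "progressive T P X \<longleftrightarrow> (\<forall>t\<in>{0..T}.
     (\<lambda>(s, \<omega>). X s \<omega>) \<in> borel_measurable (restrict_space lborel {0..t} \<Otimes>\<^sub>M Filt T P t))"

definition cont_paths :: "real \<Rightarrow> ('d::finite) omega measure \<Rightarrow> (real \<Rightarrow> 'd omega \<Rightarrow> 'b::topological_space) \<Rightarrow> bool" where
  "cont_paths T P X \<longleftrightarrow> (\<forall>\<omega>\<in>space P. continuous_on {0..T} (\<lambda>t. X t \<omega>))"

definition S2 :: "real \<Rightarrow> ('d::finite) omega measure \<Rightarrow> (real \<Rightarrow> 'd omega \<Rightarrow> 'b::real_normed_vector) \<Rightarrow> bool" where
  "S2 T P Y \<longleftrightarrow> cont_paths T P Y \<and> adapted T P Y \<and>
     (\<integral>\<^sup>+\<omega>. (SUP t\<in>{0..T}. ennreal ((norm (Y t \<omega>))\<^sup>2)) \<partial>P) < \<infinity>"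

definition L2 :: "real \<Rightarrow> ('d::finite) omega measure \<Rightarrow> (real \<Rightarrow> 'd omega \<Rightarrow> 'b::real_normed_vector) \<Rightarrow> bool" where
  "L2 T P Z \<longleftrightarrow> progressive T P Z \<and>
     (\<integral>\<^sup>+\<omega>. (\<integral>\<^sup>+s\<in>{0..T}. ennreal ((norm (Z s \<omega>))\<^sup>2) \<partial>lborel) \<partial>P) < \<infinity>"

definition simple_ok :: "real \<Rightarrow> ('d::finite) omega measure \<Rightarrow> nat \<Rightarrow> (nat \<Rightarrow> real)
    \<Rightarrow> (nat \<Rightarrow> 'd omega \<Rightarrow> real^'d) \<Rightarrow> bool" where
  "simple_ok T P n p \<xi> \<longleftrightarrow> p 0 = 0 \<and> p n = T \<and> (\<forall>k<n. p k < p (Suc k)) \<and>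
     (\<forall>k<n. \<xi> k \<in> borel_measurable (Filt T P (p k)) \<and> bounded (range (\<xi> k)))"

definition simple_proc :: "nat \<Rightarrow> (nat \<Rightarrow> real) \<Rightarrow> (nat \<Rightarrow> 'd omega \<Rightarrow> real^'d)
    \<Rightarrow> real \<Rightarrow> ('d::finite) omega \<Rightarrow> real^'d" where
  "simple_proc n p \<xi> s \<omega> = (\<Sum>k<n. indicator {p k<..p (Suc k)} s *\<^sub>R \<xi> k \<omega>)"

definition simple_int :: "nat \<Rightarrow> (nat \<Rightarrow> real) \<Rightarrow> (nat \<Rightarrow> 'd omega \<Rightarrow> real^'d)
    \<Rightarrow> real \<Rightarrow> ('d::finite) omega \<Rightarrow> real" where
  "simple_int n p \<xi> t \<omega> =
     (\<Sum>k<n. \<xi> k \<omega> \<bullet> (\<omega> [] (min t (p (Suc k))) - \<omega> [] (min t (p k))))"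

text \<open>I is (a version of) the Ito integral t \<mapsto> int_0^t Z_s . dW_s:
a continuous adapted process that is the S^2-limit of elementary integrals of
simple processes converging to Z in L^2(dt dP).\<close>
definition is_ito :: "real \<Rightarrow> ('d::finite) omega measure \<Rightarrow> (real \<Rightarrow> 'd omega \<Rightarrow> real^'d)
    \<Rightarrow> (real \<Rightarrow> 'd omega \<Rightarrow> real) \<Rightarrow> bool" where
  "is_ito T P Z I \<longleftrightarrow> progressive T P Z \<and> cont_paths T P I \<and> adapted T P I \<and>
     (\<exists>n p \<xi>. (\<forall>m. simple_ok T P (n m) (p m) (\<xi> m)) \<and>
        (\<lambda>m. \<integral>\<^sup>+\<omega>. (\<integral>\<^sup>+s\<in>{0..T}. ennreal ((norm (simple_proc (n m) (p m) (\<xi> m) s \<omega> - Z s \<omega>))\<^sup>2) \<partial>lborel) \<partial>P)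
          \<longlonglongrightarrow> 0 \<and>
        (\<lambda>m. \<integral>\<^sup>+\<omega>. (SUP t\<in>{0..T}. ennreal ((simple_int (n m) (p m) (\<xi> m) t \<omega> - I t \<omega>)\<^sup>2)) \<partial>P)
          \<longlonglongrightarrow> 0)"

definition C1b :: "('a::real_normed_vector \<Rightarrow> 'b::real_normed_vector) \<Rightarrow> bool" where
  "C1b g \<longleftrightarrow> bounded (range g) \<and>
     (\<exists>g' :: 'a \<Rightarrow> ('a \<Rightarrow>\<^sub>L 'b). (\<forall>x. (g has_derivative blinfun_apply (g' x)) (at x))
        \<and> continuous_on UNIV g' \<and> bounded (range g'))"

end

theory Submission
  imports Defs
begin

text \<open>
  Let \<open>\<phi>\<close> be the transformation of \<open>\<Omega>\<close> that changes the sign of the increments of \<open>W\<^sup>0\<close> on \<open>[t, r]\<close> and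
  leaves everything else alone. It preserves \<open>P\<close> and all the \<open>W\<^sup>i\<close> with \<open>i \<noteq> 0\<close>, hence the coefficients
  of both systems, regarded as random functions of the own state. Consequently \<open>X \<circ> \<phi>\<close> and \<open>Y \<circ> \<phi>\<close>
  solve on \<open>[r, T]\<close> the same equations as \<open>X\<close> and \<open>Y\<close>, and the usual stability estimates, localised to
  an event \<open>A \<in> \<F>\<^sub>t\<close>, give \<open>E 1\<^sub>A |Y\<^sub>r \<circ> \<phi> - Y\<^sub>r|\<^sup>2 \<le> K (r - t) P(A)\<close>. Since
  \<open>(\<integral>\<^sub>t\<^sup>r Z dW) \<circ> \<phi> = - \<integral>\<^sub>t\<^sup>r (Z \<circ> \<phi>) dW\<close>, the isometry turns this into
  \<open>E 1\<^sub>A \<integral>\<^sub>t\<^sup>r |Z + Z \<circ> \<phi>|\<^sup>2 ds \<le> K' (r - t) P(A)\<close>. A simple process is invariant under \<open>\<phi>\<close> on each piece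
  of its partition, so approximating \<open>Z\<close> by simple processes replaces \<open>Z + Z \<circ> \<phi>\<close> by \<open>2 Z\<close> and yields
  \<open>|Z| \<le> C\<close>, where \<open>C\<close> depends only on \<open>T\<close>, \<open>d\<close> and the bounds and Lipschitz constants of the data.
  The isometry is only needed up to constant factors.
\<close>

section \<open>The path space and its reflections\<close>

text \<open>The classical route bounds \<open>Z\<close> through the Malliavin derivative of
  \<open>Y\<close>. Reflecting the path over a short interval takes over the role of that
  derivative: it is a finite perturbation of \<open>W\<close>, and unlike a shift it preserves
  \<open>P\<close> exactly, so that no Girsanov density has to be controlled. The obstacle is that
  \<open>Z\<close> is known only as an element of \<open>L^2\<close>, whereas the bound is wanted
  almost everywhere. This dictates the form of the decisive estimates. They are linear in
  \<open>P(A)\<close> with \<open>A\<close> an arbitrary event of the past, which amounts to a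
  conditional bound; and they are linear in \<open>r - t\<close>, so that the contributions of the
  pieces of a partition add up however fine it is. The stability constants come from short
  intervals, on which half of the unknown is absorbed, and from chaining a number of such intervals
  that depends on \<open>T\<close> and the data only. Uniformity in \<open>N\<close> follows because
  averages over particles inherit the bounds and Lipschitz constants of the data.\<close>

lemma borel_measurable_vec_lambda:
  fixes f :: "'d::finite \<Rightarrow> 'a \<Rightarrow> real"
  assumes "\<And>j. f j \<in> borel_measurable M"
  shows "(\<lambda>x. \<chi> j. f j x) \<in> borel_measurable M"
proof (rule borel_measurable_euclidean_space[THEN iffD2, rule_format])
  fix i :: "real^'d" assume "i \<in> Basis"
  then obtain j where "i = axis j 1" by (auto simp: Basis_vec_def)
  then show "(\<lambda>x. (\<chi> j. f j x) \<bullet> i) \<in> borel_measurable M"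
    using assms[of j] by (simp add: inner_axis)
qed

lemma borel_measurable_vec_nth:
  fixes F :: "'a \<Rightarrow> real^'d::finite"
  assumes "F \<in> borel_measurable M"
  shows "(\<lambda>x. F x $ j) \<in> borel_measurable M"
  by (rule borel_measurable_continuous_on[OF _ assms]) (intro continuous_intros)

section \<open>Sigma-algebras generated by coordinates\<close>

lemma gen_sigma_algebra: "sigma_algebra (Omega T) (gen T S)"
  unfolding gen_def by (rule sigma_algebra_sigma_sets) auto

text \<open>\<open>gen\<close> is only a family of sets; wrapped as a measure it can be the source
  or target of \<open>\<rightarrow>\<^sub>M\<close>.\<close>

definition genM :: "real \<Rightarrow> (nat list \<times> real) set \<Rightarrow> ('d::finite) omega measure" where
  "genM T S = sigma (Omega T) (gen T S)"

lemma gen_subset_Pow: "gen T S \<subseteq> Pow (Omega T)"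
  using sigma_sets_into_sp[of "{{\<omega> \<in> Omega T. \<omega> i t \<in> B} | i t B. (i, t) \<in> S \<and> B \<in> sets borel}" "Omega T"]
  unfolding gen_def by blast

lemma space_genM[simp]: "space (genM T S) = Omega T"
  unfolding genM_def by (simp add: gen_subset_Pow)

lemma sets_genM[simp]: "sets (genM T S) = gen T S"
  unfolding genM_def
  by (simp add: gen_subset_Pow sigma_algebra.sigma_sets_eq[OF gen_sigma_algebra])

lemma measurable_coord: "(i, t) \<in> S \<Longrightarrow> (\<lambda>\<omega>. \<omega> i t) \<in> borel_measurable (genM T S)"
proof (rule measurableI)
  fix B :: "(real^'d) set" assume "(i, t) \<in> S" "B \<in> sets borel"
  moreover have "(\<lambda>\<omega>. \<omega> i t) -` B \<inter> space (genM T S) = {\<omega> \<in> Omega T. \<omega> i t \<in> B}"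
    by auto
  ultimately show "(\<lambda>\<omega>. \<omega> i t) -` B \<inter> space (genM T S) \<in> sets (genM T S)"
    unfolding gen_def sets_genM by (auto intro!: sigma_sets.Basic)
qed auto

lemma measurable_into_genM:
  fixes F :: "'a \<Rightarrow> ('d::finite) omega"
  assumes "\<And>x. x \<in> space N \<Longrightarrow> F x \<in> Omega T"
    and "\<And>i t. (i, t) \<in> S \<Longrightarrow> (\<lambda>x. F x i t) \<in> borel_measurable N"
  shows "F \<in> N \<rightarrow>\<^sub>M genM T S"
proof (rule measurable_sigma_sets[of _ "Omega T"])
  show "sets (genM T S) = sigma_sets (Omega T)
     {{\<omega> \<in> Omega T. \<omega> i t \<in> B} | i t B. (i, t) \<in> S \<and> B \<in> sets borel}"
    by (simp add: gen_def)
  fix E :: "'d omega set" assume "E \<in> {{\<omega> \<in> Omega T. \<omega> i t \<in> B} | i t B. (i, t) \<in> S \<and> B \<in> sets borel}"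
  then obtain i t B where E: "E = {\<omega> \<in> Omega T. \<omega> i t \<in> B}" "(i, t) \<in> S" "B \<in> sets borel"
    by blast
  have "F -` E \<inter> space N = (\<lambda>x. F x i t) -` B \<inter> space N"
    using assms(1) E by auto
  then show "F -` E \<inter> space N \<in> sets N"
    using measurable_sets[OF assms(2)[OF E(2)] E(3)] by simp
qed (use assms(1) in auto)

text \<open>Minimality of the generated family: the identity from \<open>N\<close> into
  \<open>genM T S\<close> is measurable because all coordinates in \<open>S\<close> are.\<close>

lemma gen_subset_sets:
  fixes N :: "('d::finite) omega measure"
  assumes "space N = Omega T"
    and "\<And>i t. (i, t) \<in> S \<Longrightarrow> (\<lambda>\<omega>. \<omega> i t) \<in> borel_measurable N"
  shows "gen T S \<subseteq> sets N"
proof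
  fix E :: "'d omega set" assume E: "E \<in> gen T S"
  have "(\<lambda>x. x) \<in> N \<rightarrow>\<^sub>M genM T S"
    by (rule measurable_into_genM) (use assms in auto)
  from measurable_sets[OF this, of E] E show "E \<in> sets N"
    using assms(1) gen_subset_Pow[of T S] by (auto simp: Int_absorb2)
qed

lemma gen_mono: "S \<subseteq> S' \<Longrightarrow> gen T S \<subseteq> gen T S'"
  by (rule gen_subset_sets[of "genM T S'" T S, simplified]) (auto intro: measurable_coord)

lemma OmegaD:
  assumes "\<omega> \<in> Omega T" "i \<in> Iset"
  shows "continuous_on {0..T} (\<omega> i)" "\<omega> i 0 = 0" "t \<notin> {0..T} \<Longrightarrow> \<omega> i t = 0"
  using assms unfolding Omega_def by auto

section \<open>Partitions and increments\<close>

definition partition_of :: "real \<Rightarrow> nat \<Rightarrow> (nat \<Rightarrow> real) \<Rightarrow> bool" where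
  "partition_of T n p \<longleftrightarrow> p 0 = 0 \<and> p n \<le> T \<and> (\<forall>k<n. p k < p (Suc k))"

lemma partition_of_mono:
  assumes "partition_of T n p" "k \<le> l" "l \<le> n"
  shows "p k \<le> p l"
  using assms(2,3)
proof (induction rule: dec_induct)
  case (step m)
  then have "p m < p (Suc m)" "p k \<le> p m" using assms(1) unfolding partition_of_def by auto
  then show ?case by simp
qed simp

lemma partition_of_less:
  assumes "partition_of T n p" "k < l" "l \<le> n"
  shows "p k < p l"
proof -
  have "p k < p (Suc k)" using assms unfolding partition_of_def by auto
  also have "p (Suc k) \<le> p l" using assms by (intro partition_of_mono) auto
  finally show ?thesis .
qed

lemma partition_of_range:
  assumes "partition_of T n p" "k \<le> n"
  shows "p k \<in> {0..T}"
  using partition_of_mono[OF assms(1), of 0 k] partition_of_mono[OF assms(1), of k n] assms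
  unfolding partition_of_def by auto

text \<open>A finite-dimensional event involves finitely many times. Listed in increasing order they
  form a partition of the kind over which \<open>canonical_BM_measure\<close> quantifies; its last
  node may lie before \<open>T\<close>.\<close>

lemma partition_of_finite_set:
  assumes "finite F" "0 \<in> F" "F \<subseteq> {0..T}"
  obtains n p where "partition_of T n p" "p ` {..n} = F"
proof -
  define l where "l = sorted_list_of_set F"
  have l: "set l = F" "sorted l" "distinct l" unfolding l_def using assms by auto
  have ne: "length l > 0" using l(1) assms by (cases l) auto
  have "l ! 0 = 0"
  proof -
    obtain k where "k < length l" "l ! k = 0" using l(1) assms(2) by (metis in_set_conv_nth)
    then have "l ! 0 \<le> 0" using sorted_nth_mono[OF l(2), of 0 k] by simp
    moreover have "l ! 0 \<in> F" using ne l(1) nth_mem by metis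
    ultimately show ?thesis using assms(3) by (auto simp: subset_iff)
  qed
  moreover have "l ! (length l - 1) \<in> F" using ne l(1) nth_mem[of "length l - 1" l] by auto
  moreover have "l ! k < l ! Suc k" if "k < length l - 1" for k
  proof -
    have "l ! k \<le> l ! Suc k" using that by (intro sorted_nth_mono[OF l(2)]) auto
    moreover have "l ! k \<noteq> l ! Suc k" using that l(3) by (subst nth_eq_iff_index_eq) auto
    ultimately show ?thesis by simp
  qed
  ultimately have "partition_of T (length l - 1) ((!) l)"
    unfolding partition_of_def using assms(3) by (auto simp: subset_iff)
  moreover have "((!) l) ` {..length l - 1} = F"
  proof -
    have "{..length l - 1} = {..<length l}" using lessThan_Suc_atMost[of "length l - 1"] ne by simp
    then show ?thesis unfolding l(1)[symmetric] set_conv_nth by auto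
  qed
  ultimately show ?thesis using that by blast
qed

definition incr :: "(nat \<Rightarrow> real) \<Rightarrow> (nat list \<times> 'd) \<times> nat \<Rightarrow> ('d::finite) omega \<Rightarrow> real" where
  "incr p = (\<lambda>((i, j), k) \<omega>. \<omega> i (p (Suc k)) $ j - \<omega> i (p k) $ j)"

abbreviation inc_idx :: "nat \<Rightarrow> ((nat list \<times> 'd) \<times> nat) set" where
  "inc_idx n \<equiv> (Iset \<times> UNIV) \<times> {..<n}"

lemma incr_sum:
  assumes "\<omega> \<in> Omega T" "i \<in> Iset" "p 0 = 0"
  shows "\<omega> i (p l) $ j = (\<Sum>k<l. incr p ((i, j), k) \<omega>)"
  using OmegaD(2)[OF assms(1,2)] assms(3) by (induction l) (auto simp: incr_def)

text \<open>Paths start at 0, so a position at a node is the sum of the preceding increments, and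
  events about positions become events about increments. The index set \<open>K\<close> is kept
  general because independence is later applied to blocks of increments.\<close>

lemma gen_subset_vimage_incr:
  fixes K :: "((nat list \<times> 'd::finite) \<times> nat) set"
  assumes "p 0 = 0"
    and "\<And>i t. (i, t) \<in> S \<Longrightarrow> i \<in> Iset \<and> (\<exists>l. t = p l \<and> (\<forall>j. \<forall>k<l. ((i, j), k) \<in> K))"
  shows "gen T S \<subseteq> sets (vimage_algebra (Omega T) (\<lambda>\<omega>. \<lambda>a\<in>K. incr p a \<omega>) (PiM K (\<lambda>_. borel)))"
proof (rule gen_subset_sets)
  let ?V = "vimage_algebra (Omega T) (\<lambda>\<omega>. \<lambda>a\<in>K. incr p a \<omega>) (PiM K (\<lambda>_. borel :: real measure))"
  have m: "(\<lambda>\<omega>. \<lambda>a\<in>K. incr p a \<omega>) \<in> ?V \<rightarrow>\<^sub>M PiM K (\<lambda>_. borel)"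
    by (intro measurable_vimage_algebra1) (simp add: space_PiM)
  have inc: "incr p a \<in> borel_measurable ?V" if "a \<in> K" for a
  proof -
    have "(\<lambda>\<omega>. (\<lambda>a\<in>K. incr p a \<omega>) a) \<in> borel_measurable ?V"
      by (rule measurable_compose[OF m]) (rule measurable_component_singleton[OF that])
    then show ?thesis using that by simp
  qed
  fix i t assume "(i, t) \<in> S"
  from assms(2)[OF this] obtain l where l: "i \<in> Iset" "t = p l" "\<forall>j. \<forall>k<l. ((i, j), k) \<in> K"
    by blast
  have "(\<lambda>\<omega>. \<chi> j. \<Sum>k<l. incr p ((i, j), k) \<omega>) \<in> borel_measurable ?V"
    using l(3) inc by (intro borel_measurable_vec_lambda borel_measurable_sum) auto
  also have "?this \<longleftrightarrow> (\<lambda>\<omega>. \<omega> i t) \<in> borel_measurable ?V"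
  proof (rule measurable_cong)
    fix \<omega> assume "\<omega> \<in> space ?V"
    then show "(\<chi> j. \<Sum>k<l. incr p ((i, j), k) \<omega>) = \<omega> i t"
      using incr_sum[where p=p and \<omega>=\<omega> and T=T and i=i and l=l] l(1,2) assms(1) by (simp add: vec_eq_iff)
  qed
  finally show "(\<lambda>\<omega>. \<omega> i t) \<in> borel_measurable ?V" .
qed simp

text \<open>Reflection of the increments of \<open>W\<^sup>0\<close> over \<open>[t, r]\<close>.\<close>

definition flip :: "real \<Rightarrow> real \<Rightarrow> real \<Rightarrow> ('d::finite) omega \<Rightarrow> 'd omega" where
  "flip T t r \<omega> i s = (if i = [] \<and> s \<in> {0..T}
     then \<omega> [] s - 2 *\<^sub>R (\<omega> [] (max t (min r s)) - \<omega> [] t) else \<omega> i s)"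

lemma Nil_in_Iset[simp]: "[] \<in> Iset"
  by (simp add: Iset_def)

lemma flip_other: "i \<noteq> [] \<Longrightarrow> flip T t r \<omega> i = \<omega> i"
  by (auto simp: flip_def)

lemma flip_before: "s \<le> t \<Longrightarrow> t \<le> r \<Longrightarrow> flip T t r \<omega> i s = \<omega> i s"
  by (simp add: flip_def)

lemma flip_in_Omega:
  assumes "\<omega> \<in> Omega T" "0 \<le> t" "t \<le> r" "r \<le> T"
  shows "flip T t r \<omega> \<in> Omega T"
proof -
  note c = OmegaD[OF assms(1) Nil_in_Iset]
  have c2: "continuous_on {0..T} (\<lambda>s. \<omega> [] (max t (min r s)))"
    by (rule continuous_on_compose2[OF c(1)]) (use assms in \<open>auto intro!: continuous_intros\<close>)
  have "continuous_on {0..T} (\<lambda>s. \<omega> [] s - 2 *\<^sub>R (\<omega> [] (max t (min r s)) - \<omega> [] t))"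
    by (intro continuous_intros c(1) c2)
  then have "continuous_on {0..T} (flip T t r \<omega> [])"
    by (rule continuous_on_cong[THEN iffD1, rotated -1]) (auto simp: flip_def)
  moreover have "flip T t r \<omega> [] 0 = 0"
    using assms c(2) by (simp add: flip_before)
  moreover have "flip T t r \<omega> [] s = 0" if "s \<notin> {0..T}" for s
    using c(3)[OF that] that unfolding flip_def by (simp only: if_False simp_thms)
  ultimately have "continuous_on {0..T} (flip T t r \<omega> i) \<and> flip T t r \<omega> i 0 = 0
      \<and> (\<forall>s. s \<notin> {0..T} \<longrightarrow> flip T t r \<omega> i s = 0)" if "i \<in> Iset" for i
    using OmegaD[OF assms(1) that] flip_other[of i T t r \<omega>] by (cases "i = []") auto
  moreover have "flip T t r \<omega> i = (\<lambda>_. 0)" if "i \<notin> Iset" for i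
    using that assms(1) flip_other[of i T t r \<omega>] Nil_in_Iset unfolding Omega_def by fastforce
  ultimately show ?thesis unfolding Omega_def by blast
qed

lemma flip_increment_inside:
  assumes "0 \<le> t" "t \<le> a" "a \<le> r" "t \<le> b" "b \<le> r" "r \<le> T"
  shows "flip T t r \<omega> [] b - flip T t r \<omega> [] a = - (\<omega> [] b - \<omega> [] a)"
proof -
  have "max t (min r a) = a" "max t (min r b) = b" using assms by auto
  then show ?thesis using assms by (simp add: flip_def scaleR_2)
qed

lemma flip_increment_after:
  assumes "0 \<le> t" "t \<le> r" "r \<le> a" "a \<le> T" "r \<le> b" "b \<le> T"
  shows "flip T t r \<omega> [] b - flip T t r \<omega> [] a = \<omega> [] b - \<omega> [] a"
proof -
  have "min r a = r" "min r b = r" using assms by auto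
  then show ?thesis using assms by (simp add: flip_def)
qed

text \<open>The reflection does not anticipate: after \<open>t\<close>, the reflected path at time
  \<open>s\<close> involves the original one only at \<open>s\<close>, at \<open>t\<close> and at
  \<open>max t (min r s)\<close>, none of them later than \<open>s\<close>. Hence it suffices that
  the times listed in \<open>S\<close> for the index \<open>[]\<close> are closed downwards.\<close>

lemma flip_measurable_genM:
  assumes "0 \<le> t" "t \<le> r" "r \<le> T"
    and S: "\<And>i s. (i, s) \<in> S \<Longrightarrow> i \<noteq> [] \<or> s \<in> {0..T} \<and> (\<forall>s'\<in>{0..s}. ([], s') \<in> S)"
  shows "flip T t r \<in> genM T S \<rightarrow>\<^sub>M genM T S"
proof (rule measurable_into_genM)
  fix i s assume iS: "(i, s) \<in> S"
  show "(\<lambda>\<omega>. flip T t r \<omega> i s) \<in> borel_measurable (genM T S)"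
  proof (cases "i \<noteq> [] \<or> s \<le> t")
    case True
    then show ?thesis
      using iS assms(2) by (auto simp: flip_before flip_other measurable_coord)
  next
    case False
    then have s: "s \<in> {0..T}" "i = []" "t \<le> s" and *: "\<And>s'. s' \<in> {0..s} \<Longrightarrow> ([], s') \<in> S"
      using S[OF iS] by auto
    have mm: "max t (min r s) \<in> {0..s}" using s assms by auto
    have "(\<lambda>\<omega>. \<omega> [] s - 2 *\<^sub>R (\<omega> [] (max t (min r s)) - \<omega> [] t)) \<in> borel_measurable (genM T S)"
      using measurable_coord[of "[]" s S] measurable_coord[of "[]" _ S, OF *[OF mm]]
        measurable_coord[of "[]" t S] s * assms(1)
      by (intro borel_measurable_diff borel_measurable_scaleR borel_measurable_const) auto
    then show ?thesis using s by (simp add: flip_def)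
  qed
qed (use flip_in_Omega assms in auto)

text \<open>Together with \<open>Int_stable_UN_gen\<close> this prepares pi-lambda arguments:
  finite-dimensional events generate everything, and since the index sets are directed they are
  stable under intersection.\<close>

lemma sigma_sets_UN_gen:
  fixes S :: "(nat list \<times> real) set"
  assumes "\<And>x. x \<in> S \<Longrightarrow> \<exists>S'\<in>\<S>. x \<in> S'" "\<And>S'. S' \<in> \<S> \<Longrightarrow> S' \<subseteq> S"
  shows "sigma_sets (Omega T) (\<Union>S'\<in>\<S>. gen T S') = (gen T S :: ('d::finite) omega set set)"
proof
  show "sigma_sets (Omega T) (\<Union>S'\<in>\<S>. gen T S') \<subseteq> (gen T S :: 'd omega set set)"
    by (rule sigma_algebra.sigma_sets_subset[OF gen_sigma_algebra]) (use gen_mono assms(2) in blast)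
  let ?G = "{{\<omega> \<in> Omega T. \<omega> i t \<in> B} | i t B. (i, t) \<in> S \<and> B \<in> sets borel} :: 'd omega set set"
  have "?G \<subseteq> (\<Union>S'\<in>\<S>. gen T S')"
  proof
    fix E assume "E \<in> ?G"
    then obtain i t B where E: "E = {\<omega> \<in> Omega T. \<omega> i t \<in> B}" "(i, t) \<in> S" "B \<in> sets borel" by blast
    from assms(1)[OF E(2)] obtain S' where S': "S' \<in> \<S>" "(i, t) \<in> S'" by blast
    have "E \<in> gen T S'" unfolding gen_def E(1) by (rule sigma_sets.Basic) (use S' E in blast)
    then show "E \<in> (\<Union>S'\<in>\<S>. gen T S')" using S' by blast
  qed
  then show "(gen T S :: 'd omega set set) \<subseteq> sigma_sets (Omega T) (\<Union>S'\<in>\<S>. gen T S')"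
    unfolding gen_def[of T S] by (rule sigma_sets_mono')
qed

lemma Int_stable_UN_gen:
  assumes "\<And>S1 S2. S1 \<in> \<S> \<Longrightarrow> S2 \<in> \<S> \<Longrightarrow> \<exists>S3\<in>\<S>. S1 \<union> S2 \<subseteq> S3"
  shows "Int_stable (\<Union>S'\<in>\<S>. (gen T S' :: ('d::finite) omega set set))"
proof (rule Int_stableI)
  fix a b :: "'d omega set" assume "a \<in> (\<Union>S'\<in>\<S>. gen T S')" "b \<in> (\<Union>S'\<in>\<S>. gen T S')"
  then obtain S1 S2 where S: "S1 \<in> \<S>" "S2 \<in> \<S>" "a \<in> gen T S1" "b \<in> gen T S2" by blast
  from assms[OF S(1,2)] obtain S3 where S3: "S3 \<in> \<S>" "S1 \<union> S2 \<subseteq> S3" by blast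
  have "a \<in> gen T S3" "b \<in> gen T S3"
    using S(3,4) gen_mono[of S1 S3 T] gen_mono[of S2 S3 T] S3(2) by auto
  then have "a \<inter> b \<in> sets (genM T S3)" by (intro sets.Int) auto
  then show "a \<inter> b \<in> (\<Union>S'\<in>\<S>. gen T S')" using S3(1) by auto
qed

lemma measurable_incr_vimage:
  assumes "a \<in> K"
  shows "incr p a \<in> borel_measurable (vimage_algebra \<Omega> (\<lambda>\<omega>. \<lambda>a\<in>K. incr p a \<omega>) (PiM K (\<lambda>_. borel)))"
proof -
  let ?V = "vimage_algebra \<Omega> (\<lambda>\<omega>. \<lambda>a\<in>K. incr p a \<omega>) (PiM K (\<lambda>_. borel :: real measure))"
  have m: "(\<lambda>\<omega>. \<lambda>a\<in>K. incr p a \<omega>) \<in> ?V \<rightarrow>\<^sub>M PiM K (\<lambda>_. borel)"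
    by (intro measurable_vimage_algebra1) (simp add: space_PiM)
  have "(\<lambda>\<omega>. (\<lambda>a\<in>K. incr p a \<omega>) a) \<in> borel_measurable ?V"
    by (rule measurable_compose[OF m]) (rule measurable_component_singleton[OF assms])
  then show ?thesis using assms by simp
qed

text \<open>The coordinates observable at time \<open>c\<close>: \<open>W\<^sup>0\<close> up to
  \<open>c\<close>, every other Brownian motion over the whole horizon.
  \<open>gen T (past T c)\<close> is the filtration before null sets are added.\<close>

definition past :: "real \<Rightarrow> real \<Rightarrow> (nat list \<times> real) set" where
  "past T c = {[]} \<times> {0..c} \<union> (Iset - {[]}) \<times> {0..T}"

section \<open>Invariance of the Wiener measure under reflection\<close>

locale bm_space =
  fixes T :: real and M0 P :: "('d::finite) omega measure"
  assumes T_pos: "0 < T" and M0: "canonical_BM_measure T M0" and P_eq: "P = completion M0"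
begin

lemma space_M0[simp]: "space M0 = Omega T" and sets_M0: "sets M0 = gen T (Iset \<times> {0..T})"
  using M0 unfolding canonical_BM_measure_def by auto

lemma space_P[simp]: "space P = Omega T"
  unfolding P_eq by simp

sublocale M0: prob_space M0
  using M0 unfolding canonical_BM_measure_def by auto

sublocale P: prob_space P
proof
  show "emeasure P (space P) = 1"
    unfolding P_eq by (simp add: M0.emeasure_space_1[simplified] sets.top[of M0, simplified])
qed

lemma indep_vars_incr:
  assumes "partition_of T n p"
  shows "M0.indep_vars (\<lambda>_. borel) (incr p) (inc_idx n)"
  using M0 assms unfolding canonical_BM_measure_def partition_of_def incr_def by blast

lemma distributed_incr:
  assumes "partition_of T n p" "a \<in> inc_idx n"
  shows "distributed M0 lborel (incr p a) (normal_density 0 (sqrt (p (Suc (snd a)) - p (snd a))))"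
  using M0 assms unfolding canonical_BM_measure_def partition_of_def incr_def by (cases a) auto

lemma random_variable_incr:
  assumes "partition_of T n p" "a \<in> inc_idx n"
  shows "incr p a \<in> borel_measurable M0"
  using distributed_measurable[OF distributed_incr[OF assms]] by simp

context
  fixes t r :: real
  assumes tr: "0 \<le> t" "t < r" "r \<le> T"
begin

lemma flip_measurable_M0: "flip T t r \<in> M0 \<rightarrow>\<^sub>M M0"
proof -
  have "flip T t r \<in> genM T (Iset \<times> {0..T}) \<rightarrow>\<^sub>M genM T (Iset \<times> {0..T})"
    by (rule flip_measurable_genM) (use tr in auto)
  then show ?thesis
    by (subst measurable_cong_sets[of _ "genM T (Iset \<times> {0..T})" _ "genM T (Iset \<times> {0..T})"])
       (simp_all add: sets_M0)
qed

text \<open>Since \<open>t\<close> and \<open>r\<close> are nodes, no increment straddles an end of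
  the reflected interval, and the reflection merely changes the sign of some increments. They are
  independent centred Gaussians, so their joint law is unaffected.\<close>

lemma emeasure_flip_finite:
  assumes F: "finite F" "{0, t, r} \<subseteq> F" "F \<subseteq> {0..T}" and E: "E \<in> gen T (Iset \<times> F)"
  shows "emeasure M0 (flip T t r -` E \<inter> Omega T) = emeasure M0 E"
proof -
  obtain n p where p: "partition_of T n p" "p ` {..n} = F"
    using partition_of_finite_set[of F T] F by blast
  let ?K = "inc_idx n :: ((nat list \<times> 'd) \<times> nat) set"
  let ?D = "\<lambda>\<omega>. \<lambda>a\<in>?K. incr p a \<omega>"
  let ?PM = "PiM ?K (\<lambda>_. borel :: real measure)"
  obtain l1 l2 where l: "l1 \<le> n" "t = p l1" "l2 \<le> n" "r = p l2"
    using p(2) F(2) by (metis (no_types, lifting) atMost_iff imageE insert_subset)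
  have l12: "l1 < l2"
    using partition_of_mono[OF p(1), of l2 l1] l tr(2) by (meson leD not_le_imp_less)
  then have "n > 0" using l by simp
  then have K_ne: "?K \<noteq> {}" using Nil_in_Iset by blast
  \<comment> \<open>The sign pattern: -1 exactly for the increments of \<open>W\<^sup>0\<close>
    between the nodes \<open>l1\<close> and \<open>l2\<close>, that is, inside
    \<open>[t, r]\<close>.\<close>
  define sg :: "(nat list \<times> 'd) \<times> nat \<Rightarrow> real"
    where "sg a = (if fst (fst a) = [] \<and> l1 \<le> snd a \<and> snd a < l2 then -1 else 1)" for a
  have incr_flip: "incr p a (flip T t r \<omega>) = sg a * incr p a \<omega>" if aK: "a \<in> ?K" for a \<omega>
  proof -
    obtain i j k where a: "a = ((i, j), k)" by (metis surj_pair)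
    have k: "k < n" using aK a by simp
    note R = partition_of_range[OF p(1)]
    have eq: "incr p a \<omega>' = (\<omega>' i (p (Suc k)) - \<omega>' i (p k)) $ j" for \<omega>' by (simp add: incr_def a)
    show ?thesis
    proof (cases "i = []")
      case i: True
      consider "Suc k \<le> l1" | "l1 \<le> k" "Suc k \<le> l2" | "l2 \<le> k" by linarith
      then show ?thesis
      proof cases
        case 1
        then have "p (Suc k) \<le> t" "p k \<le> t" using partition_of_mono[OF p(1)] l by auto
        then show ?thesis using 1 l12 tr by (simp only: eq) (simp add: sg_def a flip_before)
      next
        case 2
        then have "t \<le> p k" "p k \<le> r" "t \<le> p (Suc k)" "p (Suc k) \<le> r"
          using partition_of_mono[OF p(1)] l k by auto
        then show ?thesis using 2 tr i
          by (simp only: eq) (simp add: flip_increment_inside sg_def a)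
      next
        case 3
        then have "r \<le> p k" "r \<le> p (Suc k)" using partition_of_mono[OF p(1)] l k by auto
        then show ?thesis using 3 tr i R[of k] R[of "Suc k"] k
          by (simp only: eq) (simp add: flip_increment_after sg_def a)
      qed
    next
      case False
      then show ?thesis by (simp only: eq) (simp add: flip_other sg_def a)
    qed
  qed
  note rv = random_variable_incr[OF p(1)]
  have Dm: "?D \<in> M0 \<rightarrow>\<^sub>M ?PM" by (rule measurable_restrict) (use rv in auto)
  have rv': "(\<lambda>\<omega>. sg a * incr p a \<omega>) \<in> borel_measurable M0" if "a \<in> ?K" for a
    using rv[OF that] by simp
  have D'm: "(\<lambda>\<omega>. \<lambda>a\<in>?K. sg a * incr p a \<omega>) \<in> M0 \<rightarrow>\<^sub>M ?PM"
    by (rule measurable_restrict) (use rv' in auto)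
  have ind': "M0.indep_vars (\<lambda>_. borel) (\<lambda>a \<omega>. sg a * incr p a \<omega>) ?K"
    by (rule M0.indep_vars_compose2[OF indep_vars_incr[OF p(1)]]) auto
  have d1: "distr M0 borel (\<lambda>\<omega>. sg a * incr p a \<omega>) = distr M0 borel (incr p a)" if aK: "a \<in> ?K" for a
  proof (cases "sg a = 1")
    case False
    then have sg: "sg a = -1" by (auto simp: sg_def split: if_splits)
    let ?s = "sqrt (p (Suc (snd a)) - p (snd a))"
    have s: "0 < ?s" using aK partition_of_less[OF p(1), of "snd a" "Suc (snd a)"] by auto
    note D1 = distributed_incr[OF p(1) aK]
    \<comment> \<open>Symmetry of the centred normal law, as the affine image with slope -1.\<close>
    have D2: "distributed M0 lborel (\<lambda>\<omega>. 0 + (-1) * incr p a \<omega>) (normal_density (0 + (-1) * 0) (\<bar>-1\<bar> * ?s))"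
      by (rule M0.normal_density_affine[OF D1 s]) simp
    have "distr M0 lborel (\<lambda>\<omega>. sg a * incr p a \<omega>) = distr M0 lborel (incr p a)"
      using distributed_distr_eq_density[OF D1] distributed_distr_eq_density[OF D2] sg by simp
    then show ?thesis
      by (metis (no_types, lifting) distr_cong sets_lborel)
  qed simp
  have "distr M0 ?PM (\<lambda>\<omega>. \<lambda>a\<in>?K. sg a * incr p a \<omega>) = PiM ?K (\<lambda>a. distr M0 borel (\<lambda>\<omega>. sg a * incr p a \<omega>))"
    using M0.indep_vars_iff_distr_eq_PiM'[THEN iffD1, OF K_ne rv' ind'] by simp
  also have "\<dots> = PiM ?K (\<lambda>a. distr M0 borel (incr p a))"
    by (rule PiM_cong) (use d1 in auto)
  also have "\<dots> = distr M0 ?PM ?D"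
    using M0.indep_vars_iff_distr_eq_PiM'[THEN iffD1, OF K_ne rv indep_vars_incr[OF p(1)]] by simp
  finally have eq: "distr M0 ?PM (\<lambda>\<omega>. \<lambda>a\<in>?K. sg a * incr p a \<omega>) = distr M0 ?PM ?D" .
  have "E \<in> sets (vimage_algebra (Omega T) ?D ?PM)"
  proof (rule subsetD[OF gen_subset_vimage_incr E])
    show "p 0 = 0" using p(1) by (simp add: partition_of_def)
    fix i s assume "(i, s) \<in> Iset \<times> F"
    then obtain l where "i \<in> Iset" "l \<le> n" "s = p l" using p(2) by auto
    then show "i \<in> Iset \<and> (\<exists>l. s = p l \<and> (\<forall>j. \<forall>k<l. ((i, j), k) \<in> ?K))" by auto
  qed
  then obtain E' where E': "E' \<in> sets ?PM" "E = ?D -` E' \<inter> Omega T"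
    by (subst (asm) sets_vimage_algebra2) (auto simp: space_PiM)
  have "?D (flip T t r \<omega>) = (\<lambda>a\<in>?K. sg a * incr p a \<omega>)" for \<omega>
    using incr_flip by auto
  then have "flip T t r -` E \<inter> Omega T = (\<lambda>\<omega>. \<lambda>a\<in>?K. sg a * incr p a \<omega>) -` E' \<inter> Omega T"
    using E'(2) tr by (auto simp: flip_in_Omega)
  then have "emeasure M0 (flip T t r -` E \<inter> Omega T) = emeasure (distr M0 ?PM (\<lambda>\<omega>. \<lambda>a\<in>?K. sg a * incr p a \<omega>)) E'"
    using emeasure_distr[OF D'm E'(1)] by simp
  also have "\<dots> = emeasure M0 E"
    unfolding eq using emeasure_distr[OF Dm E'(1)] E'(2) by simp
  finally show ?thesis .
qed

text \<open>Two probability measures that agree on the intersection-stable generator of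
  finite-dimensional events. Adding 0, \<open>t\<close> and \<open>r\<close> to the finite time set
  costs nothing.\<close>

lemma distr_flip_M0: "distr M0 M0 (flip T t r) = M0"
proof -
  define \<S> where "\<S> = {Iset \<times> F | F. finite F \<and> {0, t, r} \<subseteq> F \<and> F \<subseteq> {0..T}}"
  have sig: "sigma_sets (Omega T) (\<Union>S'\<in>\<S>. gen T S') = (gen T (Iset \<times> {0..T}) :: 'd omega set set)"
  proof (rule sigma_sets_UN_gen)
    fix x assume x: "x \<in> Iset \<times> {0..T}"
    have "Iset \<times> {0, t, r, snd x} \<in> \<S>" unfolding \<S>_def using tr x by (intro CollectI exI[of _ "{0, t, r, snd x}"]) auto
    then show "\<exists>S'\<in>\<S>. x \<in> S'" by (rule bexI[rotated]) (use x in auto)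
  qed (auto simp: \<S>_def)
  have S0: "Iset \<times> {0, t, r} \<in> \<S>" unfolding \<S>_def using tr by (intro CollectI exI[of _ "{0, t, r}"]) auto
  show ?thesis
  proof (rule measure_eqI_generator_eq[where \<Omega>="Omega T" and E="\<Union>S'\<in>\<S>. gen T S'" and A="\<lambda>_. Omega T"])
    show "Int_stable (\<Union>S'\<in>\<S>. gen T S' :: 'd omega set set)"
    proof (rule Int_stable_UN_gen)
      fix S1 S2 assume "S1 \<in> \<S>" "S2 \<in> \<S>"
      then obtain F1 F2 where F: "S1 = Iset \<times> F1" "finite F1" "{0, t, r} \<subseteq> F1" "F1 \<subseteq> {0..T}"
        "S2 = Iset \<times> F2" "finite F2" "{0, t, r} \<subseteq> F2" "F2 \<subseteq> {0..T}" unfolding \<S>_def by auto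
      then show "\<exists>S3\<in>\<S>. S1 \<union> S2 \<subseteq> S3"
        by (intro bexI[of _ "Iset \<times> (F1 \<union> F2)"]) (auto simp: \<S>_def)
    qed
    show "(\<Union>S'\<in>\<S>. gen T S') \<subseteq> Pow (Omega T)" using gen_subset_Pow by blast
    fix E assume "E \<in> (\<Union>S'\<in>\<S>. gen T S' :: 'd omega set set)"
    then obtain F where F: "finite F" "{0, t, r} \<subseteq> F" "F \<subseteq> {0..T}" "E \<in> gen T (Iset \<times> F)"
      unfolding \<S>_def by blast
    have "E \<in> sets M0" using F(4) gen_mono[of "Iset \<times> F" "Iset \<times> {0..T}" T] F(3) by (auto simp: sets_M0)
    then show "emeasure (distr M0 M0 (flip T t r)) E = emeasure M0 E"
      using emeasure_flip_finite[OF F] by (subst emeasure_distr[OF flip_measurable_M0]) auto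
  next
    show "range (\<lambda>_. Omega T) \<subseteq> (\<Union>S'\<in>\<S>. gen T S' :: 'd omega set set)"
      using S0 sets.top[of "genM T (Iset \<times> {0, t, r})"] by auto
    show "emeasure (distr M0 M0 (flip T t r)) (Omega T) \<noteq> \<infinity>"
      using sets.top[of M0] by (subst emeasure_distr[OF flip_measurable_M0]) auto
  qed (auto simp: sig sets_M0)
qed

end

end

section \<open>Filtration and independence of increments\<close>

context bm_space begin

lemma sets_M0_subset_P: "sets M0 \<subseteq> sets P"
  unfolding P_eq by auto

lemma complete_measure_P: "complete_measure P"
  unfolding P_eq by (rule completion.complete_measure_axioms)

context
  fixes t r :: real
  assumes tr: "0 \<le> t" "t < r" "r \<le> T"
begin

text \<open>Preservation of \<open>M0\<close> pulls null sets back to null sets, so measurability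
  and invariance pass to the completion.\<close>

lemma flip_P: "flip T t r \<in> P \<rightarrow>\<^sub>M P" "distr P P (flip T t r) = P"
proof -
  interpret complete_measure P by (rule complete_measure_P)
  have m: "flip T t r \<in> P \<rightarrow>\<^sub>M M0"
    unfolding P_eq by (rule measurable_completion[OF flip_measurable_M0[OF tr]])
  have d: "distr P M0 (flip T t r) = M0"
    unfolding P_eq using distr_completion[OF flip_measurable_M0[OF tr]] distr_flip_M0[OF tr] by simp
  show "flip T t r \<in> P \<rightarrow>\<^sub>M P"
    using measurable_completion2[OF m] d by (simp add: P_eq)
  show "distr P P (flip T t r) = P"
    using completion_distr_eq[OF m] d by (simp add: P_eq)
qed

text \<open>This transports the equations, which hold only almost surely, to the reflected
  path.\<close>

lemma AE_flip:
  assumes "AE \<omega> in P. Q \<omega>" shows "AE \<omega> in P. Q (flip T t r \<omega>)"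
proof (rule AE_distrD[OF flip_P(1)])
  show "AE \<omega> in distr P P (flip T t r). Q \<omega>" unfolding flip_P(2) by (rule assms)
qed

lemma nn_integral_flip:
  assumes "h \<in> borel_measurable P"
  shows "(\<integral>\<^sup>+\<omega>. h (flip T t r \<omega>) \<partial>P) = (\<integral>\<^sup>+\<omega>. h \<omega> \<partial>P)"
  using nn_integral_distr[OF flip_P(1), of h] flip_P(2) assms by simp

lemma flip_Omega: "\<omega> \<in> Omega T \<Longrightarrow> flip T t r \<omega> \<in> Omega T"
  using tr by (simp add: flip_in_Omega)

end

abbreviation "F s \<equiv> Filt T P s"

lemma Filt_gen_subset:
  "gen T ({[]} \<times> {0..t}) \<union> null_sets P \<union> gen T ((Iset - {[]}) \<times> {0..T}) \<subseteq> Pow (Omega T)"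
proof (intro Un_least gen_subset_Pow)
  show "null_sets P \<subseteq> Pow (Omega T)" using sets.sets_into_space[of _ P] by auto
qed

lemma space_Filt[simp]: "space (F t) = Omega T"
  unfolding Filt_def using Filt_gen_subset by simp

lemma sets_Filt: "sets (F t) = sigma_sets (Omega T)
     (gen T ({[]} \<times> {0..t}) \<union> null_sets P \<union> gen T ((Iset - {[]}) \<times> {0..T}))"
  unfolding Filt_def using Filt_gen_subset by simp

lemma gen_subset_P: "S \<subseteq> Iset \<times> {0..T} \<Longrightarrow> gen T S \<subseteq> sets P"
  using gen_mono[of S "Iset \<times> {0..T}" T] sets_M0_subset_P sets_M0 by blast

lemma sets_Filt_subset:
  assumes "t \<le> T" shows "sets (F t) \<subseteq> sets P"
proof -
  have "gen T ({[]} \<times> {0..t}) \<union> null_sets P \<union> gen T ((Iset - {[]}) \<times> {0..T}) \<subseteq> sets P"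
    by (intro Un_least gen_subset_P) (use assms in auto)
  then show ?thesis unfolding sets_Filt using sets.sigma_sets_subset[of _ P] by simp
qed

lemma sets_Filt_mono:
  assumes "s \<le> t" shows "sets (F s) \<subseteq> sets (F t)"
  unfolding sets_Filt
proof (rule sigma_sets_mono')
  have "gen T ({[]} \<times> {0..s}) \<subseteq> gen T ({[]} \<times> {0..t})"
    using assms by (intro gen_mono) auto
  then show "gen T ({[]} \<times> {0..s}) \<union> null_sets P \<union> gen T ((Iset - {[]}) \<times> {0..T})
    \<subseteq> gen T ({[]} \<times> {0..t}) \<union> null_sets P \<union> gen T ((Iset - {[]}) \<times> {0..T})" by blast
qed

lemma measurable_Filt_mono: "f \<in> F s \<rightarrow>\<^sub>M N \<Longrightarrow> s \<le> t \<Longrightarrow> f \<in> F t \<rightarrow>\<^sub>M N"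
  using sets_Filt_mono[of s t] unfolding measurable_def by auto

lemma measurable_Filt_P: "f \<in> F s \<rightarrow>\<^sub>M N \<Longrightarrow> s \<le> T \<Longrightarrow> f \<in> P \<rightarrow>\<^sub>M N"
  using sets_Filt_subset[of s] unfolding measurable_def by auto

lemma W_measurable_Filt:
  assumes "0 \<le> s" "s \<le> t" shows "(\<lambda>\<omega>. \<omega> [] s) \<in> borel_measurable (F t)"
proof -
  have "(\<lambda>\<omega>. \<omega> [] s) \<in> borel_measurable (genM T ({[]} \<times> {0..t}))"
    by (rule measurable_coord) (use assms in auto)
  moreover have "gen T ({[]} \<times> {0..t}) \<subseteq> sets (F t)"
    unfolding sets_Filt using sigma_sets_superset_generator by blast
  ultimately show ?thesis unfolding measurable_def by auto
qed

text \<open>The events that agree almost surely with an uncompleted past event form a sigma-algebra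
  containing all generators of the filtration. The reduction matters because invariance under the
  reflection is pointwise, and independence is available, only before completion.\<close>

lemma Filt_eq_AE_gen_past:
  assumes "A \<in> sets (F c)" "0 \<le> c" "c \<le> T"
  shows "\<exists>A'\<in>gen T (past T c). AE \<omega> in P. \<omega> \<in> A \<longleftrightarrow> \<omega> \<in> A'"
  using assms(1) unfolding sets_Filt
proof (induction rule: sigma_sets.induct)
  case (Basic a)
  have "gen T ({[]} \<times> {0..c}) \<subseteq> gen T (past T c)" "gen T ((Iset - {[]}) \<times> {0..T}) \<subseteq> gen T (past T c)"
    by (intro gen_mono; auto simp: past_def)+
  moreover have "\<exists>A'\<in>gen T (past T c). AE \<omega> in P. \<omega> \<in> a \<longleftrightarrow> \<omega> \<in> A'" if "a \<in> null_sets P"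
    by (rule bexI[of _ "{}"]) (use AE_not_in[OF that] sets.empty_sets[of "genM T (past T c)"] in auto)
  ultimately show ?case using Basic by blast
next
  case Empty
  show ?case by (rule bexI[of _ "{}"]) (use sets.empty_sets[of "genM T (past T c)"] in auto)
next
  case (Compl a)
  then obtain A' where A': "A' \<in> gen T (past T c)" "AE \<omega> in P. \<omega> \<in> a \<longleftrightarrow> \<omega> \<in> A'" by blast
  show ?case
  proof
    show "Omega T - A' \<in> gen T (past T c)" using A'(1) sets.compl_sets[of A' "genM T (past T c)"] by simp
    show "AE \<omega> in P. \<omega> \<in> Omega T - a \<longleftrightarrow> \<omega> \<in> Omega T - A'" using A'(2) by (rule AE_mp) (rule AE_I2, simp)
  qed
next
  case (Union a)
  then have "\<forall>i. \<exists>A'. A' \<in> gen T (past T c) \<and> (AE \<omega> in P. \<omega> \<in> a i \<longleftrightarrow> \<omega> \<in> A')" by blast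
  from choice[OF this] obtain A' where
    A': "\<And>i::nat. A' i \<in> gen T (past T c)" "\<And>i. AE \<omega> in P. \<omega> \<in> a i \<longleftrightarrow> \<omega> \<in> A' i" by blast
  show ?case
  proof
    have "(\<Union>i. A' i) \<in> sets (genM T (past T c))"
      by (rule sets.countable_nat_UN) (use A'(1) in auto)
    then show "(\<Union>i. A' i) \<in> gen T (past T c)" by simp
    have "AE \<omega> in P. \<forall>i. \<omega> \<in> a i \<longleftrightarrow> \<omega> \<in> A' i" using A'(2) by (simp add: AE_all_countable)
    then show "AE \<omega> in P. \<omega> \<in> (\<Union>i. a i) \<longleftrightarrow> \<omega> \<in> (\<Union>i. A' i)" by (rule AE_mp) (rule AE_I2, simp)
  qed
qed

context
  fixes t r :: real
  assumes tr: "0 \<le> t" "t < r" "r \<le> T"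
begin

text \<open>Valid also for \<open>s\<close> inside the reflected interval, because the reflection is
  non-anticipating; null sets are handled by invariance of \<open>P\<close>.\<close>

lemma flip_Filt: "flip T t r \<in> F s \<rightarrow>\<^sub>M F s" if "s \<le> T"
proof (rule measurable_sigma_sets[OF sets_Filt])
  show "flip T t r \<in> space (F s) \<rightarrow> Omega T" using flip_Omega[OF tr] by auto
  fix A assume A: "A \<in> gen T ({[]} \<times> {0..s}) \<union> null_sets P \<union> gen T ((Iset - {[]}) \<times> {0..T})"
  let ?S = "gen T ({[]} \<times> {0..s}) \<union> null_sets P \<union> gen T ((Iset - {[]}) \<times> {0..T}) :: 'd omega set set"
  have m1: "flip T t r \<in> genM T ({[]} \<times> {0..s}) \<rightarrow>\<^sub>M (genM T ({[]} \<times> {0..s}) :: 'd omega measure)"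
    by (rule flip_measurable_genM) (use tr that in auto)
  have m2: "flip T t r \<in> genM T ((Iset - {[]}) \<times> {0..T}) \<rightarrow>\<^sub>M (genM T ((Iset - {[]}) \<times> {0..T}) :: 'd omega measure)"
    by (rule flip_measurable_genM) (use tr in auto)
  have "flip T t r -` A \<inter> Omega T \<in> null_sets P" if "A \<in> null_sets P"
  proof -
    have A: "A \<in> null_sets (distr P P (flip T t r))" using that flip_P(2)[OF tr] by simp
    show ?thesis using A null_sets_distr_iff[OF flip_P(1)[OF tr], of A] by simp
  qed
  then have "flip T t r -` A \<inter> Omega T \<in> ?S"
    using A measurable_sets[OF m1, of A] measurable_sets[OF m2, of A] by auto
  then show "flip T t r -` A \<inter> space (F s) \<in> sets (F s)"
    unfolding sets_Filt by (simp add: sigma_sets.Basic)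
qed (use Filt_gen_subset in auto)

lemma flip_invariant_gen_past:
  assumes "A \<in> gen T (past T t)" "\<omega> \<in> Omega T"
  shows "flip T t r \<omega> \<in> A \<longleftrightarrow> \<omega> \<in> A"
  using assms(1) unfolding gen_def
proof (induction rule: sigma_sets.induct)
  case (Basic a)
  then obtain i s B where a: "a = {\<omega> \<in> Omega T. \<omega> i s \<in> B}" "(i, s) \<in> past T t" by blast
  have "flip T t r \<omega> i s = \<omega> i s"
    using a(2) tr by (cases "i = []") (auto simp: past_def flip_before flip_other)
  then show ?case using a(1) assms(2) flip_Omega[OF tr] by auto
qed (use assms(2) flip_Omega[OF tr] in auto)

lemma flip_invariant_Filt:
  assumes "A \<in> sets (F t)"
  shows "AE \<omega> in P. flip T t r \<omega> \<in> A \<longleftrightarrow> \<omega> \<in> A"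
proof -
  obtain A' where A': "A' \<in> gen T (past T t)" "AE \<omega> in P. \<omega> \<in> A \<longleftrightarrow> \<omega> \<in> A'"
    using Filt_eq_AE_gen_past[OF assms] tr by auto
  have "AE \<omega> in P. \<omega> \<in> Omega T" by (rule AE_I2) simp
  with A'(2) AE_flip[OF tr A'(2)] show ?thesis
    by eventually_elim (use flip_invariant_gen_past[OF A'(1)] in auto)
qed

lemma flip_invariant_fun:
  fixes U :: "'d omega \<Rightarrow> 'b::{second_countable_topology,t2_space}"
  assumes "U \<in> borel_measurable (F t)"
  shows "AE \<omega> in P. U (flip T t r \<omega>) = U \<omega>"
proof -
  obtain B :: "'b set set" where B: "countable B" "topological_basis B"
    using ex_countable_basis by blast
  have "AE \<omega> in P. \<forall>b\<in>B. U (flip T t r \<omega>) \<in> b \<longleftrightarrow> U \<omega> \<in> b"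
  proof (subst AE_ball_countable[OF B(1)], intro ballI)
    fix b assume "b \<in> B"
    then have "b \<in> sets borel" using topological_basis_open[OF B(2)] by simp
    from flip_invariant_Filt[OF measurable_sets[OF assms this]] have "AE \<omega> in P. flip T t r \<omega> \<in> U -` b \<inter> Omega T \<longleftrightarrow> \<omega> \<in> U -` b \<inter> Omega T"
      by simp
    moreover have "AE \<omega> in P. \<omega> \<in> Omega T" by (rule AE_I2) simp
    ultimately show "AE \<omega> in P. U (flip T t r \<omega>) \<in> b \<longleftrightarrow> U \<omega> \<in> b"
      by eventually_elim (use flip_Omega[OF tr] in auto)
  qed
  then show ?thesis
  proof eventually_elim
    fix \<omega> assume *: "\<forall>b\<in>B. U (flip T t r \<omega>) \<in> b \<longleftrightarrow> U \<omega> \<in> b"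
    show "U (flip T t r \<omega>) = U \<omega>"
    proof (rule ccontr)
      assume "U (flip T t r \<omega>) \<noteq> U \<omega>"
      then obtain V where V: "open V" "U (flip T t r \<omega>) \<in> V" "U \<omega> \<notin> V" using t1_space by blast
      then obtain b where "b \<in> B" "U (flip T t r \<omega>) \<in> b" "b \<subseteq> V" using topological_basisE[OF B(2) V(1,2)] by blast
      then show False using * V by blast
    qed
  qed
qed

end

text \<open>At finitely many times, past events depend on one block of increments and
  \<open>W\<^sup>0\<close> over \<open>[c, b]\<close> on a disjoint block; disjoint blocks of an
  independent family are independent. The general case follows from stability of the generators
  under intersection.\<close>

lemma indep_past_increment:
  assumes cb: "0 \<le> c" "c < b" "b \<le> T"
  shows "M0.indep_set (gen T (past T c)) (sigma_sets (Omega T) {(\<lambda>\<omega>. \<omega> [] b - \<omega> [] c) -` B \<inter> Omega T | B. B \<in> sets borel})"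
proof -
  let ?S = "\<lambda>F. {[]} \<times> (F \<inter> {0..c}) \<union> (Iset - {[]}) \<times> F"
  let ?dW = "\<lambda>\<omega>. \<omega> [] b - \<omega> [] c"
  let ?G = "{?dW -` B \<inter> Omega T | B. B \<in> sets borel} :: 'd omega set set"
  define \<S> where "\<S> = {?S F | F. finite F \<and> {0, c, b} \<subseteq> F \<and> F \<subseteq> {0..T}}"
  have sig: "sigma_sets (Omega T) (\<Union>S'\<in>\<S>. gen T S') = (gen T (past T c) :: 'd omega set set)"
  proof (rule sigma_sets_UN_gen)
    fix x assume x: "x \<in> past T c"
    have "?S {0, c, b, snd x} \<in> \<S>"
      unfolding \<S>_def using cb x by (intro CollectI exI[of _ "{0, c, b, snd x}"]) (auto simp: past_def)
    then show "\<exists>S'\<in>\<S>. x \<in> S'" by (rule bexI[rotated]) (use x in \<open>auto simp: past_def\<close>)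
  qed (auto simp: \<S>_def past_def)
  have dW_M0: "?dW \<in> borel_measurable M0"
    using cb by (subst measurable_cong_sets[of _ "genM T (Iset \<times> {0..T})" _ borel])
      (auto simp: sets_M0 intro!: borel_measurable_diff measurable_coord)
  have evG: "?G \<subseteq> sets M0" using measurable_sets[OF dW_M0] by auto
  have "M0.indep_set (\<Union>S'\<in>\<S>. gen T S') ?G"
  proof (rule M0.indep_setI)
    show "(\<Union>S'\<in>\<S>. gen T S') \<subseteq> M0.events"
      unfolding sets_M0 by (intro UN_least gen_mono) (auto simp: \<S>_def)
    fix A E :: "'d omega set" assume "A \<in> (\<Union>S'\<in>\<S>. gen T S')" "E \<in> ?G"
    then obtain F B where F: "finite F" "{0, c, b} \<subseteq> F" "F \<subseteq> {0..T}" "A \<in> gen T (?S F)"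
      and B: "B \<in> sets borel" "E = ?dW -` B \<inter> Omega T" unfolding \<S>_def by blast
    obtain n p where p: "partition_of T n p" "p ` {..n} = F"
      using partition_of_finite_set[of F T] F by blast
    have p0: "p 0 = 0" using p(1) by (simp add: partition_of_def)
    obtain l1 l2 where l: "l1 \<le> n" "c = p l1" "l2 \<le> n" "b = p l2"
      using p(2) F(2) by (metis (no_types, lifting) atMost_iff imageE insert_subset)
    \<comment> \<open>\<open>K1\<close> collects the increments known at \<open>c\<close>: those of
      \<open>W\<^sup>0\<close> before \<open>c\<close> and all those of the other motions.
      \<open>K2\<close> collects the increments of \<open>W\<^sup>0\<close> from \<open>c\<close>
      on.\<close>
    define K1 :: "((nat list \<times> 'd) \<times> nat) set" where "K1 = {a \<in> inc_idx n. fst (fst a) \<noteq> [] \<or> snd a < l1}"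
    define K2 :: "((nat list \<times> 'd) \<times> nat) set" where "K2 = {a \<in> inc_idx n. fst (fst a) = [] \<and> l1 \<le> snd a}"
    let ?D = "\<lambda>K \<omega>. \<lambda>a\<in>K. incr p a \<omega>" and ?PM = "\<lambda>K. PiM K (\<lambda>_. borel :: real measure)"
    have ind: "M0.indep_var (?PM K1) (?D K1) (?PM K2) (?D K2)"
      by (rule M0.indep_var_restrict[OF indep_vars_incr[OF p(1)]]) (auto simp: K1_def K2_def)
    have vs: "sets (vimage_algebra (Omega T) (?D K) (?PM K)) = {?D K -` E' \<inter> Omega T | E'. E' \<in> sets (?PM K)}" for K
      by (rule sets_vimage_algebra2) (auto simp: space_PiM)
    have "A \<in> sets (vimage_algebra (Omega T) (?D K1) (?PM K1))"
    proof (rule subsetD[OF gen_subset_vimage_incr F(4)], rule p0)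
      fix i s assume iS: "(i, s) \<in> ?S F"
      then obtain l where l': "l \<le> n" "s = p l" using p(2) by auto
      \<comment> \<open>For the index \<open>[]\<close> the times in \<open>?S F\<close> are cut off
        at \<open>c\<close>, so only increments before the node \<open>l1\<close> are
        summed.\<close>
      have "l \<le> l1" if "i = []"
      proof (rule ccontr)
        assume "\<not> l \<le> l1"
        then have "p l1 < p l" using partition_of_less[OF p(1)] l' by auto
        then show False using iS that l(2) l'(2) by auto
      qed
      then show "i \<in> Iset \<and> (\<exists>l. s = p l \<and> (\<forall>j. \<forall>k<l. ((i, j), k) \<in> K1))"
        using iS l' by (intro conjI exI[of _ l]) (auto simp: K1_def)
    qed
    then have A: "A \<in> {?D K1 -` E' \<inter> Omega T | E'. E' \<in> sets (?PM K1)}" unfolding vs .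
    have "(\<lambda>\<omega>. \<chi> j. \<Sum>k\<in>{l1..<l2}. incr p (([], j), k) \<omega>) \<in> borel_measurable (vimage_algebra (Omega T) (?D K2) (?PM K2))"
      using l by (intro borel_measurable_vec_lambda borel_measurable_sum measurable_incr_vimage) (auto simp: K2_def)
    moreover have "l1 \<le> l2" using partition_of_less[OF p(1), of l2 l1] l cb by (meson leI less_asym)
    then have "(\<chi> j. \<Sum>k\<in>{l1..<l2}. incr p (([], j), k) \<omega>) = ?dW \<omega>" for \<omega> :: "'d omega"
      using l sum_Suc_diff'[of l1 l2 "\<lambda>k. \<omega> [] (p k) $ _"]
      by (simp add: vec_eq_iff incr_def)
    ultimately have "?dW \<in> borel_measurable (vimage_algebra (Omega T) (?D K2) (?PM K2))" by simp
    from measurable_sets[OF this B(1)] have E: "E \<in> {?D K2 -` E' \<inter> Omega T | E'. E' \<in> sets (?PM K2)}"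
      unfolding vs[symmetric] B(2) by simp
    show "M0.prob (A \<inter> E) = M0.prob A * M0.prob E"
      by (rule M0.indep_setD[of "sigma_sets (space M0) {?D K1 -` E' \<inter> space M0 | E'. E' \<in> sets (?PM K1)}"
            "sigma_sets (space M0) {?D K2 -` E' \<inter> space M0 | E'. E' \<in> sets (?PM K2)}"])
         (use ind[unfolded M0.indep_var_eq] A E in \<open>auto intro!: sigma_sets.Basic\<close>)
  qed (use evG in auto)
  then have "M0.indep_set (sigma_sets (space M0) (\<Union>S'\<in>\<S>. gen T S')) (sigma_sets (space M0) ?G)"
  proof (rule M0.indep_set_sigma_sets)
    show "Int_stable (\<Union>S'\<in>\<S>. gen T S' :: 'd omega set set)"
    proof (rule Int_stable_UN_gen)
      fix S1 S2 assume "S1 \<in> \<S>" "S2 \<in> \<S>"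
      then obtain F1 F2 where F: "S1 = ?S F1" "finite F1" "{0, c, b} \<subseteq> F1" "F1 \<subseteq> {0..T}"
        "S2 = ?S F2" "finite F2" "{0, c, b} \<subseteq> F2" "F2 \<subseteq> {0..T}" unfolding \<S>_def by auto
      show "\<exists>S3\<in>\<S>. S1 \<union> S2 \<subseteq> S3"
      proof
        show "?S (F1 \<union> F2) \<in> \<S>" unfolding \<S>_def using F by (intro CollectI exI[of _ "F1 \<union> F2"]) auto
      qed (use F in auto)
    qed
    show "Int_stable ?G"
    proof (rule Int_stableI)
      fix x y assume "x \<in> ?G" "y \<in> ?G"
      then obtain B1 B2 where "x = ?dW -` B1 \<inter> Omega T" "y = ?dW -` B2 \<inter> Omega T" "B1 \<in> sets borel" "B2 \<in> sets borel" by blast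
      then show "x \<inter> y \<in> ?G" by (intro CollectI exI[of _ "B1 \<inter> B2"]) auto
    qed
  qed
  then show ?thesis by (simp add: sig)
qed

end

section \<open>Moments of increments and of elementary integrals\<close>

context bm_space begin

lemma increment_measurable_M0:
  assumes "c \<in> {0..T}" "b \<in> {0..T}"
  shows "(\<lambda>\<omega>. \<omega> [] b - \<omega> [] c) \<in> borel_measurable M0"
  using assms by (subst measurable_cong_sets[of _ "genM T (Iset \<times> {0..T})" _ borel])
    (auto simp: sets_M0 intro!: borel_measurable_diff measurable_coord)

lemma increment_measurable_Filt:
  assumes "0 \<le> c" "c \<le> t" "0 \<le> b" "b \<le> t"
  shows "(\<lambda>\<omega>. \<omega> [] b - \<omega> [] c) \<in> borel_measurable (F t)"
  using W_measurable_Filt assms by (intro borel_measurable_diff) auto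

text \<open>Events of \<open>U\<close> are exchanged for almost surely equal uncompleted past
  events, for which the product formula holds under \<open>M0\<close>.\<close>

lemma indep_var_Filt:
  fixes U :: "'d omega \<Rightarrow> real" and g :: "real^'d \<Rightarrow> real"
  assumes cb: "0 \<le> c" "c < b" "b \<le> T" and U: "U \<in> borel_measurable (F c)"
    and g: "g \<in> borel_measurable borel"
  shows "P.indep_var borel U borel (\<lambda>\<omega>. g (\<omega> [] b - \<omega> [] c))"
  unfolding P.indep_var_eq
proof (intro conjI)
  let ?dW = "\<lambda>\<omega>. \<omega> [] b - \<omega> [] c"
  show "U \<in> borel_measurable P" using measurable_Filt_P[OF U] cb by simp
  have dW0: "?dW \<in> borel_measurable M0" by (rule increment_measurable_M0) (use cb in auto)
  then have gdW0: "(\<lambda>\<omega>. g (?dW \<omega>)) \<in> borel_measurable M0" using g by (rule measurable_compose)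
  then show "(\<lambda>\<omega>. g (?dW \<omega>)) \<in> borel_measurable P" unfolding P_eq by (rule measurable_completion)
  let ?A = "sigma_sets (space P) {U -` A \<inter> space P | A. A \<in> sets borel}"
  let ?B = "sigma_sets (space P) {(\<lambda>\<omega>. g (?dW \<omega>)) -` A \<inter> space P | A. A \<in> sets borel}"
  have "{U -` A \<inter> space P | A. A \<in> sets borel} \<subseteq> sets (F c)"
    using measurable_sets[OF U] by auto
  from sets.sigma_sets_subset[OF this] have A: "?A \<subseteq> sets (F c)" by simp
  have "{(\<lambda>\<omega>. g (?dW \<omega>)) -` A \<inter> space P | A. A \<in> sets borel} \<subseteq> sets M0"
    using measurable_sets[OF gdW0] by auto
  from sets.sigma_sets_subset[OF this] have B: "?B \<subseteq> sets M0" by simp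
  have B': "?B \<subseteq> sigma_sets (Omega T) {?dW -` A \<inter> Omega T | A. A \<in> sets borel}"
    unfolding space_P
  proof (rule sigma_sets_mono', safe)
    fix A :: "real set" assume "A \<in> sets borel"
    then show "\<exists>A'. (\<lambda>\<omega>. g (?dW \<omega>)) -` A \<inter> Omega T = ?dW -` A' \<inter> Omega T \<and> A' \<in> sets borel"
      using measurable_sets[OF g] by (intro exI[of _ "g -` A"]) auto
  qed
  show "P.indep_set ?A ?B"
    unfolding P.indep_sets2_eq
  proof (intro conjI ballI)
    show "?A \<subseteq> P.events" using A sets_Filt_subset[of c] cb by auto
    show "?B \<subseteq> P.events" using B sets_M0_subset_P by blast
    fix x y assume x: "x \<in> ?A" and y: "y \<in> ?B"
    obtain x' where x': "x' \<in> gen T (past T c)" "AE \<omega> in P. \<omega> \<in> x \<longleftrightarrow> \<omega> \<in> x'"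
      using Filt_eq_AE_gen_past[of x c] A x cb by auto
    have "past T c \<subseteq> Iset \<times> {0..T}" using cb by (auto simp: past_def)
    from subsetD[OF gen_mono[OF this] x'(1)] have x'M: "x' \<in> sets M0" by (simp add: sets_M0)
    have xP: "x \<in> sets P" using A x sets_Filt_subset[of c] cb by auto
    have yM: "y \<in> sets M0" using B y by auto
    have x'P: "x' \<in> sets P" and yP: "y \<in> sets P" using x'M yM sets_M0_subset_P by auto
    have "P.prob (x \<inter> y) = P.prob (x' \<inter> y)"
    proof (rule measure_eq_AE)
      show "AE \<omega> in P. \<omega> \<in> x \<inter> y \<longleftrightarrow> \<omega> \<in> x' \<inter> y" using x'(2) by eventually_elim auto
    qed (use xP x'P yP in auto)
    also have "\<dots> = M0.prob (x' \<inter> y)" unfolding P_eq using x'M yM by (intro measure_completion) auto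
    also have "\<dots> = M0.prob x' * M0.prob y"
      using M0.indep_setD[OF indep_past_increment[OF cb] x'(1)] y B' by blast
    also have "\<dots> = P.prob x' * P.prob y" unfolding P_eq using x'M yM by simp
    also have "P.prob x' = P.prob x" using x'(2) xP x'P by (intro measure_eq_AE) auto
    finally show "P.prob (x \<inter> y) = P.prob x * P.prob y" .
  qed
qed

text \<open>The covariance matrix of the increment is \<open>b - c\<close> times the identity: the
  diagonal comes from the variance of the normal law, the off-diagonal zeros from independence of
  the components.\<close>

lemma increment_moments:
  fixes i j :: 'd
  assumes cb: "0 \<le> c" "c < b" "b \<le> T"
  shows "has_bochner_integral P (\<lambda>\<omega>. (\<omega> [] b - \<omega> [] c) $ i) 0"
    and "has_bochner_integral P (\<lambda>\<omega>. (\<omega> [] b - \<omega> [] c) $ i * (\<omega> [] b - \<omega> [] c) $ j) (if i = j then b - c else 0)"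
proof -
  let ?d = "\<lambda>i \<omega>. (\<omega> [] b - \<omega> [] c) $ i"
  obtain n p where p: "partition_of T n p" "p ` {..n} = {0, c, b}"
    using partition_of_finite_set[of "{0, c, b}" T] cb by auto
  have "c \<in> p ` {..n}" "b \<in> p ` {..n}" unfolding p(2) by auto
  then obtain l m where l: "l \<le> n" "c = p l" and m: "m \<le> n" "b = p m" by blast
  have lm: "l < m" using partition_of_mono[OF p(1), of m l] l m cb by (meson leD not_le_imp_less)
  \<comment> \<open>The nodes are exactly 0, \<open>c\<close> and \<open>b\<close>, so nothing lies
    between \<open>c\<close> and \<open>b\<close> and the increment is a single
    \<open>incr\<close>.\<close>
  have "m = Suc l"
  proof (rule ccontr)
    assume "m \<noteq> Suc l"
    then have "Suc l < m" using lm by simp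
    then have "p l < p (Suc l)" "p (Suc l) < p m" "p (Suc l) \<in> {0, c, b}"
      using partition_of_less[OF p(1)] l m p(2) by auto
    then show False using l m cb by auto
  qed
  then have ln: "l < n" "b = p (Suc l)" using m by auto
  have inc: "incr p (([], i), l) = ?d i" for i by (auto simp: incr_def l ln)
  have aK: "(([], i), l) \<in> inc_idx n" for i :: 'd using ln by simp
  have D: "distributed M0 lborel (?d i) (normal_density 0 (sqrt (b - c)))" for i
    using distributed_incr[OF p(1) aK, of i] by (simp add: inc l ln)
  have s: "0 < sqrt (b - c)" using cb by simp
  have I1: "integrable M0 (?d i)" for i
    using distributed_integrable_var[OF D] integrable_normal_moment[OF s, of 0 1] by simp
  have E1: "M0.expectation (?d i) = 0" for i
    by (rule M0.normal_distributed_expectation[OF s D])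
  have I2: "integrable M0 (\<lambda>\<omega>. (?d i \<omega>)\<^sup>2)" for i
    using distributed_integrable[OF D, of "\<lambda>x. x\<^sup>2"] integrable_normal_moment[OF s, of 0 2] by simp
  have E2: "M0.expectation (\<lambda>\<omega>. (?d i \<omega>)\<^sup>2) = b - c" for i
    using M0.normal_distributed_variance[OF s D] cb unfolding E1 by simp
  have X: "integrable M0 (\<lambda>\<omega>. ?d i \<omega> * ?d j \<omega>) \<and> M0.expectation (\<lambda>\<omega>. ?d i \<omega> * ?d j \<omega>) = (if i = j then b - c else 0)"
  proof (cases "i = j")
    case True
    then show ?thesis using I2[of i] E2[of i] by (simp add: power2_eq_square)
  next
    case False
    let ?K = "{(([], i), l), (([], j), l)} :: ((nat list \<times> 'd) \<times> nat) set"
    have ind: "M0.indep_vars (\<lambda>_. borel) (incr p) ?K"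
      by (rule M0.indep_vars_subset[OF indep_vars_incr[OF p(1)]]) (use ln in auto)
    have int: "integrable M0 (incr p a)" if "a \<in> ?K" for a using that by (auto simp only: insert_iff empty_iff inc intro!: I1)
    show ?thesis
      using M0.indep_vars_lebesgue_integral[OF _ ind int] M0.indep_vars_integrable[OF _ ind int] False
        E1[of i] by (simp add: inc)
  qed
  have mM: "(\<lambda>\<omega>. \<omega> [] b - \<omega> [] c) \<in> borel_measurable M0" by (rule increment_measurable_M0) (use cb in auto)
  note mi = borel_measurable_vec_nth[OF mM]
  show "has_bochner_integral P (?d i) 0"
    unfolding P_eq has_bochner_integral_iff
    using I1[of i] E1[of i] integrable_completion[OF mi[of i]] integral_completion[OF mi[of i]] by simp
  have mij: "(\<lambda>\<omega>. ?d i \<omega> * ?d j \<omega>) \<in> borel_measurable M0" by (intro borel_measurable_times mi)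
  show "has_bochner_integral P (\<lambda>\<omega>. ?d i \<omega> * ?d j \<omega>) (if i = j then b - c else 0)"
    unfolding P_eq has_bochner_integral_iff
    using X integrable_completion[OF mij] integral_completion[OF mij] by simp
qed

text \<open>Independence factorises the expectations. The degenerate case \<open>c = b\<close> is
  separate because partitions are strictly increasing.\<close>

lemma weighted_increment_moments:
  fixes i j :: 'd
  assumes cb: "0 \<le> c" "c \<le> b" "b \<le> T" and U: "U \<in> borel_measurable (F c)" "integrable P U"
  shows "has_bochner_integral P (\<lambda>\<omega>. U \<omega> * (\<omega> [] b - \<omega> [] c) $ i) 0"
    and "has_bochner_integral P (\<lambda>\<omega>. U \<omega> * ((\<omega> [] b - \<omega> [] c) $ i * (\<omega> [] b - \<omega> [] c) $ j))
           (if i = j then (b - c) * P.expectation U else 0)"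
proof -
  let ?d = "\<lambda>\<omega>. \<omega> [] b - \<omega> [] c"
  have "has_bochner_integral P (\<lambda>\<omega>. U \<omega> * ?d \<omega> $ i) 0 \<and>
     has_bochner_integral P (\<lambda>\<omega>. U \<omega> * (?d \<omega> $ i * ?d \<omega> $ j)) (if i = j then (b - c) * P.expectation U else 0)"
  proof (cases "c = b")
    case True
    then show ?thesis by (simp add: has_bochner_integral_zero)
  next
    case False
    then have cb': "0 \<le> c" "c < b" "b \<le> T" using cb by auto
    have i1: "P.indep_var borel U borel (\<lambda>\<omega>. ?d \<omega> $ i)"
      by (rule indep_var_Filt[OF cb' U(1)]) (rule borel_measurable_vec_nth, simp)
    have i2: "P.indep_var borel U borel (\<lambda>\<omega>. ?d \<omega> $ i * ?d \<omega> $ j)"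
      by (rule indep_var_Filt[OF cb' U(1), of "\<lambda>x. x $ i * x $ j"])
        (intro borel_measurable_times borel_measurable_vec_nth, simp_all)
    note m = increment_moments[OF cb', unfolded has_bochner_integral_iff]
    show ?thesis
      unfolding has_bochner_integral_iff
      using P.indep_var_integrable[OF i1 U(2)] P.indep_var_lebesgue_integral[OF i1 U(2)]
        P.indep_var_integrable[OF i2 U(2)] P.indep_var_lebesgue_integral[OF i2 U(2)]
        m(1)[of i] m(2)[of i j] by auto
  qed
  then show "has_bochner_integral P (\<lambda>\<omega>. U \<omega> * ?d \<omega> $ i) 0"
    "has_bochner_integral P (\<lambda>\<omega>. U \<omega> * (?d \<omega> $ i * ?d \<omega> $ j)) (if i = j then (b - c) * P.expectation U else 0)"
    by auto
qed

definition bdd_Filt :: "real \<Rightarrow> ('d omega \<Rightarrow> real^'d) \<Rightarrow> bool" where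
  "bdd_Filt a \<xi> \<longleftrightarrow> \<xi> \<in> borel_measurable (F a) \<and> (\<exists>c. \<forall>\<omega>. norm (\<xi> \<omega>) \<le> c)"

lemma bdd_Filt_mono: "bdd_Filt a \<xi> \<Longrightarrow> a \<le> b \<Longrightarrow> bdd_Filt b \<xi>"
  unfolding bdd_Filt_def using measurable_Filt_mono by blast

lemma integrable_mult_bdd_Filt:
  assumes "bdd_Filt a \<xi>" "a \<le> T" "integrable P \<eta>"
  shows "integrable P (\<lambda>\<omega>. \<eta> \<omega> * \<xi> \<omega> $ i)"
proof -
  obtain c where c: "\<And>\<omega>. norm (\<xi> \<omega>) \<le> c" using assms(1) unfolding bdd_Filt_def by auto
  have m: "(\<lambda>\<omega>. \<xi> \<omega> $ i) \<in> borel_measurable P"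
    using assms measurable_Filt_P unfolding bdd_Filt_def by (intro borel_measurable_vec_nth) auto
  show ?thesis
  proof (rule Bochner_Integration.integrable_bound)
    show "integrable P (\<lambda>\<omega>. c * \<eta> \<omega>)" using assms(3) by simp
    show "(\<lambda>\<omega>. \<eta> \<omega> * \<xi> \<omega> $ i) \<in> borel_measurable P" using assms(3) m by measurable
    have "norm (\<eta> \<omega> * \<xi> \<omega> $ i) \<le> norm (c * \<eta> \<omega>)" for \<omega>
    proof -
      have "\<bar>\<xi> \<omega> $ i\<bar> \<le> c" using component_le_norm_cart[of "\<xi> \<omega>" i] c[of \<omega>] by linarith
      then have "\<bar>\<xi> \<omega> $ i\<bar> \<le> \<bar>c\<bar>" by linarith
      then show ?thesis by (simp add: abs_mult mult.commute[of "\<bar>c\<bar>"] mult_left_mono)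
    qed
    then show "AE \<omega> in P. norm (\<eta> \<omega> * \<xi> \<omega> $ i) \<le> norm (c * \<eta> \<omega>)" by simp
  qed
qed

text \<open>The elementary stochastic integral over \<open>]a, b]\<close> of an integrand frozen at
  time \<open>a\<close>.\<close>

definition G :: "real \<Rightarrow> real \<Rightarrow> ('d omega \<Rightarrow> real^'d) \<Rightarrow> 'd omega \<Rightarrow> real" where
  "G a b \<xi> \<omega> = \<xi> \<omega> \<bullet> (\<omega> [] b - \<omega> [] a)"

lemma G_self: "G a a \<xi> \<omega> = 0"
  by (simp add: G_def)

lemma G_split: "G a c \<xi> \<omega> = G a b \<xi> \<omega> + G b c \<xi> \<omega>"
  by (simp add: G_def inner_diff_right)

lemma G_measurable:
  assumes "bdd_Filt a \<xi>" "0 \<le> a" "a \<le> b"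
  shows "G a b \<xi> \<in> borel_measurable (F b)"
proof -
  have "\<xi> \<in> borel_measurable (F b)" using assms measurable_Filt_mono unfolding bdd_Filt_def by blast
  moreover have "(\<lambda>\<omega>. \<omega> [] b - \<omega> [] a) \<in> borel_measurable (F b)"
    using assms by (intro increment_measurable_Filt) auto
  ultimately show ?thesis unfolding G_def[abs_def] by (intro borel_measurable_inner)
qed

text \<open>The martingale property, tested against a weight known at time \<open>a\<close>; it is
  read off coordinate by coordinate.\<close>

lemma G_ortho:
  assumes "bdd_Filt a \<xi>" "0 \<le> a" "a \<le> b" "b \<le> T" "\<eta> \<in> borel_measurable (F a)" "integrable P \<eta>"
  shows "has_bochner_integral P (\<lambda>\<omega>. \<eta> \<omega> * G a b \<xi> \<omega>) 0"
proof -
  have "has_bochner_integral P (\<lambda>\<omega>. \<eta> \<omega> * \<xi> \<omega> $ i * (\<omega> [] b - \<omega> [] a) $ i) 0" for i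
  proof (rule weighted_increment_moments(1))
    show "(\<lambda>\<omega>. \<eta> \<omega> * \<xi> \<omega> $ i) \<in> borel_measurable (F a)"
      using assms unfolding bdd_Filt_def by (intro borel_measurable_times borel_measurable_vec_nth) auto
    show "integrable P (\<lambda>\<omega>. \<eta> \<omega> * \<xi> \<omega> $ i)"
      using assms by (intro integrable_mult_bdd_Filt[of a]) auto
  qed (use assms in auto)
  then have "has_bochner_integral P (\<lambda>\<omega>. \<Sum>i\<in>UNIV. \<eta> \<omega> * \<xi> \<omega> $ i * (\<omega> [] b - \<omega> [] a) $ i) (\<Sum>i\<in>(UNIV::'d set). 0)"
    by (intro has_bochner_integral_sum)
  then show ?thesis by (simp add: G_def inner_vec_def sum_distrib_left mult.assoc)
qed

lemma G_integrable:
  assumes "bdd_Filt a \<xi>" "0 \<le> a" "a \<le> b" "b \<le> T"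
  shows "integrable P (G a b \<xi>)"
proof -
  have "has_bochner_integral P (\<lambda>\<omega>. 1 * G a b \<xi> \<omega>) 0" by (rule G_ortho[OF assms]) auto
  then show ?thesis by (simp add: has_bochner_integral_iff)
qed

lemma G_ortho_G:
  assumes "bdd_Filt a \<xi>" "0 \<le> a" "a \<le> b" "b \<le> a'" "bdd_Filt a' \<xi>'" "a' \<le> b'" "b' \<le> T"
  shows "has_bochner_integral P (\<lambda>\<omega>. G a b \<xi> \<omega> * G a' b' \<xi>' \<omega>) 0"
proof (rule G_ortho)
  show "G a b \<xi> \<in> borel_measurable (F a')"
    by (rule measurable_Filt_mono[OF G_measurable]) (use assms in auto)
  show "integrable P (G a b \<xi>)" by (rule G_integrable) (use assms in auto)
qed (use assms in auto)

lemma G_same: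
  assumes "bdd_Filt a \<xi>" "bdd_Filt a \<xi>'" "0 \<le> a" "a \<le> b" "b \<le> T"
  shows "has_bochner_integral P (\<lambda>\<omega>. G a b \<xi> \<omega> * G a b \<xi>' \<omega>) ((b - a) * P.expectation (\<lambda>\<omega>. \<xi> \<omega> \<bullet> \<xi>' \<omega>))"
proof -
  let ?d = "\<lambda>\<omega>. \<omega> [] b - \<omega> [] a"
  have int: "integrable P (\<lambda>\<omega>. \<xi> \<omega> $ i * \<xi>' \<omega> $ j)" for i j
    using integrable_mult_bdd_Filt[OF assms(2), of "\<lambda>\<omega>. \<xi> \<omega> $ i"]
      integrable_mult_bdd_Filt[OF assms(1), of "\<lambda>_. 1"] assms by auto
  have "has_bochner_integral P (\<lambda>\<omega>. \<xi> \<omega> $ i * \<xi>' \<omega> $ j * (?d \<omega> $ i * ?d \<omega> $ j))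
     (if i = j then (b - a) * P.expectation (\<lambda>\<omega>. \<xi> \<omega> $ i * \<xi>' \<omega> $ j) else 0)" for i j
  proof (rule weighted_increment_moments(2))
    show "(\<lambda>\<omega>. \<xi> \<omega> $ i * \<xi>' \<omega> $ j) \<in> borel_measurable (F a)"
      using assms unfolding bdd_Filt_def by (intro borel_measurable_times borel_measurable_vec_nth) auto
  qed (use assms int in auto)
  then have "has_bochner_integral P (\<lambda>\<omega>. \<Sum>i\<in>UNIV. \<Sum>j\<in>UNIV. \<xi> \<omega> $ i * \<xi>' \<omega> $ j * (?d \<omega> $ i * ?d \<omega> $ j))
     (\<Sum>i\<in>UNIV. \<Sum>j\<in>UNIV. if i = j then (b - a) * P.expectation (\<lambda>\<omega>. \<xi> \<omega> $ i * \<xi>' \<omega> $ j) else 0)"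
    by (intro has_bochner_integral_sum)
  moreover have "(\<Sum>i\<in>UNIV. \<Sum>j\<in>UNIV. \<xi> \<omega> $ i * \<xi>' \<omega> $ j * (?d \<omega> $ i * ?d \<omega> $ j)) = G a b \<xi> \<omega> * G a b \<xi>' \<omega>" for \<omega>
    unfolding G_def inner_vec_def sum_product by (intro sum.cong refl) (simp add: ac_simps)
  moreover have "(\<Sum>i\<in>UNIV. \<Sum>j\<in>UNIV. if i = j then (b - a) * P.expectation (\<lambda>\<omega>. \<xi> \<omega> $ i * \<xi>' \<omega> $ j) else 0)
      = (b - a) * P.expectation (\<lambda>\<omega>. \<xi> \<omega> \<bullet> \<xi>' \<omega>)"
    unfolding inner_vec_def using int by (simp add: sum_distrib_left[symmetric] Bochner_Integration.integral_sum)
  ultimately show ?thesis by simp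
qed

text \<open>The length of the intersection of \<open>]a, b]\<close> and
  \<open>]a', b']\<close>.\<close>

definition overlap :: "real \<Rightarrow> real \<Rightarrow> real \<Rightarrow> real \<Rightarrow> real" where
  "overlap a b a' b' = max 0 (min b b' - max a a')"

text \<open>A polarised isometry for arbitrarily placed intervals. It spares the common refinement
  of two partitions when step integrals are added.\<close>

lemma G_G:
  assumes "bdd_Filt a \<xi>" "0 \<le> a" "a \<le> b" "b \<le> T" "bdd_Filt a' \<xi>'" "0 \<le> a'" "a' \<le> b'" "b' \<le> T"
  shows "has_bochner_integral P (\<lambda>\<omega>. G a b \<xi> \<omega> * G a' b' \<xi>' \<omega>) (overlap a b a' b' * P.expectation (\<lambda>\<omega>. \<xi> \<omega> \<bullet> \<xi>' \<omega>))"
proof -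
  have *: "has_bochner_integral P (\<lambda>\<omega>. G a b \<xi> \<omega> * G a' b' \<xi>' \<omega>) (overlap a b a' b' * P.expectation (\<lambda>\<omega>. \<xi> \<omega> \<bullet> \<xi>' \<omega>))"
    if A: "bdd_Filt a \<xi>" "0 \<le> a" "a \<le> b" "b \<le> T" "bdd_Filt a' \<xi>'" "0 \<le> a'" "a' \<le> b'" "b' \<le> T" "a \<le> a'" for a b \<xi> a' b' \<xi>'
  proof (cases "b \<le> a'")
    case True
    then have "overlap a b a' b' = 0" using A by (auto simp: overlap_def)
    then show ?thesis using G_ortho_G[of a \<xi> b a' \<xi>' b'] A True by simp
  next
    case False
    \<comment> \<open>Both intervals are cut at the ends \<open>a'\<close> and \<open>m\<close> of
      their intersection. Products over disjoint pieces vanish in expectation, and only the common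
      piece contributes.\<close>
    define m where "m = min b b'"
    have m: "a' \<le> m" "m \<le> b" "m \<le> b'" using False A by (auto simp: m_def)
    have \<xi>: "bdd_Filt a' \<xi>" "bdd_Filt m \<xi>" "bdd_Filt m \<xi>'" using bdd_Filt_mono A m by auto
    have eq: "G a b \<xi> \<omega> * G a' b' \<xi>' \<omega> = G a a' \<xi> \<omega> * G a' b' \<xi>' \<omega> + (G a' m \<xi> \<omega> * G a' m \<xi>' \<omega>
       + (G a' m \<xi> \<omega> * G m b' \<xi>' \<omega> + (G a' m \<xi>' \<omega> * G m b \<xi> \<omega> + 0)))" for \<omega>
    proof -
      \<comment> \<open>\<open>m\<close> is one of the two right ends, so one of the two tails is
        empty.\<close>
      have "G m b \<xi> \<omega> * G m b' \<xi>' \<omega> = 0" unfolding m_def min_def by (simp add: G_self)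
      moreover have "G a b \<xi> \<omega> = G a a' \<xi> \<omega> + G a' m \<xi> \<omega> + G m b \<xi> \<omega>" using G_split[of a b \<xi> \<omega> a'] G_split[of a' b \<xi> \<omega> m] by simp
      moreover have "G a' b' \<xi>' \<omega> = G a' m \<xi>' \<omega> + G m b' \<xi>' \<omega>" using G_split[of a' b' \<xi>' \<omega> m] by simp
      ultimately show ?thesis by (simp add: algebra_simps)
    qed
    have "has_bochner_integral P (\<lambda>\<omega>. G a b \<xi> \<omega> * G a' b' \<xi>' \<omega>)
      (0 + ((m - a') * P.expectation (\<lambda>\<omega>. \<xi> \<omega> \<bullet> \<xi>' \<omega>) + (0 + (0 + 0))))"
      unfolding eq
      by (intro has_bochner_integral_add has_bochner_integral_zero G_ortho_G G_same) (use A m \<xi> in auto)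
    moreover have "overlap a b a' b' = m - a'" using A m by (auto simp: overlap_def m_def)
    ultimately show ?thesis by simp
  qed
  show ?thesis
  proof (cases "a \<le> a'")
    case False
    have 1: "overlap a b a' b' = overlap a' b' a b" by (simp add: overlap_def min.commute max.commute)
    have 2: "(\<lambda>\<omega>. \<xi> \<omega> \<bullet> \<xi>' \<omega>) = (\<lambda>\<omega>. \<xi>' \<omega> \<bullet> \<xi> \<omega>)" by (simp add: inner_commute)
    have 3: "(\<lambda>\<omega>. G a b \<xi> \<omega> * G a' b' \<xi>' \<omega>) = (\<lambda>\<omega>. G a' b' \<xi>' \<omega> * G a b \<xi> \<omega>)" by (rule ext) (rule mult.commute)
    show ?thesis
      unfolding 1 2 3 by (rule *) (use assms False in auto)
  qed (use * assms in auto)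
qed

end

section \<open>The Ito integral\<close>

lemma inner_sum_list:
  fixes f :: "'a \<Rightarrow> 'c::real_inner"
  shows "(\<Sum>x\<leftarrow>xs. f x) \<bullet> (\<Sum>y\<leftarrow>ys. h y) = (\<Sum>x\<leftarrow>xs. \<Sum>y\<leftarrow>ys. f x \<bullet> h y)"
proof -
  have 1: "v \<bullet> (\<Sum>y\<leftarrow>ys. h y) = (\<Sum>y\<leftarrow>ys. v \<bullet> h y)" for v
    by (induction ys) (auto simp: inner_add_right)
  have 2: "(\<Sum>x\<leftarrow>xs. f x) \<bullet> w = (\<Sum>x\<leftarrow>xs. f x \<bullet> w)" for w
    by (induction xs) (auto simp: inner_add_left)
  show ?thesis unfolding 2 unfolding 1 ..
qed

lemma has_bochner_integral_sum_list:
  assumes "\<And>x. x \<in> set xs \<Longrightarrow> has_bochner_integral M (f x) (v x)"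
  shows "has_bochner_integral M (\<lambda>\<omega>. \<Sum>x\<leftarrow>xs. f x \<omega>) (\<Sum>x\<leftarrow>xs. v x)"
  using assms by (induction xs) (auto intro!: has_bochner_integral_zero has_bochner_integral_add)

text \<open>The source of the factors 2 throughout: norms are handled squared, and the triangle
  inequality becomes \<open>(a + b)^2 \<le> 2 a^2 + 2 b^2\<close>.\<close>

lemma ennreal_power2_triangle:
  fixes x a b :: real
  assumes "\<bar>x\<bar> \<le> \<bar>a\<bar> + \<bar>b\<bar>"
  shows "ennreal (x\<^sup>2) \<le> 2 * ennreal (a\<^sup>2) + 2 * ennreal (b\<^sup>2)"
proof -
  have "x\<^sup>2 \<le> (\<bar>a\<bar> + \<bar>b\<bar>)\<^sup>2" using power_mono[OF assms, of 2] by simp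
  also have "\<dots> \<le> 2 * a\<^sup>2 + 2 * b\<^sup>2"
    using sum_squares_bound[of "\<bar>a\<bar>" "\<bar>b\<bar>"] by (simp add: power2_sum)
  finally have "ennreal (x\<^sup>2) \<le> ennreal (2 * a\<^sup>2 + 2 * b\<^sup>2)" by (rule ennreal_leI)
  also have "\<dots> = 2 * ennreal (a\<^sup>2) + 2 * ennreal (b\<^sup>2)"
    by (simp add: ennreal_plus ennreal_mult)
  finally show ?thesis .
qed

lemma tendsto_0_ennreal_le:
  fixes f g :: "nat \<Rightarrow> ennreal"
  assumes "\<And>m. f m \<le> g m" "g \<longlonglongrightarrow> 0"
  shows "f \<longlonglongrightarrow> 0"
  by (rule tendsto_sandwich[OF _ _ tendsto_const assms(2)]) (use assms(1) in auto)

lemma tendsto_0_ennreal_lin: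
  fixes f g :: "nat \<Rightarrow> ennreal"
  assumes "f \<longlonglongrightarrow> 0" "g \<longlonglongrightarrow> 0" "a < \<infinity>" "b < \<infinity>"
  shows "(\<lambda>m. a * f m + b * g m) \<longlonglongrightarrow> 0"
proof -
  have "(\<lambda>m. a * f m + b * g m) \<longlonglongrightarrow> a * 0 + b * 0"
    using assms by (intro tendsto_add ennreal_tendsto_cmult) auto
  then show ?thesis by simp
qed

lemma ennreal_le_limit:
  fixes x a :: ennreal
  assumes "\<And>m::nat. x \<le> a + e m" "e \<longlonglongrightarrow> 0"
  shows "x \<le> a"
proof -
  have "(\<lambda>m. a + e m) \<longlonglongrightarrow> a + 0" by (intro tendsto_add tendsto_const assms(2))
  then show ?thesis using LIMSEQ_le_const[of "\<lambda>m. a + e m" a x] assms(1) by auto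
qed

section \<open>Squared norms in time and chance; step processes\<close>

context bm_space begin

abbreviation LT :: "real measure" where "LT \<equiv> restrict_space lborel {0..T}"

abbreviation N1 :: "real \<Rightarrow> real \<Rightarrow> (real \<Rightarrow> 'b::real_normed_vector) \<Rightarrow> ennreal" where
  "N1 r u h \<equiv> (\<integral>\<^sup>+s. indicator {r<..u} s * ennreal ((norm (h s))\<^sup>2) \<partial>LT)"

lemma space_LT[simp]: "space LT = {0..T}"
  by (simp add: space_restrict_space)

lemma finite_measure_LT: "finite_measure LT"
  by (rule finite_measureI) (use T_pos in \<open>simp add: emeasure_restrict_space\<close>)

lemma sigma_finite_LT: "sigma_finite_measure LT"
  using finite_measure_LT by (simp add: finite_measure.axioms(1))

lemma measurable_LT: "f \<in> borel_measurable borel \<Longrightarrow> f \<in> borel_measurable LT"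
  by (rule measurable_restrict_space1) simp

text \<open>Joint measurability in time and chance.\<close>

definition jm :: "(real \<Rightarrow> 'd omega \<Rightarrow> 'b::topological_space) \<Rightarrow> bool" where
  "jm Z \<longleftrightarrow> (\<lambda>(s, \<omega>). Z s \<omega>) \<in> borel_measurable (LT \<Otimes>\<^sub>M P)"

lemma jm_progressive:
  assumes "progressive T P Z" shows "jm Z"
proof -
  have m: "(\<lambda>(s, \<omega>). Z s \<omega>) \<in> borel_measurable (LT \<Otimes>\<^sub>M F T)"
    using assms T_pos unfolding progressive_def by auto
  have i: "(\<lambda>\<omega>. \<omega>) \<in> P \<rightarrow>\<^sub>M F T"
    by (rule measurable_Filt_P[of _ T]) auto
  have "(\<lambda>x. (fst x, snd x)) \<in> LT \<Otimes>\<^sub>M P \<rightarrow>\<^sub>M LT \<Otimes>\<^sub>M F T"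
    by (intro measurable_Pair measurable_fst measurable_compose[OF measurable_snd i])
  from measurable_compose[OF this m] show ?thesis by (simp add: jm_def case_prod_beta')
qed

lemma jm_add: "jm Z1 \<Longrightarrow> jm Z2 \<Longrightarrow> jm (\<lambda>s \<omega>. Z1 s \<omega> + Z2 s \<omega> :: 'b::{real_normed_vector,second_countable_topology})"
  unfolding jm_def case_prod_beta' by (rule borel_measurable_add)

lemma jm_diff: "jm Z1 \<Longrightarrow> jm Z2 \<Longrightarrow> jm (\<lambda>s \<omega>. Z1 s \<omega> - Z2 s \<omega> :: 'b::{real_normed_vector,second_countable_topology})"
  unfolding jm_def case_prod_beta' by (rule borel_measurable_diff)

lemma jm_scale:
  assumes "c \<in> borel_measurable P" "jm Z"
  shows "jm (\<lambda>s \<omega>. c \<omega> *\<^sub>R Z s \<omega> :: 'b::{real_normed_vector,second_countable_topology})"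
proof -
  have "(\<lambda>x. c (snd x)) \<in> borel_measurable (LT \<Otimes>\<^sub>M P)" by (rule measurable_compose[OF measurable_snd assms(1)])
  then show ?thesis using assms(2) unfolding jm_def case_prod_beta' by (rule borel_measurable_scaleR)
qed

lemma jm_section:
  assumes "jm Z" "\<omega> \<in> Omega T" shows "(\<lambda>s. Z s \<omega>) \<in> borel_measurable LT"
  using measurable_compose[OF measurable_Pair2'[of \<omega> P LT]] assms unfolding jm_def by fastforce

lemma jm_section2:
  assumes "jm Z" "s \<in> {0..T}" shows "Z s \<in> borel_measurable P"
  using measurable_compose[OF measurable_Pair1'[of s LT P]] assms unfolding jm_def by fastforce

text \<open>\<open>N2\<close> and \<open>E2\<close> are squared norms, on
  \<open>]r, u] \<times> \<Omega>\<close> and on \<open>\<Omega>\<close>. As nonnegative integrals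
  with values in \<open>ennreal\<close> they carry no integrability conditions, at the price that
  absorption needs separate proofs of finiteness.\<close>

definition N2 :: "real \<Rightarrow> real \<Rightarrow> (real \<Rightarrow> 'd omega \<Rightarrow> 'b::real_normed_vector) \<Rightarrow> ennreal" where
  "N2 r u Z = (\<integral>\<^sup>+\<omega>. (N1 r u (\<lambda>s. Z s \<omega>)) \<partial>P)"

definition E2 :: "('d omega \<Rightarrow> 'b::real_normed_vector) \<Rightarrow> ennreal" where
  "E2 J = (\<integral>\<^sup>+\<omega>. ennreal ((norm (J \<omega>))\<^sup>2) \<partial>P)"

lemma E2_mono: "(\<And>\<omega>. \<omega> \<in> Omega T \<Longrightarrow> norm (J \<omega>) \<le> norm (J' \<omega>)) \<Longrightarrow> E2 J \<le> E2 J'"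
  unfolding E2_def by (intro nn_integral_mono ennreal_leI power_mono) auto

lemma E2_mono_AE: "(AE \<omega> in P. norm (J \<omega>) \<le> norm (J' \<omega>)) \<Longrightarrow> E2 J \<le> E2 J'"
  unfolding E2_def
proof (intro nn_integral_mono_AE)
  assume "AE \<omega> in P. norm (J \<omega>) \<le> norm (J' \<omega>)"
  then show "AE \<omega> in P. ennreal ((norm (J \<omega>))\<^sup>2) \<le> ennreal ((norm (J' \<omega>))\<^sup>2)"
    by eventually_elim (auto intro!: ennreal_leI power_mono)
qed

lemma E2_triangle_AE:
  fixes J1 :: "'d omega \<Rightarrow> 'b::{real_normed_vector,second_countable_topology}"
    and J2 :: "'d omega \<Rightarrow> 'c::{real_normed_vector,second_countable_topology}"
  assumes "J1 \<in> borel_measurable P" "J2 \<in> borel_measurable P"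
    and le: "AE \<omega> in P. norm (J \<omega>) \<le> norm (J1 \<omega>) + norm (J2 \<omega>)"
  shows "E2 J \<le> 2 * E2 J1 + 2 * E2 J2"
proof -
  have "E2 J \<le> (\<integral>\<^sup>+\<omega>. 2 * ennreal ((norm (J1 \<omega>))\<^sup>2) + 2 * ennreal ((norm (J2 \<omega>))\<^sup>2) \<partial>P)"
    unfolding E2_def
  proof (rule nn_integral_mono_AE)
    show "AE \<omega> in P. ennreal ((norm (J \<omega>))\<^sup>2) \<le> 2 * ennreal ((norm (J1 \<omega>))\<^sup>2) + 2 * ennreal ((norm (J2 \<omega>))\<^sup>2)"
      using le by eventually_elim (auto intro!: ennreal_power2_triangle)
  qed
  also have "\<dots> = 2 * E2 J1 + 2 * E2 J2"
    unfolding E2_def using assms by (subst nn_integral_add) (auto simp: nn_integral_cmult)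
  finally show ?thesis .
qed

lemma N2_inner_measurable:
  fixes Z :: "real \<Rightarrow> 'd omega \<Rightarrow> 'b::{real_normed_vector,second_countable_topology}"
  assumes "jm Z"
  shows "(\<lambda>\<omega>. N1 r u (\<lambda>s. Z s \<omega>)) \<in> borel_measurable P"
proof (rule sigma_finite_measure.borel_measurable_nn_integral[OF sigma_finite_LT])
  have i: "indicator {r<..u} \<in> borel_measurable LT" by (rule measurable_LT) simp
  have "(\<lambda>x. (snd x, fst x)) \<in> P \<Otimes>\<^sub>M LT \<rightarrow>\<^sub>M LT \<Otimes>\<^sub>M P" by measurable
  from measurable_compose[OF this assms[unfolded jm_def]]
  have [measurable]: "(\<lambda>x. Z (snd x) (fst x)) \<in> borel_measurable (P \<Otimes>\<^sub>M LT)" by (simp add: case_prod_beta')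
  have [measurable]: "(\<lambda>x. indicator {r<..u} (snd x) :: ennreal) \<in> borel_measurable (P \<Otimes>\<^sub>M LT)"
    by (rule measurable_compose[OF measurable_snd i])
  show "(\<lambda>(\<omega>, s). indicator {r<..u} s * ennreal ((norm (Z s \<omega>))\<^sup>2)) \<in> borel_measurable (P \<Otimes>\<^sub>M LT)"
    unfolding case_prod_beta' by measurable
qed

lemma N2_mono:
  assumes "\<And>s \<omega>. s \<in> {r<..u} \<Longrightarrow> s \<in> {0..T} \<Longrightarrow> \<omega> \<in> Omega T \<Longrightarrow> norm (Z s \<omega>) \<le> norm (Z' s \<omega>)"
  shows "N2 r u Z \<le> N2 r u Z'"
  unfolding N2_def
proof (intro nn_integral_mono)
  fix \<omega> s assume "\<omega> \<in> space P" "s \<in> space LT"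
  then show "indicator {r<..u} s * ennreal ((norm (Z s \<omega>))\<^sup>2) \<le> indicator {r<..u} s * ennreal ((norm (Z' s \<omega>))\<^sup>2)"
    using assms[of s \<omega>] by (cases "s \<in> {r<..u}") (auto intro!: ennreal_leI power_mono)
qed

lemma N2_triangle:
  fixes Z1 :: "real \<Rightarrow> 'd omega \<Rightarrow> 'b::{real_normed_vector,second_countable_topology}"
    and Z2 :: "real \<Rightarrow> 'd omega \<Rightarrow> 'c::{real_normed_vector,second_countable_topology}"
  assumes jm: "jm Z1" "jm Z2"
    and le: "\<And>s \<omega>. s \<in> {r<..u} \<Longrightarrow> s \<in> {0..T} \<Longrightarrow> \<omega> \<in> Omega T \<Longrightarrow> norm (Z s \<omega>) \<le> norm (Z1 s \<omega>) + norm (Z2 s \<omega>)"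
  shows "N2 r u Z \<le> 2 * N2 r u Z1 + 2 * N2 r u Z2"
proof -
  let ?n = "\<lambda>\<omega> h. N1 r u (\<lambda>s. h s)"
  have i: "indicator {r<..u} \<in> borel_measurable LT" by (rule measurable_LT) simp
  have "N2 r u Z \<le> (\<integral>\<^sup>+\<omega>. 2 * ?n \<omega> (\<lambda>s. Z1 s \<omega>) + 2 * ?n \<omega> (\<lambda>s. Z2 s \<omega>) \<partial>P)"
    unfolding N2_def
  proof (rule nn_integral_mono)
    fix \<omega> assume "\<omega> \<in> space P"
    then have \<omega>: "\<omega> \<in> Omega T" by simp
    have m: "(\<lambda>s. indicator {r<..u} s * ennreal ((norm (Z1 s \<omega>))\<^sup>2)) \<in> borel_measurable LT"
      "(\<lambda>s. indicator {r<..u} s * ennreal ((norm (Z2 s \<omega>))\<^sup>2)) \<in> borel_measurable LT"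
      using jm_section[OF jm(1) \<omega>] jm_section[OF jm(2) \<omega>] i by measurable
    have "?n \<omega> (\<lambda>s. Z s \<omega>) \<le> (\<integral>\<^sup>+s. 2 * (indicator {r<..u} s * ennreal ((norm (Z1 s \<omega>))\<^sup>2))
         + 2 * (indicator {r<..u} s * ennreal ((norm (Z2 s \<omega>))\<^sup>2)) \<partial>LT)"
      using le \<omega> by (intro nn_integral_mono) (auto intro!: ennreal_power2_triangle split: split_indicator)
    also have "\<dots> = 2 * ?n \<omega> (\<lambda>s. Z1 s \<omega>) + 2 * ?n \<omega> (\<lambda>s. Z2 s \<omega>)"
      using m by (subst nn_integral_add) (auto simp: nn_integral_cmult)
    finally show "?n \<omega> (\<lambda>s. Z s \<omega>) \<le> 2 * ?n \<omega> (\<lambda>s. Z1 s \<omega>) + 2 * ?n \<omega> (\<lambda>s. Z2 s \<omega>)" .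
  qed
  also have "\<dots> = 2 * N2 r u Z1 + 2 * N2 r u Z2"
    unfolding N2_def using N2_inner_measurable[OF jm(1)] N2_inner_measurable[OF jm(2)]
    by (subst nn_integral_add) (auto simp: nn_integral_cmult)
  finally show ?thesis .
qed

text \<open>The intervals in the list may overlap, so a sum of two step processes is simply the
  concatenation of their lists.\<close>

definition step_proc :: "(real \<times> real \<times> ('d omega \<Rightarrow> real^'d)) list \<Rightarrow> real \<Rightarrow> 'd omega \<Rightarrow> real^'d" where
  "step_proc gs s \<omega> = (\<Sum>(a, b, \<xi>)\<leftarrow>gs. indicator {a<..b} s *\<^sub>R \<xi> \<omega>)"

definition step_int :: "(real \<times> real \<times> ('d omega \<Rightarrow> real^'d)) list \<Rightarrow> 'd omega \<Rightarrow> real" where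
  "step_int gs \<omega> = (\<Sum>(a, b, \<xi>)\<leftarrow>gs. G a b \<xi> \<omega>)"

definition step_ok :: "real \<Rightarrow> real \<Rightarrow> (real \<times> real \<times> ('d omega \<Rightarrow> real^'d)) list \<Rightarrow> bool" where
  "step_ok r u gs \<longleftrightarrow> (\<forall>(a, b, \<xi>)\<in>set gs. r \<le> a \<and> a \<le> b \<and> b \<le> u \<and> bdd_Filt a \<xi>)"

lemma step_append: "step_proc (gs @ hs) s \<omega> = step_proc gs s \<omega> + step_proc hs s \<omega>"
    "step_int (gs @ hs) \<omega> = step_int gs \<omega> + step_int hs \<omega>"
    "step_ok r u (gs @ hs) \<longleftrightarrow> step_ok r u gs \<and> step_ok r u hs"
  by (simp_all add: step_proc_def step_int_def step_ok_def ball_Un)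

lemma step_Nil: "step_proc [] s \<omega> = 0" "step_int [] \<omega> = 0" "step_ok r u []"
  by (auto simp: step_proc_def step_int_def step_ok_def)

lemma step_Cons:
  "step_proc ((a, b, \<xi>) # gs) s \<omega> = indicator {a<..b} s *\<^sub>R \<xi> \<omega> + step_proc gs s \<omega>"
  "step_int ((a, b, \<xi>) # gs) \<omega> = G a b \<xi> \<omega> + step_int gs \<omega>"
  "step_ok r u ((a, b, \<xi>) # gs) \<longleftrightarrow> r \<le> a \<and> a \<le> b \<and> b \<le> u \<and> bdd_Filt a \<xi> \<and> step_ok r u gs"
  by (auto simp: step_proc_def step_int_def step_ok_def)

lemma jm_step_proc:
  assumes "step_ok r u gs" "u \<le> T" shows "jm (step_proc gs)"
  using assms(1)
proof (induction gs)
  case Nil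
  then show ?case by (simp add: step_Nil jm_def)
next
  case (Cons g gs)
  obtain a b \<xi> where g: "g = (a, b, \<xi>)" by (cases g)
  have ok: "a \<le> T" "\<xi> \<in> borel_measurable (F a)" using Cons(2) assms(2) by (auto simp: g step_Cons bdd_Filt_def)
  have 1: "(\<lambda>x. \<xi> (snd x)) \<in> borel_measurable (LT \<Otimes>\<^sub>M P)"
    by (rule measurable_compose[OF measurable_snd measurable_Filt_P[OF ok(2,1)]])
  have 2: "(\<lambda>x. indicator {a<..b} (fst x) :: real) \<in> borel_measurable (LT \<Otimes>\<^sub>M P)"
    by (rule measurable_compose[OF measurable_fst measurable_LT]) simp
  have "jm (\<lambda>s \<omega>. indicator {a<..b} s *\<^sub>R \<xi> \<omega>)"
    unfolding jm_def case_prod_beta' by (rule borel_measurable_scaleR[OF 2 1])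
  then have "jm (\<lambda>s \<omega>. indicator {a<..b} s *\<^sub>R \<xi> \<omega> + step_proc gs s \<omega>)"
    by (rule jm_add) (use Cons in \<open>auto simp: g step_Cons\<close>)
  moreover have "step_proc (g # gs) = (\<lambda>s \<omega>. indicator {a<..b} s *\<^sub>R \<xi> \<omega> + step_proc gs s \<omega>)"
    by (intro ext) (simp add: g step_Cons)
  ultimately show ?case by simp
qed

lemma step_int_measurable:
  assumes "step_ok r u gs" "0 \<le> r" "u \<le> T" shows "step_int gs \<in> borel_measurable P"
  using assms(1)
proof (induction gs)
  case Nil
  then show ?case by (simp add: step_Nil step_int_def[abs_def])
next
  case (Cons g gs)
  obtain a b \<xi> where g: "g = (a, b, \<xi>)" by (cases g)
  have "G a b \<xi> \<in> borel_measurable P"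
    using Cons(2) assms by (intro measurable_Filt_P[OF G_measurable]) (auto simp: g step_Cons)
  then have "(\<lambda>\<omega>. G a b \<xi> \<omega> + step_int gs \<omega>) \<in> borel_measurable P"
    using Cons by (intro borel_measurable_add) (auto simp: g step_Cons)
  moreover have "step_int (g # gs) = (\<lambda>\<omega>. G a b \<xi> \<omega> + step_int gs \<omega>)"
    by (intro ext) (simp add: g step_Cons)
  ultimately show ?case by simp
qed

lemma has_bochner_integral_indicator_overlap:
  fixes x y :: "real^'d"
  assumes "0 \<le> a" "b \<le> T" "0 \<le> a'" "b' \<le> T"
  shows "has_bochner_integral LT (\<lambda>s. (indicator {a<..b} s *\<^sub>R x) \<bullet> (indicator {a'<..b'} s *\<^sub>R y)) (overlap a b a' b' * (x \<bullet> y))"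
proof -
  let ?A = "{max a a'<..min b b'}"
  have sub: "?A \<subseteq> {0..T}" using assms by auto
  then have A: "?A \<in> sets LT" by (simp add: sets_restrict_space_iff)
  have em: "emeasure LT ?A = ennreal (overlap a b a' b')"
    using sub by (subst emeasure_restrict_space)
      (auto simp: overlap_def max_def ennreal_0[symmetric] simp del: ennreal_0)
  have "has_bochner_integral LT (\<lambda>s. indicator ?A s *\<^sub>R (x \<bullet> y)) (measure LT ?A *\<^sub>R (x \<bullet> y))"
    by (rule has_bochner_integral_indicator[OF A]) (simp add: em)
  moreover have "measure LT ?A = overlap a b a' b'"
    unfolding measure_def em by (rule enn2real_ennreal) (simp add: overlap_def)
  moreover have "indicator ?A s *\<^sub>R (x \<bullet> y) = (indicator {a<..b} s *\<^sub>R x) \<bullet> (indicator {a'<..b'} s *\<^sub>R y)" for s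
    by (auto split: split_indicator)
  ultimately show ?thesis by (simp only: real_scaleR_def)
qed

text \<open>Both squares are expanded bilinearly. Each pair of entries contributes the overlap of
  its intervals times the expected inner product: on the stochastic side by \<open>G_G\<close>, on
  the other side as the length of an intersection.\<close>

lemma step_isometry:
  assumes ok: "step_ok r u gs" "0 \<le> r" "u \<le> T"
  shows "E2 (step_int gs) = N2 r u (step_proc gs)" "integrable P (\<lambda>\<omega>. (step_int gs \<omega>)\<^sup>2)"
proof -
  let ?V = "\<Sum>(a, b, \<xi>)\<leftarrow>gs. \<Sum>(a', b', \<xi>')\<leftarrow>gs. overlap a b a' b' * P.expectation (\<lambda>\<omega>. \<xi> \<omega> \<bullet> \<xi>' \<omega>)"
  let ?v = "\<lambda>\<omega>. \<Sum>(a, b, \<xi>)\<leftarrow>gs. \<Sum>(a', b', \<xi>')\<leftarrow>gs. overlap a b a' b' * (\<xi> \<omega> \<bullet> \<xi>' \<omega>)"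
  have okD: "0 \<le> a" "a \<le> b" "b \<le> T" "bdd_Filt a \<xi>" if "(a, b, \<xi>) \<in> set gs" for a b \<xi>
    using ok that unfolding step_ok_def by (fastforce dest: bspec)+
  have J: "has_bochner_integral P (\<lambda>\<omega>. step_int gs \<omega> \<bullet> step_int gs \<omega>) ?V"
    unfolding step_int_def inner_sum_list
  proof (intro has_bochner_integral_sum_list)
    fix x assume x: "x \<in> set gs"
    obtain a b \<xi> where x': "x = (a, b, \<xi>)" by (cases x)
    have "has_bochner_integral P (\<lambda>\<omega>. (case x of (a, b, \<xi>) \<Rightarrow> G a b \<xi> \<omega>) \<bullet> (case y of (a, b, \<xi>) \<Rightarrow> G a b \<xi> \<omega>))
       (case y of (a', b', \<xi>') \<Rightarrow> overlap a b a' b' * P.expectation (\<lambda>\<omega>. \<xi> \<omega> \<bullet> \<xi>' \<omega>))" if "y \<in> set gs" for y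
    proof (cases y)
      case (fields a' b' \<xi>')
      show ?thesis unfolding x' fields prod.case inner_real_def
        by (rule G_G) (use okD x that x' fields in blast)+
    qed
    then show "has_bochner_integral P (\<lambda>\<omega>. \<Sum>y\<leftarrow>gs. (case x of (a, b, \<xi>) \<Rightarrow> G a b \<xi> \<omega>) \<bullet> (case y of (a, b, \<xi>) \<Rightarrow> G a b \<xi> \<omega>))
       (case x of (a, b, \<xi>) \<Rightarrow> \<Sum>(a', b', \<xi>')\<leftarrow>gs. overlap a b a' b' * P.expectation (\<lambda>\<omega>. \<xi> \<omega> \<bullet> \<xi>' \<omega>))"
      unfolding x' prod.case by (intro has_bochner_integral_sum_list) auto
  qed
  have S: "has_bochner_integral LT (\<lambda>s. step_proc gs s \<omega> \<bullet> step_proc gs s \<omega>) (?v \<omega>)" for \<omega>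
    unfolding step_proc_def inner_sum_list
  proof (intro has_bochner_integral_sum_list)
    fix x assume x: "x \<in> set gs"
    obtain a b \<xi> where x': "x = (a, b, \<xi>)" by (cases x)
    have "has_bochner_integral LT (\<lambda>s. (case x of (a, b, \<xi>) \<Rightarrow> indicator {a<..b} s *\<^sub>R \<xi> \<omega>) \<bullet> (case y of (a, b, \<xi>) \<Rightarrow> indicator {a<..b} s *\<^sub>R \<xi> \<omega>))
       (case y of (a', b', \<xi>') \<Rightarrow> overlap a b a' b' * (\<xi> \<omega> \<bullet> \<xi>' \<omega>))" if "y \<in> set gs" for y
    proof (cases y)
      case (fields a' b' \<xi>')
      show ?thesis unfolding x' fields prod.case
        by (rule has_bochner_integral_indicator_overlap) (use okD x that x' fields in blast)+
    qed
    then show "has_bochner_integral LT (\<lambda>s. \<Sum>y\<leftarrow>gs. (case x of (a, b, \<xi>) \<Rightarrow> indicator {a<..b} s *\<^sub>R \<xi> \<omega>) \<bullet> (case y of (a, b, \<xi>) \<Rightarrow> indicator {a<..b} s *\<^sub>R \<xi> \<omega>))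
       (case x of (a, b, \<xi>) \<Rightarrow> \<Sum>(a', b', \<xi>')\<leftarrow>gs. overlap a b a' b' * (\<xi> \<omega> \<bullet> \<xi>' \<omega>))"
      unfolding x' prod.case by (intro has_bochner_integral_sum_list) auto
  qed
  show int: "integrable P (\<lambda>\<omega>. (step_int gs \<omega>)\<^sup>2)"
    using J by (simp add: has_bochner_integral_iff power2_eq_square)
  have "E2 (step_int gs) = (\<integral>\<^sup>+\<omega>. ennreal ((step_int gs \<omega>)\<^sup>2) \<partial>P)"
    by (simp add: E2_def)
  also have "\<dots> = ennreal ?V"
    using int J by (subst nn_integral_eq_integral) (auto simp: has_bochner_integral_iff power2_eq_square)
  finally have 1: "E2 (step_int gs) = ennreal ?V" .
  have v0: "0 \<le> ?v \<omega>" for \<omega>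
    using S[of \<omega>] by (subst has_bochner_integral_integral_eq[symmetric, OF S]) (simp add: Bochner_Integration.integral_nonneg)
  have z: "step_proc gs s \<omega> = 0" if "s \<notin> {r<..u}" for s \<omega>
  proof -
    have "(case g of (a, b, \<xi>) \<Rightarrow> indicator {a<..b} s *\<^sub>R \<xi> \<omega>) = (0 :: real^'d)" if "g \<in> set gs" for g
      using ok(1) that \<open>s \<notin> _\<close> unfolding step_ok_def by (cases g) (fastforce split: split_indicator)
    then have mp: "map (\<lambda>(a, b, \<xi>). indicator {a<..b} s *\<^sub>R \<xi> \<omega>) gs = map (\<lambda>_. 0 :: real^'d) gs"
      by (intro map_cong) auto
    show ?thesis unfolding step_proc_def mp by simp
  qed
  have inner: "(N1 r u (\<lambda>s. step_proc gs s \<omega>)) = ennreal (?v \<omega>)" for \<omega>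
  proof -
    have "indicator {r<..u} s * ennreal ((norm (step_proc gs s \<omega>))\<^sup>2) = ennreal (step_proc gs s \<omega> \<bullet> step_proc gs s \<omega>)" for s
      using z[of s \<omega>] by (auto simp: power2_norm_eq_inner split: split_indicator)
    then show ?thesis
      using S[of \<omega>] by (simp add: nn_integral_eq_integral has_bochner_integral_iff)
  qed
  have ii: "integrable P (\<lambda>\<omega>. \<xi> \<omega> \<bullet> \<xi>' \<omega>)" if "(a, b, \<xi>) \<in> set gs" "(a', b', \<xi>') \<in> set gs" for a b \<xi> a' b' \<xi>'
  proof -
    have "integrable P (\<lambda>\<omega>. \<xi> \<omega> $ i * \<xi>' \<omega> $ i)" for i
      using integrable_mult_bdd_Filt[OF okD(4)[OF that(2)], of "\<lambda>\<omega>. \<xi> \<omega> $ i"]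
        integrable_mult_bdd_Filt[OF okD(4)[OF that(1)], of "\<lambda>_. 1"] okD[OF that(1)] okD[OF that(2)] by auto
    then show ?thesis unfolding inner_vec_def by (intro Bochner_Integration.integrable_sum) simp
  qed
  have "has_bochner_integral P ?v ?V"
    using ii by (intro has_bochner_integral_sum_list)
      (auto intro!: has_bochner_integral_mult_right has_bochner_integral_integrable has_bochner_integral_sum_list split: prod.splits)
  then have "(\<integral>\<^sup>+\<omega>. ennreal (?v \<omega>) \<partial>P) = ennreal ?V"
    using v0 by (subst nn_integral_eq_integral) (auto simp: has_bochner_integral_iff)
  then show "E2 (step_int gs) = N2 r u (step_proc gs)"
    unfolding 1 N2_def inner by simp
qed

lemma step_ortho:
  assumes ok: "step_ok r u gs" "0 \<le> r" "u \<le> T"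
    and \<eta>: "\<eta> \<in> borel_measurable (F r)" "integrable P \<eta>"
  shows "has_bochner_integral P (\<lambda>\<omega>. \<eta> \<omega> * step_int gs \<omega>) 0"
  using ok(1)
proof (induction gs)
  case Nil
  then show ?case by (simp add: step_Nil has_bochner_integral_zero)
next
  case (Cons g gs)
  obtain a b \<xi> where g: "g = (a, b, \<xi>)" by (cases g)
  have "has_bochner_integral P (\<lambda>\<omega>. \<eta> \<omega> * G a b \<xi> \<omega> + \<eta> \<omega> * step_int gs \<omega>) (0 + 0)"
  proof (intro has_bochner_integral_add)
    show "has_bochner_integral P (\<lambda>\<omega>. \<eta> \<omega> * G a b \<xi> \<omega>) 0"
      by (rule G_ortho) (use Cons(2) ok \<eta> measurable_Filt_mono[OF \<eta>(1)] in \<open>auto simp: g step_Cons\<close>)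
  qed (use Cons in \<open>auto simp: g step_Cons\<close>)
  then show ?case by (simp add: g step_Cons distrib_left)
qed

text \<open>The cross term vanishes because \<open>\<eta>\<close> is known before the first step
  begins.\<close>

lemma step_pythagoras:
  assumes ok: "step_ok r u gs" "0 \<le> r" "u \<le> T"
    and \<eta>: "\<eta> \<in> borel_measurable (F r)" "E2 \<eta> < \<infinity>" and ru: "r \<le> u"
  shows "E2 (\<lambda>\<omega>. \<eta> \<omega> + step_int gs \<omega>) = E2 \<eta> + E2 (step_int gs)"
proof -
  have m: "\<eta> \<in> borel_measurable P" using measurable_Filt_P[OF \<eta>(1)] ru ok by simp
  have i2: "integrable P (\<lambda>\<omega>. (\<eta> \<omega>)\<^sup>2)"
    using \<eta>(2) m unfolding E2_def by (intro integrableI_nonneg) auto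
  \<comment> \<open>Square integrability gives integrability through
    \<open>\<bar>\<eta>\<bar> \<le> 1 + \<eta>^2\<close>.\<close>
  have i1: "integrable P \<eta>"
  proof (rule Bochner_Integration.integrable_bound[of P "\<lambda>\<omega>. 1 + (\<eta> \<omega>)\<^sup>2"])
    have "norm (\<eta> \<omega>) \<le> norm (1 + (\<eta> \<omega>)\<^sup>2)" for \<omega>
      using sum_squares_bound[of 1 "\<bar>\<eta> \<omega>\<bar>"] by simp
    then show "AE \<omega> in P. norm (\<eta> \<omega>) \<le> norm (1 + (\<eta> \<omega>)\<^sup>2)" by simp
  qed (use i2 m in auto)
  note o = step_ortho[OF ok \<eta>(1) i1, unfolded has_bochner_integral_iff]
  note s = step_isometry(2)[OF ok]
  have eq: "(\<eta> \<omega> + step_int gs \<omega>)\<^sup>2 = (\<eta> \<omega>)\<^sup>2 + (2 * (\<eta> \<omega> * step_int gs \<omega>) + (step_int gs \<omega>)\<^sup>2)" for \<omega>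
    by (simp add: power2_sum)
  have int: "integrable P (\<lambda>\<omega>. (\<eta> \<omega> + step_int gs \<omega>)\<^sup>2)"
    unfolding eq using i2 s o by (intro Bochner_Integration.integrable_add Bochner_Integration.integrable_mult_right) auto
  have "P.expectation (\<lambda>\<omega>. (\<eta> \<omega> + step_int gs \<omega>)\<^sup>2) = P.expectation (\<lambda>\<omega>. (\<eta> \<omega>)\<^sup>2) + P.expectation (\<lambda>\<omega>. (step_int gs \<omega>)\<^sup>2)"
    unfolding eq using i2 s o by (simp add: Bochner_Integration.integral_add)
  then show ?thesis
    unfolding E2_def using int i2 s by (simp add: nn_integral_eq_integral ennreal_plus)
qed

end

lemma norm_diff_sum_le:
  fixes a b c d :: "'a::real_normed_vector"
  shows "norm (a + b - (c + d)) \<le> norm (a - c) + norm (b - d)"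
  using norm_triangle_ineq[of "a - c" "b - d"] by (simp add: algebra_simps)

lemma norm_le_norm_plus_diff:
  fixes x y :: "'a::real_normed_vector"
  shows "norm x \<le> norm y + norm (y - x)" "norm y \<le> norm x + norm (y - x)"
  using norm_triangle_ineq4[of y "y - x"] norm_triangle_ineq[of x "y - x"] by auto

lemma norm_scaleR_diff_le:
  fixes x y :: "'a::real_normed_vector"
  assumes "\<bar>c\<bar> \<le> 1"
  shows "norm (c *\<^sub>R x - c *\<^sub>R y) \<le> norm (x - y)"
  using mult_right_mono[OF assms norm_ge_zero[of "x - y"]] by (simp add: scaleR_diff_right[symmetric])

section \<open>Stochastic integrals over an interval as limits of step integrals\<close>

context bm_space begin

text \<open>The process sampled at the grid point just below the current time takes only countably
  many sampling times, hence is jointly measurable; it converges pointwise by continuity of the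
  paths.\<close>

lemma jm_continuous:
  fixes X :: "real \<Rightarrow> 'd omega \<Rightarrow> 'b::metric_space"
  assumes m: "\<And>t. t \<in> {0..T} \<Longrightarrow> X t \<in> borel_measurable P"
    and c: "\<And>\<omega>. \<omega> \<in> Omega T \<Longrightarrow> continuous_on {0..T} (\<lambda>t. X t \<omega>)"
  shows "jm X"
proof -
  \<comment> \<open>Clipping keeps every grid point in \<open>{0..T}\<close>, since measurability of
    the samples is required for all integers \<open>i\<close>, not only those that occur.\<close>
  define \<tau> :: "nat \<Rightarrow> int \<Rightarrow> real" where "\<tau> n i = max 0 (min T (real_of_int i / real (Suc n)))" for n i
  have \<tau>_in: "\<tau> n i \<in> {0..T}" for n i using T_pos by (auto simp: \<tau>_def)
  show ?thesis
    unfolding jm_def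
  proof (rule borel_measurable_LIMSEQ_metric)
    fix n
    show "(\<lambda>x. X (\<tau> n \<lfloor>real (Suc n) * fst x\<rfloor>) (snd x)) \<in> borel_measurable (LT \<Otimes>\<^sub>M P)"
    proof (rule measurable_compose_countable[where f="\<lambda>i x. X (\<tau> n i) (snd x)"])
      show "(\<lambda>x. X (\<tau> n i) (snd x)) \<in> borel_measurable (LT \<Otimes>\<^sub>M P)" for i
        by (rule measurable_compose[OF measurable_snd m[OF \<tau>_in]])
      have "(\<lambda>s::real. \<lfloor>real (Suc n) * s\<rfloor>) \<in> borel \<rightarrow>\<^sub>M count_space UNIV" by measurable
      then have "(\<lambda>s::real. \<lfloor>real (Suc n) * s\<rfloor>) \<in> LT \<rightarrow>\<^sub>M count_space UNIV"
        by (intro measurable_restrict_space1) simp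
      from measurable_compose[OF measurable_fst this]
      show "(\<lambda>x. \<lfloor>real (Suc n) * fst x\<rfloor>) \<in> LT \<Otimes>\<^sub>M P \<rightarrow>\<^sub>M count_space UNIV" by simp
    qed
  next
    fix x assume "x \<in> space (LT \<Otimes>\<^sub>M P)"
    then obtain s \<omega> where x: "x = (s, \<omega>)" "s \<in> {0..T}" "\<omega> \<in> Omega T" by (auto simp: space_pair_measure)
    have "(\<lambda>n. \<tau> n \<lfloor>real (Suc n) * s\<rfloor>) \<longlonglongrightarrow> s"
    proof (rule tendsto_sandwich)
      show "\<forall>\<^sub>F n in sequentially. s - 1 / real (Suc n) \<le> \<tau> n \<lfloor>real (Suc n) * s\<rfloor>"
      proof (rule always_eventually, rule allI)
        fix n
        have "real (Suc n) * s - 1 \<le> real_of_int \<lfloor>real (Suc n) * s\<rfloor>" by linarith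
        then have "(real (Suc n) * s - 1) / real (Suc n) \<le> real_of_int \<lfloor>real (Suc n) * s\<rfloor> / real (Suc n)"
          by (intro divide_right_mono) auto
        moreover have "(real (Suc n) * s - 1) / real (Suc n) = s - 1 / real (Suc n)" by (simp add: field_simps)
        moreover have "s - 1 / real (Suc n) \<le> T - 0" using x(2) by (intro diff_mono) auto
        ultimately show "s - 1 / real (Suc n) \<le> \<tau> n \<lfloor>real (Suc n) * s\<rfloor>" unfolding \<tau>_def by linarith
      qed
      show "\<forall>\<^sub>F n in sequentially. \<tau> n \<lfloor>real (Suc n) * s\<rfloor> \<le> s"
      proof (rule always_eventually, rule allI)
        fix n
        have "real_of_int \<lfloor>real (Suc n) * s\<rfloor> / real (Suc n) \<le> (real (Suc n) * s) / real (Suc n)"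
          by (intro divide_right_mono of_int_floor_le) auto
        then have "real_of_int \<lfloor>real (Suc n) * s\<rfloor> / real (Suc n) \<le> s" by simp
        then show "\<tau> n \<lfloor>real (Suc n) * s\<rfloor> \<le> s" unfolding \<tau>_def using x(2) by auto
      qed
      show "(\<lambda>n. s - 1 / real (Suc n)) \<longlonglongrightarrow> s"
        using tendsto_diff[OF tendsto_const LIMSEQ_inverse_real_of_nat, of s] by (simp add: inverse_eq_divide)
    qed simp
    then have "(\<lambda>n. X (\<tau> n \<lfloor>real (Suc n) * s\<rfloor>) \<omega>) \<longlonglongrightarrow> X s \<omega>"
      by (rule continuous_on_tendsto_compose[OF c[OF x(3)]]) (use x \<tau>_in in auto)
    then show "(\<lambda>n. X (\<tau> n \<lfloor>real (Suc n) * fst x\<rfloor>) (snd x)) \<longlonglongrightarrow> (case x of (s, \<omega>) \<Rightarrow> X s \<omega>)"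
      by (simp add: x)
  qed
qed

lemma E2_flip:
  fixes J :: "'d omega \<Rightarrow> 'b::{real_normed_vector,second_countable_topology}"
  assumes "0 \<le> t" "t < r" "r \<le> T" "J \<in> borel_measurable P"
  shows "E2 (\<lambda>\<omega>. J (flip T t r \<omega>)) = E2 J"
  unfolding E2_def using nn_integral_flip[OF assms(1-3), of "\<lambda>\<omega>. ennreal ((norm (J \<omega>))\<^sup>2)"] assms(4) by simp

lemma N2_flip:
  fixes Z :: "real \<Rightarrow> 'd omega \<Rightarrow> 'b::{real_normed_vector,second_countable_topology}"
  assumes "0 \<le> t" "t < r" "r \<le> T" "jm Z"
  shows "N2 e u (\<lambda>s \<omega>. Z s (flip T t r \<omega>)) = N2 e u Z"
  unfolding N2_def using nn_integral_flip[OF assms(1-3) N2_inner_measurable[OF assms(4), of e u]] .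

lemma jm_flip:
  assumes "0 \<le> t" "t < r" "r \<le> T" "jm Z"
  shows "jm (\<lambda>s \<omega>. Z s (flip T t r \<omega>))"
proof -
  have "(\<lambda>x. (fst x, flip T t r (snd x))) \<in> LT \<Otimes>\<^sub>M P \<rightarrow>\<^sub>M LT \<Otimes>\<^sub>M P"
    by (intro measurable_Pair measurable_fst measurable_compose[OF measurable_snd flip_P(1)] assms)
  from measurable_compose[OF this assms(4)[unfolded jm_def]] show ?thesis
    by (simp add: jm_def case_prod_beta')
qed

text \<open>\<open>J\<close> is the stochastic integral of \<open>Z\<close> over \<open>]r, u]\<close>. In contrast to \<open>is_ito\<close>, the approximating step
  processes need not share a partition, which makes the notion visibly closed under sums,
  \<open>\<F>\<^sub>r\<close>-measurable factors and reflections.\<close>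

definition ito_on :: "real \<Rightarrow> real \<Rightarrow> (real \<Rightarrow> 'd omega \<Rightarrow> real^'d) \<Rightarrow> ('d omega \<Rightarrow> real) \<Rightarrow> bool" where
  "ito_on r u Z J \<longleftrightarrow> jm Z \<and> J \<in> borel_measurable P \<and>
     (\<exists>gs :: nat \<Rightarrow> _. (\<forall>m. step_ok r u (gs m)) \<and>
        (\<lambda>m. N2 r u (\<lambda>s \<omega>. step_proc (gs m) s \<omega> - Z s \<omega>)) \<longlonglongrightarrow> 0 \<and>
        (\<lambda>m. E2 (\<lambda>\<omega>. step_int (gs m) \<omega> - J \<omega>)) \<longlonglongrightarrow> 0)"

context
  fixes r u :: real
  assumes ru: "0 \<le> r" "r \<le> u" "u \<le> T"
begin

lemma ito_on_add:
  assumes "ito_on r u Z1 J1" "ito_on r u Z2 J2"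
  shows "ito_on r u (\<lambda>s \<omega>. Z1 s \<omega> + Z2 s \<omega>) (\<lambda>\<omega>. J1 \<omega> + J2 \<omega>)"
proof -
  obtain g1 where g1: "\<And>m::nat. step_ok r u (g1 m)"
    "(\<lambda>m. N2 r u (\<lambda>s \<omega>. step_proc (g1 m) s \<omega> - Z1 s \<omega>)) \<longlonglongrightarrow> 0" "(\<lambda>m. E2 (\<lambda>\<omega>. step_int (g1 m) \<omega> - J1 \<omega>)) \<longlonglongrightarrow> 0"
    using assms(1) unfolding ito_on_def by blast
  obtain g2 where g2: "\<And>m::nat. step_ok r u (g2 m)"
    "(\<lambda>m. N2 r u (\<lambda>s \<omega>. step_proc (g2 m) s \<omega> - Z2 s \<omega>)) \<longlonglongrightarrow> 0" "(\<lambda>m. E2 (\<lambda>\<omega>. step_int (g2 m) \<omega> - J2 \<omega>)) \<longlonglongrightarrow> 0"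
    using assms(2) unfolding ito_on_def by blast
  have Z: "jm Z1" "jm Z2" "J1 \<in> borel_measurable P" "J2 \<in> borel_measurable P"
    using assms unfolding ito_on_def by auto
  note jmp = jm_step_proc[OF g1(1) ru(3)] jm_step_proc[OF g2(1) ru(3)]
  note mi = step_int_measurable[OF g1(1) ru(1,3)] step_int_measurable[OF g2(1) ru(1,3)]
  note tri = norm_diff_sum_le
  have "(\<lambda>m. N2 r u (\<lambda>s \<omega>. step_proc (g1 m @ g2 m) s \<omega> - (Z1 s \<omega> + Z2 s \<omega>))) \<longlonglongrightarrow> 0"
    by (rule tendsto_0_ennreal_le[OF N2_triangle tendsto_0_ennreal_lin[OF g1(2) g2(2)]])
       (auto intro!: jm_diff jmp Z simp: step_append tri)
  moreover have "(\<lambda>m. E2 (\<lambda>\<omega>. step_int (g1 m @ g2 m) \<omega> - (J1 \<omega> + J2 \<omega>))) \<longlonglongrightarrow> 0"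
    by (rule tendsto_0_ennreal_le[OF E2_triangle_AE tendsto_0_ennreal_lin[OF g1(3) g2(3)]])
       (use tri[where 'a=real] in \<open>auto intro!: borel_measurable_diff mi Z simp: step_append\<close>)
  moreover have "step_ok r u (g1 m @ g2 m)" for m using g1(1) g2(1) by (simp add: step_append)
  moreover have "jm (\<lambda>s \<omega>. Z1 s \<omega> + Z2 s \<omega>)" "(\<lambda>\<omega>. J1 \<omega> + J2 \<omega>) \<in> borel_measurable P"
    using Z by (auto intro: jm_add)
  ultimately show ?thesis
    unfolding ito_on_def by (intro conjI exI[of _ "\<lambda>m. g1 m @ g2 m"] allI)
qed

text \<open>A factor known at time \<open>r\<close> can be moved into each frozen integrand, as all
  of them start at or after \<open>r\<close>. With \<open>\<bar>c \<omega>\<bar> \<le> 1\<close> the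
  approximation errors do not grow; the main use is the localisation by an indicator.\<close>

lemma ito_on_scale:
  assumes "ito_on r u Z J" "c \<in> borel_measurable (F r)" "\<And>\<omega>. \<bar>c \<omega>\<bar> \<le> 1"
  shows "ito_on r u (\<lambda>s \<omega>. c \<omega> *\<^sub>R Z s \<omega>) (\<lambda>\<omega>. c \<omega> * J \<omega>)"
proof -
  obtain g where g: "\<And>m::nat. step_ok r u (g m)"
    "(\<lambda>m. N2 r u (\<lambda>s \<omega>. step_proc (g m) s \<omega> - Z s \<omega>)) \<longlonglongrightarrow> 0" "(\<lambda>m. E2 (\<lambda>\<omega>. step_int (g m) \<omega> - J \<omega>)) \<longlonglongrightarrow> 0"
    using assms(1) unfolding ito_on_def by blast
  let ?c = "map (\<lambda>(a, b, \<xi>). (a, b, \<lambda>\<omega>. c \<omega> *\<^sub>R \<xi> \<omega>))"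
  have proc: "step_proc (?c gs) s \<omega> = c \<omega> *\<^sub>R step_proc gs s \<omega>" for gs s \<omega>
    by (induction gs) (auto simp: step_Nil step_Cons scaleR_add_right mult.commute)
  have int: "step_int (?c gs) \<omega> = c \<omega> * step_int gs \<omega>" for gs \<omega>
    by (induction gs) (auto simp: step_Nil step_Cons distrib_left G_def)
  have bdd: "bdd_Filt a (\<lambda>\<omega>. c \<omega> *\<^sub>R \<xi> \<omega>)" if "bdd_Filt a \<xi>" "r \<le> a" for a \<xi>
  proof -
    from that obtain C where C: "\<forall>\<omega>. norm (\<xi> \<omega>) \<le> C" unfolding bdd_Filt_def by blast
    have "norm (c \<omega> *\<^sub>R \<xi> \<omega>) \<le> C" for \<omega>
      using mult_mono[OF assms(3)[of \<omega>] C[rule_format, of \<omega>]] by simp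
    moreover have "(\<lambda>\<omega>. c \<omega> *\<^sub>R \<xi> \<omega>) \<in> borel_measurable (F a)"
      using that measurable_Filt_mono[OF assms(2) that(2)] unfolding bdd_Filt_def by (intro borel_measurable_scaleR) auto
    ultimately show ?thesis unfolding bdd_Filt_def by blast
  qed
  have ok: "step_ok r u (?c gs)" if "step_ok r u gs" for gs
    using that by (induction gs) (auto simp: step_Nil step_Cons bdd)
  note le = norm_scaleR_diff_le[OF assms(3)]
  have "(\<lambda>m. N2 r u (\<lambda>s \<omega>. step_proc (?c (g m)) s \<omega> - c \<omega> *\<^sub>R Z s \<omega>)) \<longlonglongrightarrow> 0"
    by (rule tendsto_0_ennreal_le[OF N2_mono g(2)]) (simp only: proc le)
  moreover have "(\<lambda>m. E2 (\<lambda>\<omega>. step_int (?c (g m)) \<omega> - c \<omega> * J \<omega>)) \<longlonglongrightarrow> 0"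
    by (rule tendsto_0_ennreal_le[OF E2_mono g(3)]) (use le[where 'a=real] in \<open>simp add: int\<close>)
  moreover have cm: "c \<in> borel_measurable P" using measurable_Filt_P[OF assms(2)] ru by simp
  moreover have "jm (\<lambda>s \<omega>. c \<omega> *\<^sub>R Z s \<omega>)" "(\<lambda>\<omega>. c \<omega> * J \<omega>) \<in> borel_measurable P"
    using assms(1) cm unfolding ito_on_def by (auto intro: jm_scale)
  ultimately show ?thesis
    unfolding ito_on_def using ok[OF g(1)] by (intro conjI exI[of _ "\<lambda>m. ?c (g m)"] allI)
qed

text \<open>Reflecting a step integral replaces its integrands by the reflected ones and its
  increments by \<open>c\<close> times the original ones; since \<open>c * c = 1\<close>, the factor
  can be carried to the other side. It is used with \<open>c = -1\<close> inside the reflected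
  interval and \<open>c = 1\<close> after it.\<close>

lemma ito_on_flip:
  assumes tr: "0 \<le> t" "t < r'" "r' \<le> T" and I: "ito_on r u Z J" and c: "c * c = 1"
    and inc: "\<And>a b (\<omega> :: 'd omega). r \<le> a \<Longrightarrow> a \<le> b \<Longrightarrow> b \<le> u \<Longrightarrow>
      flip T t r' \<omega> [] b - flip T t r' \<omega> [] a = c *\<^sub>R (\<omega> [] b - \<omega> [] a)"
  shows "ito_on r u (\<lambda>s \<omega>. Z s (flip T t r' \<omega>)) (\<lambda>\<omega>. c * J (flip T t r' \<omega>))"
proof -
  let ?\<phi> = "flip T t r'"
  have Z: "jm Z" "J \<in> borel_measurable P" using I unfolding ito_on_def by auto
  obtain g where g: "\<And>m::nat. step_ok r u (g m)"
    "(\<lambda>m. N2 r u (\<lambda>s \<omega>. step_proc (g m) s \<omega> - Z s \<omega>)) \<longlonglongrightarrow> 0" "(\<lambda>m. E2 (\<lambda>\<omega>. step_int (g m) \<omega> - J \<omega>)) \<longlonglongrightarrow> 0"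
    using I unfolding ito_on_def by blast
  let ?c = "map (\<lambda>(a, b, \<xi>). (a, b, \<lambda>\<omega>. \<xi> (?\<phi> \<omega>)))"
  have proc: "step_proc (?c gs) s \<omega> = step_proc gs s (?\<phi> \<omega>)" for gs s \<omega>
    by (induction gs) (auto simp: step_Nil step_Cons)
  have Gf: "G a b (\<lambda>\<omega>. \<xi> (?\<phi> \<omega>)) \<omega> = c * G a b \<xi> (?\<phi> \<omega>)" if "r \<le> a" "a \<le> b" "b \<le> u" for a b \<xi> \<omega>
  proof -
    have "c * G a b \<xi> (?\<phi> \<omega>) = c * (c * (\<xi> (?\<phi> \<omega>) \<bullet> (\<omega> [] b - \<omega> [] a)))"
      unfolding G_def inc[OF that] by (simp only: inner_scaleR_right)
    also have "\<dots> = (c * c) * (\<xi> (?\<phi> \<omega>) \<bullet> (\<omega> [] b - \<omega> [] a))" by (simp only: mult.assoc)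
    finally show ?thesis unfolding c G_def by simp
  qed
  have int: "step_int (?c gs) \<omega> = c * step_int gs (?\<phi> \<omega>)" if "step_ok r u gs" for gs \<omega>
    using that by (induction gs) (auto simp: step_Nil step_Cons distrib_left Gf)
  have bdd: "bdd_Filt a (\<lambda>\<omega>. \<xi> (?\<phi> \<omega>))" if "bdd_Filt a \<xi>" "a \<le> u" for a \<xi>
    using that measurable_compose[OF flip_Filt[OF tr, of a]] ru unfolding bdd_Filt_def by auto
  have ok: "step_ok r u (?c gs)" if "step_ok r u gs" for gs
    using that by (induction gs) (auto simp: step_Nil step_Cons bdd)
  have "N2 r u (\<lambda>s \<omega>. step_proc (?c (g m)) s \<omega> - Z s (?\<phi> \<omega>)) = N2 r u (\<lambda>s \<omega>. step_proc (g m) s \<omega> - Z s \<omega>)" for m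
    unfolding proc by (rule N2_flip[OF tr]) (intro jm_diff Z jm_step_proc[OF g(1) ru(3)])
  moreover have "E2 (\<lambda>\<omega>. step_int (?c (g m)) \<omega> - c * J (?\<phi> \<omega>)) = E2 (\<lambda>\<omega>. step_int (g m) \<omega> - J \<omega>)" for m
  proof -
    have ac: "\<bar>c\<bar> = 1" using c by (metis abs_1 abs_mult_self_eq abs_square_eq_1 power2_eq_square)
    have "norm (step_int (?c (g m)) \<omega> - c * J (?\<phi> \<omega>)) = norm (step_int (g m) (?\<phi> \<omega>) - J (?\<phi> \<omega>))" for \<omega>
      unfolding int[OF g(1)] right_diff_distrib[symmetric] by (simp add: abs_mult ac)
    then have "E2 (\<lambda>\<omega>. step_int (?c (g m)) \<omega> - c * J (?\<phi> \<omega>)) = E2 (\<lambda>\<omega>. step_int (g m) (?\<phi> \<omega>) - J (?\<phi> \<omega>))"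
      unfolding E2_def by simp
    also have "\<dots> = E2 (\<lambda>\<omega>. step_int (g m) \<omega> - J \<omega>)"
      by (rule E2_flip[OF tr, of "\<lambda>\<omega>. step_int (g m) \<omega> - J \<omega>"]) (intro borel_measurable_diff step_int_measurable[OF g(1)] ru Z)
    finally show ?thesis .
  qed
  moreover have "jm (\<lambda>s \<omega>. Z s (?\<phi> \<omega>))" by (rule jm_flip[OF tr Z(1)])
  moreover have "(\<lambda>\<omega>. c * J (?\<phi> \<omega>)) \<in> borel_measurable P"
    by (intro borel_measurable_times borel_measurable_const measurable_compose[OF flip_P(1)[OF tr] Z(2)])
  ultimately show ?thesis
    unfolding ito_on_def using g(2,3) ok[OF g(1)] by (intro conjI exI[of _ "\<lambda>m. ?c (g m)"] allI) auto
qed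

text \<open>The isometry is exact for step processes. Passing from \<open>J\<close> to a step
  integral and from the step process to \<open>Z\<close> costs a factor 2 each, which gives
  4.\<close>

lemma ito_on_bounds:
  assumes I: "ito_on r u Z J"
  shows "E2 J \<le> 4 * N2 r u Z" "N2 r u Z \<le> 4 * E2 J"
proof -
  have Z: "jm Z" "J \<in> borel_measurable P" using I unfolding ito_on_def by auto
  obtain g where g: "\<And>m::nat. step_ok r u (g m)"
    "(\<lambda>m. N2 r u (\<lambda>s \<omega>. step_proc (g m) s \<omega> - Z s \<omega>)) \<longlonglongrightarrow> 0" "(\<lambda>m. E2 (\<lambda>\<omega>. step_int (g m) \<omega> - J \<omega>)) \<longlonglongrightarrow> 0"
    using I unfolding ito_on_def by blast
  let ?n = "\<lambda>m. N2 r u (\<lambda>s \<omega>. step_proc (g m) s \<omega> - Z s \<omega>)" and ?e = "\<lambda>m. E2 (\<lambda>\<omega>. step_int (g m) \<omega> - J \<omega>)"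
  note jmp = jm_step_proc[OF g(1) ru(3)]
  note mi = step_int_measurable[OF g(1) ru(1,3)]
  note iso = step_isometry(1)[OF g(1) ru(1,3)]
  note tri = norm_le_norm_plus_diff
  have 1: "E2 J \<le> 2 * E2 (step_int (g m)) + 2 * ?e m" for m
    by (rule E2_triangle_AE) (use tri[where 'a=real] in \<open>auto intro!: mi Z borel_measurable_diff\<close>)
  have 2: "E2 (step_int (g m)) \<le> 2 * E2 J + 2 * ?e m" for m
    by (rule E2_triangle_AE) (use tri[where 'a=real] in \<open>auto intro!: mi Z borel_measurable_diff\<close>)
  have 3: "N2 r u Z \<le> 2 * N2 r u (step_proc (g m)) + 2 * ?n m" for m
    by (rule N2_triangle) (auto intro!: jmp Z jm_diff tri)
  have 4: "N2 r u (step_proc (g m)) \<le> 2 * N2 r u Z + 2 * ?n m" for m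
    by (rule N2_triangle) (auto intro!: jmp Z jm_diff tri)
  have b1: "E2 J \<le> 4 * N2 r u Z + (4 * ?n m + 2 * ?e m)" for m
  proof -
    have "E2 J \<le> 2 * (2 * N2 r u Z + 2 * ?n m) + 2 * ?e m"
      by (rule order_trans[OF 1[of m]]) (intro add_mono mult_left_mono order_refl; use 4[of m] iso in simp)
    then show ?thesis by (simp add: distrib_left mult.assoc[symmetric] add.assoc)
  qed
  show "E2 J \<le> 4 * N2 r u Z"
    by (rule ennreal_le_limit[OF b1 tendsto_0_ennreal_lin[OF g(2,3)]]) auto
  have b2: "N2 r u Z \<le> 4 * E2 J + (4 * ?e m + 2 * ?n m)" for m
  proof -
    have "N2 r u Z \<le> 2 * (2 * E2 J + 2 * ?e m) + 2 * ?n m"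
      by (rule order_trans[OF 3[of m]]) (intro add_mono mult_left_mono order_refl; use 2[of m] iso in simp)
    then show ?thesis by (simp add: distrib_left mult.assoc[symmetric] add.assoc)
  qed
  show "N2 r u Z \<le> 4 * E2 J"
    by (rule ennreal_le_limit[OF b2 tendsto_0_ennreal_lin[OF g(3,2)]]) auto
qed

text \<open>The Pythagorean identity for step integrals survives in the limit up to constants. Since
  the two squares add up, the size of the sum controls both summands at once; 16 is 4 from this
  comparison times 4 from \<open>ito_on_bounds\<close>.\<close>

lemma ito_on_ortho_bounds:
  assumes I: "ito_on r u Z J" and \<eta>: "\<eta> \<in> borel_measurable (F r)" "E2 \<eta> < \<infinity>"
  shows "E2 \<eta> \<le> 2 * E2 (\<lambda>\<omega>. \<eta> \<omega> + J \<omega>)" "N2 r u Z \<le> 16 * E2 (\<lambda>\<omega>. \<eta> \<omega> + J \<omega>)"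
proof -
  have Z: "jm Z" "J \<in> borel_measurable P" using I unfolding ito_on_def by auto
  obtain g where g: "\<And>m::nat. step_ok r u (g m)" "(\<lambda>m. E2 (\<lambda>\<omega>. step_int (g m) \<omega> - J \<omega>)) \<longlonglongrightarrow> 0"
    using I unfolding ito_on_def by blast
  let ?e = "\<lambda>m. E2 (\<lambda>\<omega>. step_int (g m) \<omega> - J \<omega>)" and ?S = "E2 (\<lambda>\<omega>. \<eta> \<omega> + J \<omega>)"
  note mi = step_int_measurable[OF g(1) ru(1,3)]
  have m\<eta>: "\<eta> \<in> borel_measurable P" using measurable_Filt_P[OF \<eta>(1)] ru by simp
  note pyth = step_pythagoras[OF g(1) ru(1,3) \<eta> ru(2)]
  have 1: "E2 \<eta> + E2 (step_int (g m)) \<le> 2 * ?S + 2 * ?e m" for m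
    unfolding pyth[symmetric]
    by (rule E2_triangle_AE) (auto intro!: mi Z borel_measurable_diff borel_measurable_add m\<eta>)
  have 2: "E2 J \<le> 2 * E2 (step_int (g m)) + 2 * ?e m" for m
    by (rule E2_triangle_AE) (auto intro!: mi Z borel_measurable_diff)
  \<comment> \<open>The zero multiple only brings the error into the shape of
    \<open>tendsto_0_ennreal_lin\<close>.\<close>
  have b1: "E2 \<eta> \<le> 2 * ?S + (2 * ?e m + 0 * ?e m)" for m
    using order_trans[OF add_increasing2[OF zero_le order_refl] 1[of m]] by simp
  show "E2 \<eta> \<le> 2 * ?S"
    by (rule ennreal_le_limit[OF b1 tendsto_0_ennreal_lin[OF g(2,2)]]) auto
  have b2: "E2 J \<le> 4 * ?S + (4 * ?e m + 2 * ?e m)" for m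
  proof -
    have "E2 (step_int (g m)) \<le> 2 * ?S + 2 * ?e m"
      using order_trans[OF add_increasing[OF zero_le order_refl] 1[of m]] by simp
    then have "E2 J \<le> 2 * (2 * ?S + 2 * ?e m) + 2 * ?e m"
      by (intro order_trans[OF 2[of m]] add_mono mult_left_mono order_refl) auto
    then show ?thesis by (simp add: distrib_left mult.assoc[symmetric] add.assoc)
  qed
  have "E2 J \<le> 4 * ?S"
    by (rule ennreal_le_limit[OF b2 tendsto_0_ennreal_lin[OF g(2,2)]]) auto
  then have "4 * E2 J \<le> 4 * (4 * ?S)" by (intro mult_left_mono) auto
  with ito_on_bounds(2)[OF I] show "N2 r u Z \<le> 16 * ?S"
    by (simp add: mult.assoc[symmetric])
qed

text \<open>The integral over a subinterval is approximated by clipping the nodes of the given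
  partitions to \<open>[r, u]\<close>.\<close>

lemma ito_on_of_is_ito:
  assumes I: "is_ito T P Z I"
  shows "ito_on r u Z (\<lambda>\<omega>. I u \<omega> - I r \<omega>)"
proof -
  have Z: "progressive T P Z" "adapted T P I" using I unfolding is_ito_def by auto
  obtain n p \<xi> where ok: "\<And>m::nat. simple_ok T P (n m) (p m) (\<xi> m)"
    and cv: "(\<lambda>m. \<integral>\<^sup>+\<omega>. (\<integral>\<^sup>+s\<in>{0..T}. ennreal ((norm (simple_proc (n m) (p m) (\<xi> m) s \<omega> - Z s \<omega>))\<^sup>2) \<partial>lborel) \<partial>P) \<longlonglongrightarrow> 0"
      "(\<lambda>m. \<integral>\<^sup>+\<omega>. (SUP t\<in>{0..T}. ennreal ((simple_int (n m) (p m) (\<xi> m) t \<omega> - I t \<omega>)\<^sup>2)) \<partial>P) \<longlonglongrightarrow> 0"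
    using I unfolding is_ito_def by blast
  define cl where "cl x = max r (min u x)" for x
  \<comment> \<open>A piece starting after \<open>u\<close> collapses to the point \<open>u\<close>.
    Its integrand is set to 0, because \<open>\<xi> m k\<close> need not be known at time
    \<open>u\<close>.\<close>
  define g where "g m = map (\<lambda>k. (cl (p m k), cl (p m (Suc k)), \<lambda>\<omega>. if p m k \<le> u then \<xi> m k \<omega> else 0)) [0..<n m]" for m
  have part: "partition_of T (n m) (p m)" for m
    using ok[of m] unfolding simple_ok_def partition_of_def by auto
  have \<xi>: "\<xi> m k \<in> borel_measurable (F (p m k))" "\<exists>c. \<forall>\<omega>. norm (\<xi> m k \<omega>) \<le> c" if "k < n m" for m k
    using ok[of m] that unfolding simple_ok_def bounded_iff by auto
  have gok: "step_ok r u (g m)" for m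
    unfolding step_ok_def g_def
  proof safe
    fix a b \<zeta> assume "(a, b, \<zeta>) \<in> set (map (\<lambda>k. (cl (p m k), cl (p m (Suc k)), \<lambda>\<omega>. if p m k \<le> u then \<xi> m k \<omega> else 0)) [0..<n m])"
    then obtain k where k: "k < n m" "a = cl (p m k)" "b = cl (p m (Suc k))" "\<zeta> = (\<lambda>\<omega>. if p m k \<le> u then \<xi> m k \<omega> else 0)" by auto
    have "p m k < p m (Suc k)" using part[of m] k(1) unfolding partition_of_def by auto
    then show "a \<le> b" "r \<le> a" "b \<le> u" using k ru by (auto simp: cl_def)
    show "bdd_Filt a \<zeta>"
    proof (cases "p m k \<le> u")
      case True
      then have "p m k \<le> a" by (simp add: k cl_def)
      then show ?thesis using \<xi>[OF k(1)] measurable_Filt_mono[OF \<xi>(1)[OF k(1)]] True unfolding k(4) bdd_Filt_def by auto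
    next
      case False
      then show ?thesis unfolding k(4) bdd_Filt_def by auto
    qed
  qed
  have proc: "step_proc (g m) s \<omega> = simple_proc (n m) (p m) (\<xi> m) s \<omega>" if "s \<in> {r<..u}" for m s \<omega>
  proof -
    have "indicator {cl (p m k)<..cl (p m (Suc k))} s *\<^sub>R (if p m k \<le> u then \<xi> m k \<omega> else 0)
       = indicator {p m k<..p m (Suc k)} s *\<^sub>R \<xi> m k \<omega>" for k
      using that ru by (auto simp: cl_def split: split_indicator)
    then show ?thesis
      unfolding step_proc_def g_def simple_proc_def
      by (simp add: comp_def interv_sum_list_conv_sum_set_nat lessThan_atLeast0)
  qed
  have int: "step_int (g m) \<omega> = simple_int (n m) (p m) (\<xi> m) u \<omega> - simple_int (n m) (p m) (\<xi> m) r \<omega>" for m \<omega>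
  proof -
    have "G (cl (p m k)) (cl (p m (Suc k))) (\<lambda>\<omega>. if p m k \<le> u then \<xi> m k \<omega> else 0) \<omega>
       = \<xi> m k \<omega> \<bullet> (\<omega> [] (min u (p m (Suc k))) - \<omega> [] (min u (p m k)))
        - \<xi> m k \<omega> \<bullet> (\<omega> [] (min r (p m (Suc k))) - \<omega> [] (min r (p m k)))" if "k < n m" for k
    proof -
      have lt: "p m k < p m (Suc k)" using part[of m] that unfolding partition_of_def by auto
      \<comment> \<open>Clipping from both sides is the difference of two one-sided clippings, up to
        a constant that cancels in increments. This is what turns the clipped sum into a difference
        of \<open>simple_int\<close> at \<open>u\<close> and \<open>r\<close>.\<close>
      have w: "w (cl x) = w (min u x) - w (min r x) + w r" for x and w :: "real \<Rightarrow> real^'d"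
        using ru by (auto simp: cl_def max_def min_def)
      have "\<omega> [] (min u (p m (Suc k))) - \<omega> [] (min u (p m k)) = 0 \<and> \<omega> [] (min r (p m (Suc k))) - \<omega> [] (min r (p m k)) = 0"
        if "\<not> p m k \<le> u" using that lt ru by (auto simp: min_def)
      then show ?thesis
        by (cases "p m k \<le> u") (simp_all add: G_def w[of "\<omega> []"] inner_diff_right inner_add_right)
    qed
    then show ?thesis
      unfolding step_int_def g_def simple_int_def
      by (simp add: comp_def interv_sum_list_conv_sum_set_nat lessThan_atLeast0 sum_subtractf[symmetric])
  qed
  have It: "I t \<in> borel_measurable P" if "t \<in> {0..T}" for t
    using Z(2) measurable_Filt_P[of "I t" t] that unfolding adapted_def by auto
  have sm: "simple_int (n m) (p m) (\<xi> m) t \<in> borel_measurable P" if t: "t \<in> {0..T}" for m t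
  proof -
    have "(\<lambda>\<omega>. \<xi> m k \<omega> \<bullet> (\<omega> [] (min t (p m (Suc k))) - \<omega> [] (min t (p m k)))) \<in> borel_measurable P" if "k < n m" for k
    proof (intro borel_measurable_inner)
      have "p m k \<in> {0..T}" "p m (Suc k) \<in> {0..T}" using partition_of_range[OF part] that by auto
      then show "\<xi> m k \<in> borel_measurable P" "(\<lambda>\<omega>. \<omega> [] (min t (p m (Suc k))) - \<omega> [] (min t (p m k))) \<in> borel_measurable P"
        using measurable_Filt_P[OF \<xi>(1)[OF that]] t
        by (auto intro!: measurable_Filt_P[OF increment_measurable_Filt, of _ T])
    qed
    then show ?thesis unfolding simple_int_def[abs_def] by (intro borel_measurable_sum) auto
  qed
  have "N2 r u (\<lambda>s \<omega>. step_proc (g m) s \<omega> - Z s \<omega>)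
     \<le> (\<integral>\<^sup>+\<omega>. (\<integral>\<^sup>+s\<in>{0..T}. ennreal ((norm (simple_proc (n m) (p m) (\<xi> m) s \<omega> - Z s \<omega>))\<^sup>2) \<partial>lborel) \<partial>P)" for m
    unfolding N2_def
  proof (intro nn_integral_mono)
    fix \<omega>
    have "(N1 r u (\<lambda>s. step_proc (g m) s \<omega> - Z s \<omega>))
      \<le> (\<integral>\<^sup>+s. ennreal ((norm (simple_proc (n m) (p m) (\<xi> m) s \<omega> - Z s \<omega>))\<^sup>2) \<partial>LT)"
      by (intro nn_integral_mono) (auto simp: proc split: split_indicator)
    then show "(N1 r u (\<lambda>s. step_proc (g m) s \<omega> - Z s \<omega>))
      \<le> (\<integral>\<^sup>+s\<in>{0..T}. ennreal ((norm (simple_proc (n m) (p m) (\<xi> m) s \<omega> - Z s \<omega>))\<^sup>2) \<partial>lborel)"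
      by (simp add: nn_integral_restrict_space)
  qed
  from tendsto_0_ennreal_le[OF this cv(1)]
  have 1: "(\<lambda>m. N2 r u (\<lambda>s \<omega>. step_proc (g m) s \<omega> - Z s \<omega>)) \<longlonglongrightarrow> 0" .
  let ?s = "\<lambda>m. \<integral>\<^sup>+\<omega>. (SUP t\<in>{0..T}. ennreal ((simple_int (n m) (p m) (\<xi> m) t \<omega> - I t \<omega>)\<^sup>2)) \<partial>P"
  have d: "E2 (\<lambda>\<omega>. simple_int (n m) (p m) (\<xi> m) t \<omega> - I t \<omega>) \<le> ?s m" if "t \<in> {0..T}" for m t
    unfolding E2_def by (intro nn_integral_mono) (use that in \<open>auto intro: SUP_upper\<close>)
  have "E2 (\<lambda>\<omega>. step_int (g m) \<omega> - (I u \<omega> - I r \<omega>)) \<le> 2 * ?s m + 2 * ?s m" for m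
  proof -
    have "E2 (\<lambda>\<omega>. step_int (g m) \<omega> - (I u \<omega> - I r \<omega>)) \<le> 2 * E2 (\<lambda>\<omega>. simple_int (n m) (p m) (\<xi> m) u \<omega> - I u \<omega>)
       + 2 * E2 (\<lambda>\<omega>. simple_int (n m) (p m) (\<xi> m) r \<omega> - I r \<omega>)"
      by (rule E2_triangle_AE) (use ru in \<open>auto simp: int intro!: borel_measurable_diff sm It\<close>)
    also have "\<dots> \<le> 2 * ?s m + 2 * ?s m"
      using ru by (intro add_mono mult_left_mono d) auto
    finally show ?thesis .
  qed
  from tendsto_0_ennreal_le[OF this tendsto_0_ennreal_lin[OF cv(2) cv(2)]]
  have 2: "(\<lambda>m. E2 (\<lambda>\<omega>. step_int (g m) \<omega> - (I u \<omega> - I r \<omega>))) \<longlonglongrightarrow> 0" by simp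
  show ?thesis
    unfolding ito_on_def using jm_progressive[OF Z(1)] It[of u] It[of r] ru gok 1 2
    by (intro conjI exI[of _ g]) auto
qed

end

end

section \<open>Chaining of short intervals, absorption, and the Cauchy-Schwarz inequality\<close>

lemma iterate_forward:
  fixes f :: "real \<Rightarrow> ennreal"
  assumes step: "\<And>e s. r \<le> e \<Longrightarrow> e \<le> s \<Longrightarrow> s \<le> u \<Longrightarrow> s - e \<le> \<delta> \<Longrightarrow> f s \<le> K * f e"
    and "0 < \<delta>"
  shows "r \<le> s \<Longrightarrow> s \<le> u \<Longrightarrow> s - r \<le> real n * \<delta> \<Longrightarrow> f s \<le> K ^ n * f r"
proof (induction n arbitrary: s)
  case 0
  then show ?case by (simp add: antisym)
next
  case (Suc n)
  define e where "e = max r (s - \<delta>)"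
  have e: "r \<le> e" "e \<le> s" "s - e \<le> \<delta>" using Suc(2) \<open>0 < \<delta>\<close> by (auto simp: e_def)
  have "0 \<le> real n * \<delta>" using \<open>0 < \<delta>\<close> by simp
  moreover have "s - \<delta> - r \<le> real n * \<delta>" using Suc(4) by (simp add: algebra_simps)
  ultimately have "e - r \<le> real n * \<delta>" unfolding e_def by linarith
  then have "f e \<le> K ^ n * f r" using Suc(1)[of e] e Suc(3) by simp
  then have "K * f e \<le> K * (K ^ n * f r)" by (intro mult_left_mono) auto
  moreover have "f s \<le> K * f e" using step[of e s] e Suc(3) by simp
  ultimately show ?case by (simp add: mult.assoc)
qed

text \<open>The forward version under the time reversal \<open>s \<mapsto> -s\<close>.\<close>

lemma iterate_backward:
  fixes f :: "real \<Rightarrow> ennreal"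
  assumes step: "\<And>s e. r \<le> s \<Longrightarrow> s \<le> e \<Longrightarrow> e \<le> u \<Longrightarrow> e - s \<le> \<delta> \<Longrightarrow> f s \<le> K * f e"
    and "0 < \<delta>" "r \<le> s" "s \<le> u" "u - s \<le> real n * \<delta>"
  shows "f s \<le> K ^ n * f u"
  using iterate_forward[of "-u" "-r" \<delta> "\<lambda>x. f (- x)" K "-s" n] step[of "- _" "- _"] assms(2-) by auto

text \<open>Finiteness of \<open>x\<close> is what permits the subtraction; every use is therefore
  preceded by an a priori bound.\<close>

lemma ennreal_absorb_half:
  fixes x a :: ennreal
  assumes "x \<le> a + ennreal (1/2) * x" "x < \<infinity>"
  shows "x \<le> 2 * a"
proof (cases "a = \<infinity>")
  case True
  then show ?thesis by (simp add: ennreal_mult_top)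
next
  case False
  obtain x' where x: "x = ennreal x'" "0 \<le> x'" using assms(2) by (cases x) auto
  obtain a' where a: "a = ennreal a'" "0 \<le> a'" using False by (cases a) auto
  have "ennreal x' \<le> ennreal (a' + (1/2) * x')"
    using assms(1) x a ennreal_mult[of "1/2" x'] ennreal_plus[of a' "(1/2) * x'"] by simp
  then have "x' \<le> a' + (1/2) * x'" using x a by (subst (asm) ennreal_le_iff) auto
  then have "ennreal x' \<le> ennreal (2 * a')" by (intro ennreal_leI) linarith
  then show ?thesis using x a by (simp add: ennreal_mult)
qed

text \<open>The Cauchy-Schwarz inequality, for the Henstock-Kurzweil integral in which the equations
  are written. It follows from the nonnegativity of the integral of
  \<open>(norm (g v) - k)^2\<close>.\<close>

lemma integral_square_le:
  fixes g :: "real \<Rightarrow> 'b::euclidean_space"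
  assumes es: "e \<le> s" and m: "g \<in> borel_measurable (restrict_space lborel {e..s})"
    and bd: "\<And>v. v \<in> {e..s} \<Longrightarrow> norm (g v) \<le> C"
  shows "ennreal ((norm (integral {e..s} g))\<^sup>2)
     \<le> ennreal (s - e) * (\<integral>\<^sup>+v. indicator {e<..s} v * ennreal ((norm (g v))\<^sup>2) \<partial>lborel)"
proof (cases "e = s")
  case False
  let ?M = "restrict_space lborel {e..s}"
  interpret M: finite_measure ?M
    by (rule finite_measureI) (use es in \<open>simp add: emeasure_restrict_space space_restrict_space\<close>)
  have M1: "measure ?M (space ?M) = s - e"
    using es by (simp add: measure_restrict_space space_restrict_space)
  have sp: "space ?M = {e..s}" by (simp add: space_restrict_space)
  have bdM: "AE v in ?M. norm (g v) \<le> C" by (rule AE_I2) (use bd sp in auto)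
  have i: "integrable ?M g" by (rule M.integrable_const_bound[OF bdM m])
  have in1: "integrable ?M (\<lambda>v. norm (g v))" using i by simp
  have in2: "integrable ?M (\<lambda>v. (norm (g v))\<^sup>2)"
  proof (rule M.integrable_const_bound)
    show "AE v in ?M. norm ((norm (g v))\<^sup>2) \<le> C\<^sup>2" using bdM by eventually_elim (auto intro: power_mono)
  qed (use m in measurable)
  define a where "a = (\<integral>v. norm (g v) \<partial>?M)"
  define q where "q = (\<integral>v. (norm (g v))\<^sup>2 \<partial>?M)"
  have "set_integrable lborel {e..s} g"
    using i integrable_restrict_space[of "{e..s}" lborel g] unfolding set_integrable_def by simp
  then have "integral {e..s} g = set_lebesgue_integral lborel {e..s} g"
    by (rule set_borel_integral_eq_integral(2)[symmetric])
  also have "\<dots> = (\<integral>v. g v \<partial>?M)"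
    unfolding set_lebesgue_integral_def by (subst integral_restrict_space) auto
  finally have na: "norm (integral {e..s} g) \<le> a" unfolding a_def by simp
  have a0: "0 \<le> a" unfolding a_def by simp
  \<comment> \<open>The mean of \<open>norm (g v)\<close> over the interval, which is the optimal
    constant.\<close>
  define k where "k = a / (s - e)"
  have "0 \<le> (\<integral>v. (norm (g v) - k)\<^sup>2 \<partial>?M)" by simp
  also have "\<dots> = (\<integral>v. (norm (g v))\<^sup>2 - 2 * k * norm (g v) + k\<^sup>2 \<partial>?M)"
    by (simp add: power2_diff algebra_simps)
  also have "\<dots> = q - 2 * k * a + k\<^sup>2 * (s - e)"
    using in1 in2 M1 by (simp add: q_def a_def)
  finally have "0 \<le> (q - 2 * k * a + k\<^sup>2 * (s - e)) * (s - e)" using es by simp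
  also have "\<dots> = (s - e) * q - 2 * (k * (s - e)) * a + (k * (s - e))\<^sup>2"
    by (simp add: algebra_simps power2_eq_square)
  also have "k * (s - e) = a" using False unfolding k_def by simp
  also have "(s - e) * q - 2 * a * a + a\<^sup>2 = (s - e) * q - a\<^sup>2" by (simp add: power2_eq_square)
  finally have "a\<^sup>2 \<le> (s - e) * q" by simp
  then have "(norm (integral {e..s} g))\<^sup>2 \<le> (s - e) * q" using power_mono[OF na, of 2] by simp
  then have "ennreal ((norm (integral {e..s} g))\<^sup>2) \<le> ennreal (s - e) * ennreal q"
    using es by (subst ennreal_mult[symmetric]) (auto simp: q_def intro: ennreal_leI)
  also have "ennreal q = (\<integral>\<^sup>+v. ennreal ((norm (g v))\<^sup>2) \<partial>?M)"
    unfolding q_def using in2 by (subst nn_integral_eq_integral) auto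
  also have "\<dots> = (\<integral>\<^sup>+v. ennreal ((norm (g v))\<^sup>2) * indicator {e..s} v \<partial>lborel)"
    by (subst nn_integral_restrict_space) auto
  also have "\<dots> = (\<integral>\<^sup>+v. indicator {e<..s} v * ennreal ((norm (g v))\<^sup>2) \<partial>lborel)"
  proof (rule nn_integral_cong_AE)
    have "AE v in lborel. v \<noteq> e" by (rule AE_lborel_singleton)
    then show "AE v in lborel. ennreal ((norm (g v))\<^sup>2) * indicator {e..s} v = indicator {e<..s} v * ennreal ((norm (g v))\<^sup>2)"
      by eventually_elim (auto split: split_indicator)
  qed
  finally show ?thesis .
qed simp

section \<open>Estimates for the squared norms\<close>

context bm_space begin

lemma N2_cong_AE:
  assumes "AE \<omega> in P. \<forall>s\<in>{0..T}. norm (Z s \<omega>) = norm (Z' s \<omega>)"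
  shows "N2 r u Z = N2 r u Z'"
  unfolding N2_def
proof (rule nn_integral_cong_AE)
  show "AE \<omega> in P. (N1 r u (\<lambda>s. Z s \<omega>))
      = (N1 r u (\<lambda>s. Z' s \<omega>))"
    using assms by eventually_elim (auto intro!: nn_integral_cong)
qed

lemma E2_cong_AE: "(AE \<omega> in P. norm (J \<omega>) = norm (J' \<omega>)) \<Longrightarrow> E2 J = E2 J'"
  unfolding E2_def
proof (rule nn_integral_cong_AE)
  assume "AE \<omega> in P. norm (J \<omega>) = norm (J' \<omega>)"
  then show "AE \<omega> in P. ennreal ((norm (J \<omega>))\<^sup>2) = ennreal ((norm (J' \<omega>))\<^sup>2)" by eventually_elim simp
qed

lemma E2_indicator: "A \<in> sets P \<Longrightarrow> E2 (\<lambda>\<omega>. indicator A \<omega> *\<^sub>R c) = ennreal ((norm c)\<^sup>2) * emeasure P A"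
proof -
  assume A: "A \<in> sets P"
  have "E2 (\<lambda>\<omega>. indicator A \<omega> *\<^sub>R c) = (\<integral>\<^sup>+\<omega>. ennreal ((norm c)\<^sup>2) * indicator A \<omega> \<partial>P)"
    unfolding E2_def by (intro nn_integral_cong) (auto split: split_indicator)
  then show ?thesis using A by (simp add: nn_integral_cmult_indicator)
qed

lemma emeasure_LT: "0 \<le> r \<Longrightarrow> r \<le> u \<Longrightarrow> u \<le> T \<Longrightarrow> emeasure LT {r<..u} = ennreal (u - r)"
  by (subst emeasure_restrict_space) auto

lemma N2_indicator:
  fixes c :: "'d omega \<Rightarrow> 'b::{real_normed_vector,second_countable_topology}"
  assumes "A \<in> sets P" "0 \<le> r" "r \<le> u" "u \<le> T" and c: "c \<in> borel_measurable P"
  shows "N2 r u (\<lambda>s \<omega>. indicator A \<omega> *\<^sub>R c \<omega>) = ennreal (u - r) * E2 (\<lambda>\<omega>. indicator A \<omega> *\<^sub>R c \<omega>)"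
proof -
  have S: "{r<..u} \<in> sets LT" using assms by (subst sets_restrict_space_iff) auto
  have "N2 r u (\<lambda>s \<omega>. indicator A \<omega> *\<^sub>R c \<omega>) = (\<integral>\<^sup>+\<omega>. ennreal (u - r) * ennreal ((norm (indicator A \<omega> *\<^sub>R c \<omega>))\<^sup>2) \<partial>P)"
    unfolding N2_def using S emeasure_LT[OF assms(2-4)]
    by (intro nn_integral_cong) (simp add: nn_integral_multc)
  also have "\<dots> = ennreal (u - r) * E2 (\<lambda>\<omega>. indicator A \<omega> *\<^sub>R c \<omega>)"
    unfolding E2_def using c assms(1)
    by (intro nn_integral_cmult measurable_compose[OF _ measurable_ennreal] borel_measurable_power
        borel_measurable_norm borel_measurable_scaleR) auto
  finally show ?thesis .
qed

lemma N2_swap: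
  fixes H :: "real \<Rightarrow> 'd omega \<Rightarrow> 'b::{real_normed_vector,second_countable_topology}"
  assumes "jm H"
  shows "N2 r u H = (\<integral>\<^sup>+s. indicator {r<..u} s * E2 (H s) \<partial>LT)"
    and "N2 r u H = (\<integral>\<^sup>+x. indicator {r<..u} (fst x) * ennreal ((norm (H (fst x) (snd x)))\<^sup>2) \<partial>(LT \<Otimes>\<^sub>M P))"
    and "(\<lambda>x. indicator {r<..u} (fst x) * ennreal ((norm (H (fst x) (snd x)))\<^sup>2)) \<in> borel_measurable (LT \<Otimes>\<^sub>M P)"
proof -
  have sfP: "sigma_finite_measure P" by (rule P.sigma_finite_measure_axioms)
  interpret LTs: sigma_finite_measure LT by (rule sigma_finite_LT)
  interpret pair_sigma_finite LT P ..
  have i: "indicator {r<..u} \<in> borel_measurable LT" by (rule measurable_LT) simp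
  have [measurable]: "(\<lambda>x. H (fst x) (snd x)) \<in> borel_measurable (LT \<Otimes>\<^sub>M P)"
    using assms by (simp add: jm_def case_prod_beta')
  have [measurable]: "(\<lambda>x. indicator {r<..u} (fst x) :: ennreal) \<in> borel_measurable (LT \<Otimes>\<^sub>M P)"
    by (rule measurable_compose[OF measurable_fst i])
  show m: "(\<lambda>x. indicator {r<..u} (fst x) * ennreal ((norm (H (fst x) (snd x)))\<^sup>2)) \<in> borel_measurable (LT \<Otimes>\<^sub>M P)"
    by measurable
  show 2: "N2 r u H = (\<integral>\<^sup>+x. indicator {r<..u} (fst x) * ennreal ((norm (H (fst x) (snd x)))\<^sup>2) \<partial>(LT \<Otimes>\<^sub>M P))"
    unfolding N2_def using nn_integral_snd[OF m] by simp
  have "N2 r u H = (\<integral>\<^sup>+s. (\<integral>\<^sup>+\<omega>. indicator {r<..u} s * ennreal ((norm (H s \<omega>))\<^sup>2) \<partial>P) \<partial>LT)"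
    unfolding 2 using sigma_finite_measure.nn_integral_fst[OF sfP m] by simp
  also have "\<dots> = (\<integral>\<^sup>+s. indicator {r<..u} s * E2 (H s) \<partial>LT)"
    unfolding E2_def
  proof (intro nn_integral_cong nn_integral_cmult)
    fix s assume "s \<in> space LT"
    then have [measurable]: "H s \<in> borel_measurable P" using jm_section2[OF assms] by simp
    show "(\<lambda>\<omega>. ennreal ((norm (H s \<omega>))\<^sup>2)) \<in> borel_measurable P" by measurable
  qed
  finally show "N2 r u H = (\<integral>\<^sup>+s. indicator {r<..u} s * E2 (H s) \<partial>LT)" .
qed

lemma N2_le_sup:
  fixes H :: "real \<Rightarrow> 'd omega \<Rightarrow> 'b::{real_normed_vector,second_countable_topology}"
  assumes "jm H" "0 \<le> r" "r \<le> u" "u \<le> T" "\<And>s. s \<in> {r..u} \<Longrightarrow> E2 (H s) \<le> S"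
  shows "N2 r u H \<le> ennreal (u - r) * S"
proof -
  have S: "{r<..u} \<in> sets LT" using assms by (subst sets_restrict_space_iff) auto
  have "N2 r u H \<le> (\<integral>\<^sup>+s. S * indicator {r<..u} s \<partial>LT)"
    unfolding N2_swap(1)[OF assms(1)] using assms(5)
    by (intro nn_integral_mono) (auto split: split_indicator)
  also have "\<dots> = ennreal (u - r) * S"
    using S emeasure_LT[OF assms(2-4)] by (simp add: nn_integral_cmult_indicator mult.commute)
  finally show ?thesis .
qed

text \<open>Cauchy-Schwarz on almost every path, then expectation. The uniform bound
  \<open>C\<close> serves integrability only and does not enter the estimate.\<close>

lemma E2_integral_le:
  fixes H :: "real \<Rightarrow> 'd omega \<Rightarrow> 'c::{real_normed_vector,second_countable_topology}"
    and gg :: "real \<Rightarrow> 'd omega \<Rightarrow> 'b::euclidean_space"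
  assumes es: "0 \<le> e" "e \<le> s" "s \<le> T" and H: "jm H"
    and g: "AE \<omega> in P. (\<lambda>v. gg v \<omega>) \<in> borel_measurable LT \<and> (\<forall>v\<in>{0..T}. norm (gg v \<omega>) \<le> C) \<and>
         (\<forall>v\<in>{e..s}. norm (gg v \<omega>) \<le> l * norm (H v \<omega>))" and l: "0 \<le> l"
  shows "E2 (\<lambda>\<omega>. integral {e..s} (\<lambda>v. gg v \<omega>)) \<le> ennreal ((s - e) * l\<^sup>2) * N2 e s H"
proof -
  let ?N = "\<lambda>\<omega>. N1 e s (\<lambda>v. H v \<omega>)"
  have "E2 (\<lambda>\<omega>. integral {e..s} (\<lambda>v. gg v \<omega>)) \<le> (\<integral>\<^sup>+\<omega>. ennreal ((s - e) * l\<^sup>2) * ?N \<omega> \<partial>P)"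
    unfolding E2_def
  proof (rule nn_integral_mono_AE)
    have "AE \<omega> in P. \<omega> \<in> Omega T" by (rule AE_I2) simp
    with g show "AE \<omega> in P. ennreal ((norm (integral {e..s} (\<lambda>v. gg v \<omega>)))\<^sup>2) \<le> ennreal ((s - e) * l\<^sup>2) * ?N \<omega>"
    proof eventually_elim
      fix \<omega> assume \<omega>: "\<omega> \<in> Omega T" and g: "(\<lambda>v. gg v \<omega>) \<in> borel_measurable LT \<and> (\<forall>v\<in>{0..T}. norm (gg v \<omega>) \<le> C) \<and>
         (\<forall>v\<in>{e..s}. norm (gg v \<omega>) \<le> l * norm (H v \<omega>))"
      have "restrict_space LT {e..s} = restrict_space lborel {e..s}"
        using es by (subst restrict_restrict_space) (auto simp: Int_absorb1)
      then have m: "(\<lambda>v. gg v \<omega>) \<in> borel_measurable (restrict_space lborel {e..s})"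
        using measurable_restrict_space1[of "\<lambda>v. gg v \<omega>" LT borel "{e..s}"] g by simp
      have "ennreal ((norm (integral {e..s} (\<lambda>v. gg v \<omega>)))\<^sup>2)
         \<le> ennreal (s - e) * (\<integral>\<^sup>+v. indicator {e<..s} v * ennreal ((norm (gg v \<omega>))\<^sup>2) \<partial>lborel)"
        by (rule integral_square_le[OF es(2) m, of C]) (use g es in auto)
      also have "(\<integral>\<^sup>+v. indicator {e<..s} v * ennreal ((norm (gg v \<omega>))\<^sup>2) \<partial>lborel)
         = (N1 e s (\<lambda>v. gg v \<omega>))"
        using es by (subst nn_integral_restrict_space) (auto intro!: nn_integral_cong split: split_indicator)
      also have "\<dots> \<le> (\<integral>\<^sup>+v. ennreal (l\<^sup>2) * (indicator {e<..s} v * ennreal ((norm (H v \<omega>))\<^sup>2)) \<partial>LT)"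
      proof (rule nn_integral_mono)
        fix v
        show "indicator {e<..s} v * ennreal ((norm (gg v \<omega>))\<^sup>2) \<le> ennreal (l\<^sup>2) * (indicator {e<..s} v * ennreal ((norm (H v \<omega>))\<^sup>2))"
        proof (cases "v \<in> {e<..s}")
          case True
          then have "(norm (gg v \<omega>))\<^sup>2 \<le> (l * norm (H v \<omega>))\<^sup>2" using g by (intro power_mono) auto
          then show ?thesis using True by (simp add: ennreal_mult[symmetric] power_mult_distrib ennreal_leI)
        qed simp
      qed
      also have "\<dots> = ennreal (l\<^sup>2) * ?N \<omega>"
      proof (rule nn_integral_cmult)
        have [measurable]: "(\<lambda>v. H v \<omega>) \<in> borel_measurable LT" by (rule jm_section[OF H \<omega>])
        have [measurable]: "indicator {e<..s} \<in> borel_measurable LT" by (rule measurable_LT) simp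
        show "(\<lambda>v. indicator {e<..s} v * ennreal ((norm (H v \<omega>))\<^sup>2)) \<in> borel_measurable LT" by measurable
      qed
      finally show "ennreal ((norm (integral {e..s} (\<lambda>v. gg v \<omega>)))\<^sup>2) \<le> ennreal ((s - e) * l\<^sup>2) * ?N \<omega>"
        using es by (simp add: ennreal_mult mult.assoc mult_left_mono)
    qed
  qed
  also have "\<dots> = ennreal ((s - e) * l\<^sup>2) * N2 e s H"
    unfolding N2_def by (intro nn_integral_cmult N2_inner_measurable H)
  finally show ?thesis .
qed

lemma E2_vec:
  fixes V :: "'d \<Rightarrow> 'd omega \<Rightarrow> real"
  assumes "\<And>j. V j \<in> borel_measurable P"
  shows "E2 (\<lambda>\<omega>. \<chi> j. V j \<omega>) = (\<Sum>j\<in>UNIV. E2 (V j))"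
proof -
  have *: "ennreal ((norm (\<chi> j. V j \<omega>))\<^sup>2) = (\<Sum>j\<in>UNIV. ennreal ((norm (V j \<omega>))\<^sup>2))" for \<omega>
  proof -
    have "(norm (\<chi> j. V j \<omega>))\<^sup>2 = (\<Sum>j\<in>UNIV. (norm (V j \<omega>))\<^sup>2)"
      unfolding norm_vec_def L2_set_def by (simp add: sum_nonneg)
    then show ?thesis by (simp add: sum_ennreal)
  qed
  note [measurable] = assms
  show ?thesis unfolding E2_def * by (rule nn_integral_sum) measurable
qed

lemma N2_subinterval:
  assumes "r' \<le> r" "u \<le> u'" shows "N2 r u H \<le> N2 r' u' H"
  unfolding N2_def using assms
  by (intro nn_integral_mono mult_right_mono) (auto split: split_indicator)

lemma N2_Pair:
  fixes H1 :: "real \<Rightarrow> 'd omega \<Rightarrow> 'b::{real_normed_vector,second_countable_topology}"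
    and H2 :: "real \<Rightarrow> 'd omega \<Rightarrow> 'c::{real_normed_vector,second_countable_topology}"
  assumes "jm H1" "jm H2"
  shows "N2 r u (\<lambda>s \<omega>. (H1 s \<omega>, H2 s \<omega>)) = N2 r u H1 + N2 r u H2"
proof -
  let ?n = "\<lambda>\<omega> h. N1 r u (\<lambda>s. h s)"
  have [measurable]: "indicator {r<..u} \<in> borel_measurable LT" by (rule measurable_LT) simp
  have "N2 r u (\<lambda>s \<omega>. (H1 s \<omega>, H2 s \<omega>)) = (\<integral>\<^sup>+\<omega>. ?n \<omega> (\<lambda>s. H1 s \<omega>) + ?n \<omega> (\<lambda>s. H2 s \<omega>) \<partial>P)"
    unfolding N2_def
  proof (rule nn_integral_cong)
    fix \<omega> assume "\<omega> \<in> space P"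
    then have [measurable]: "(\<lambda>s. H1 s \<omega>) \<in> borel_measurable LT" "(\<lambda>s. H2 s \<omega>) \<in> borel_measurable LT"
      using jm_section assms by auto
    have "indicator {r<..u} s * ennreal ((norm (H1 s \<omega>, H2 s \<omega>))\<^sup>2)
      = indicator {r<..u} s * ennreal ((norm (H1 s \<omega>))\<^sup>2) + indicator {r<..u} s * ennreal ((norm (H2 s \<omega>))\<^sup>2)" for s
      by (simp add: norm_Pair ennreal_plus distrib_left)
    then show "?n \<omega> (\<lambda>s. (H1 s \<omega>, H2 s \<omega>)) = ?n \<omega> (\<lambda>s. H1 s \<omega>) + ?n \<omega> (\<lambda>s. H2 s \<omega>)"
      by (simp add: nn_integral_add)
  qed
  also have "\<dots> = N2 r u H1 + N2 r u H2"
    unfolding N2_def by (intro nn_integral_add N2_inner_measurable assms)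
  finally show ?thesis .
qed

lemma jm_Pair: "jm (H1 :: real \<Rightarrow> 'd omega \<Rightarrow> 'b::second_countable_topology) \<Longrightarrow> jm (H2 :: real \<Rightarrow> 'd omega \<Rightarrow> 'c::second_countable_topology) \<Longrightarrow> jm (\<lambda>s \<omega>. (H1 s \<omega>, H2 s \<omega>))"
  unfolding jm_def case_prod_beta' by (rule borel_measurable_Pair)

lemma indicator_flip_AE:
  assumes "0 \<le> t" "t < r" "r \<le> T" "A \<in> sets (F t)"
  shows "AE \<omega> in P. (indicator A (flip T t r \<omega>) :: real) = indicator A \<omega>"
  using flip_invariant_Filt[OF assms] by eventually_elim (auto split: split_indicator)

text \<open>An event of the past of \<open>t\<close> is almost surely invariant, so the indicator
  may be reflected as well; then \<open>P\<close> is preserved.\<close>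

lemma E2_indicator_flip:
  fixes V :: "'d omega \<Rightarrow> 'b::{real_normed_vector,second_countable_topology}"
  assumes tr: "0 \<le> t" "t < r" "r \<le> T" and A: "A \<in> sets (F t)" and V: "V \<in> borel_measurable P"
  shows "E2 (\<lambda>\<omega>. indicator A \<omega> *\<^sub>R V (flip T t r \<omega>)) = E2 (\<lambda>\<omega>. indicator A \<omega> *\<^sub>R V \<omega>)"
proof -
  have AP: "A \<in> sets P" using A sets_Filt_subset[of t] tr by auto
  have "E2 (\<lambda>\<omega>. indicator A \<omega> *\<^sub>R V (flip T t r \<omega>)) = E2 (\<lambda>\<omega>. indicator A (flip T t r \<omega>) *\<^sub>R V (flip T t r \<omega>))"
    by (rule E2_cong_AE) (use indicator_flip_AE[OF tr A] in eventually_elim, simp)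
  also have "\<dots> = E2 (\<lambda>\<omega>. indicator A \<omega> *\<^sub>R V \<omega>)"
    by (rule E2_flip[OF tr, of "\<lambda>\<omega>. indicator A \<omega> *\<^sub>R V \<omega>"]) (use AP V in measurable)
  finally show ?thesis .
qed

lemma N2_indicator_flip:
  fixes V :: "real \<Rightarrow> 'd omega \<Rightarrow> 'b::{real_normed_vector,second_countable_topology}"
  assumes tr: "0 \<le> t" "t < r" "r \<le> T" and A: "A \<in> sets (F t)" and V: "jm V"
  shows "N2 e u (\<lambda>s \<omega>. indicator A \<omega> *\<^sub>R V s (flip T t r \<omega>)) = N2 e u (\<lambda>s \<omega>. indicator A \<omega> *\<^sub>R V s \<omega>)"
proof -
  have AP: "indicator A \<in> borel_measurable P" using A sets_Filt_subset[of t] tr by auto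
  have "N2 e u (\<lambda>s \<omega>. indicator A \<omega> *\<^sub>R V s (flip T t r \<omega>)) = N2 e u (\<lambda>s \<omega>. indicator A (flip T t r \<omega>) *\<^sub>R V s (flip T t r \<omega>))"
    by (rule N2_cong_AE) (use indicator_flip_AE[OF tr A] in eventually_elim, simp)
  also have "\<dots> = N2 e u (\<lambda>s \<omega>. indicator A \<omega> *\<^sub>R V s \<omega>)"
    by (rule N2_flip[OF tr, of "\<lambda>s \<omega>. indicator A \<omega> *\<^sub>R V s \<omega>"]) (intro jm_scale AP V)
  finally show ?thesis .
qed

end

section \<open>Stability under reflection\<close>

lemma continuous_on_path:
  fixes h :: "real \<Rightarrow> 'b::topological_space \<Rightarrow> 'c::metric_space" and x :: "real \<Rightarrow> 'b"
  assumes "continuous_on ({0..T} \<times> UNIV) (\<lambda>(s, x). h s x)" "continuous_on {0..T} x"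
  shows "continuous_on {0..T} (\<lambda>s. h s (x s))"
proof -
  have "continuous_on {0..T} (\<lambda>s. (\<lambda>(s, x). h s x) (s, x s))"
    by (rule continuous_on_compose2[OF assms(1)]) (auto intro!: continuous_intros assms(2))
  then show ?thesis by simp
qed

lemma numeral_ennreal_mult: "0 \<le> a \<Longrightarrow> numeral k * (ennreal a * x) = ennreal (numeral k * a) * x"
  by (simp add: ennreal_mult mult.assoc)

lemma (in bm_space) is_ito_measurable:
  assumes "is_ito T P Z I" "t \<in> {0..T}" shows "I t \<in> borel_measurable P"
proof (rule measurable_Filt_P)
  have "adapted T P I" using assms(1) unfolding is_ito_def by blast
  then show "I t \<in> borel_measurable (F t)" using assms(2) unfolding adapted_def by blast
qed (use assms in auto)

lemma (in bm_space) N2_cmult: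
  fixes H :: "real \<Rightarrow> 'd omega \<Rightarrow> 'b::{real_normed_vector,second_countable_topology}"
  assumes "jm H"
  shows "N2 r u (\<lambda>s \<omega>. c *\<^sub>R H s \<omega>) = ennreal (c\<^sup>2) * N2 r u H"
proof -
  have [measurable]: "indicator {r<..u} \<in> borel_measurable LT" by (rule measurable_LT) simp
  have "N2 r u (\<lambda>s \<omega>. c *\<^sub>R H s \<omega>) = (\<integral>\<^sup>+\<omega>. ennreal (c\<^sup>2) * (N1 r u (\<lambda>s. H s \<omega>)) \<partial>P)"
    unfolding N2_def
  proof (rule nn_integral_cong)
    fix \<omega> assume "\<omega> \<in> space P"
    then have [measurable]: "(\<lambda>s. H s \<omega>) \<in> borel_measurable LT" using jm_section[OF assms] by simp
    have "indicator {r<..u} s * ennreal ((norm (c *\<^sub>R H s \<omega>))\<^sup>2) = ennreal (c\<^sup>2) * (indicator {r<..u} s * ennreal ((norm (H s \<omega>))\<^sup>2))" for s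
      by (simp add: power_mult_distrib ennreal_mult ac_simps)
    then show "(N1 r u (\<lambda>s. c *\<^sub>R H s \<omega>))
       = ennreal (c\<^sup>2) * (N1 r u (\<lambda>s. H s \<omega>))"
      by (simp add: nn_integral_cmult)
  qed
  also have "\<dots> = ennreal (c\<^sup>2) * N2 r u H"
    unfolding N2_def by (intro nn_integral_cmult N2_inner_measurable assms)
  finally show ?thesis .
qed

lemma (in bm_space) ito_on_diff:
  assumes ru: "0 \<le> r" "r \<le> u" "u \<le> T" and I: "ito_on r u Z1 J1" "ito_on r u Z2 J2"
  shows "ito_on r u (\<lambda>s \<omega>. Z1 s \<omega> - Z2 s \<omega>) (\<lambda>\<omega>. J1 \<omega> - J2 \<omega>)"
proof -
  have "ito_on r u (\<lambda>s \<omega>. (-1) *\<^sub>R Z2 s \<omega>) (\<lambda>\<omega>. (-1) * J2 \<omega>)"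
    by (rule ito_on_scale[OF ru I(2)]) auto
  from ito_on_add[OF ru I(1) this] show ?thesis by simp
qed

text \<open>Common form of the particle system and of the mean-field system: the first argument of a coefficient
  stands for its dependence on the \<open>W\<^sup>i\<close> with \<open>i \<noteq> 0\<close>, and the law or the empirical measure has been
  integrated out.\<close>

locale fbsde = bm_space T M0 P for T M0 and P :: "('d::finite) omega measure" +
  fixes B L :: real and x0 :: "real^'d"
    and bt :: "'d omega \<Rightarrow> real \<Rightarrow> real^'d \<Rightarrow> real^'d"
    and st :: "'d omega \<Rightarrow> real \<Rightarrow> real^'d \<Rightarrow> real^'d^'d"
    and gt :: "'d omega \<Rightarrow> real^'d \<Rightarrow> real"
    and ft :: "'d omega \<Rightarrow> real \<Rightarrow> (real^'d) \<times> real \<times> (real^'d) \<Rightarrow> real"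
    and X :: "real \<Rightarrow> 'd omega \<Rightarrow> real^'d" and Y :: "real \<Rightarrow> 'd omega \<Rightarrow> real"
    and Z :: "real \<Rightarrow> 'd omega \<Rightarrow> real^'d"
    and IX :: "'d \<Rightarrow> real \<Rightarrow> 'd omega \<Rightarrow> real" and IY :: "real \<Rightarrow> 'd omega \<Rightarrow> real"
  assumes B0: "0 \<le> B" and L0: "0 \<le> L"
    and invariant: "\<And>\<omega> \<omega>'. \<omega> \<in> Omega T \<Longrightarrow> \<omega>' \<in> Omega T \<Longrightarrow> (\<And>i. i \<noteq> [] \<Longrightarrow> \<omega> i = \<omega>' i) \<Longrightarrow>
      bt \<omega> = bt \<omega>' \<and> st \<omega> = st \<omega>' \<and> gt \<omega> = gt \<omega>' \<and> ft \<omega> = ft \<omega>'"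
    and bt_bound: "\<And>\<omega> s x. \<omega> \<in> Omega T \<Longrightarrow> s \<in> {0..T} \<Longrightarrow> norm (bt \<omega> s x) \<le> B"
    and st_bound: "\<And>\<omega> s x. \<omega> \<in> Omega T \<Longrightarrow> s \<in> {0..T} \<Longrightarrow> norm (st \<omega> s x) \<le> B"
    and ft_bound: "\<And>\<omega> s x. \<omega> \<in> Omega T \<Longrightarrow> s \<in> {0..T} \<Longrightarrow> norm (ft \<omega> s x) \<le> B"
    and bt_lip: "\<And>\<omega> s x y. \<omega> \<in> Omega T \<Longrightarrow> s \<in> {0..T} \<Longrightarrow> norm (bt \<omega> s x - bt \<omega> s y) \<le> L * norm (x - y)"
    and st_lip: "\<And>\<omega> s x y. \<omega> \<in> Omega T \<Longrightarrow> s \<in> {0..T} \<Longrightarrow> norm (st \<omega> s x - st \<omega> s y) \<le> L * norm (x - y)"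
    and gt_lip: "\<And>\<omega> x y. \<omega> \<in> Omega T \<Longrightarrow> norm (gt \<omega> x - gt \<omega> y) \<le> L * norm (x - y)"
    and ft_lip: "\<And>\<omega> s x y. \<omega> \<in> Omega T \<Longrightarrow> s \<in> {0..T} \<Longrightarrow> norm (ft \<omega> s x - ft \<omega> s y) \<le> L * norm (x - y)"
    and bt_cont: "\<And>\<omega>. \<omega> \<in> Omega T \<Longrightarrow> continuous_on ({0..T} \<times> UNIV) (\<lambda>(s, x). bt \<omega> s x)"
    and ft_cont: "\<And>\<omega>. \<omega> \<in> Omega T \<Longrightarrow> continuous_on ({0..T} \<times> UNIV) (\<lambda>(s, x). ft \<omega> s x)"
    and X_proc: "cont_paths T P X" "adapted T P X"
    and X_ito: "\<And>j. is_ito T P (\<lambda>s \<omega>. st \<omega> s (X s \<omega>) $ j) (IX j)"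
    and X_eq: "AE \<omega> in P. \<forall>t\<in>{0..T}. X t \<omega> = x0 + integral {0..t} (\<lambda>s. bt \<omega> s (X s \<omega>)) + (\<chi> j. IX j t \<omega>)"
    and Y_S2: "S2 T P Y" and Z_L2: "L2 T P Z" and Y_ito: "is_ito T P Z IY"
    and Y_eq: "AE \<omega> in P. \<forall>t\<in>{0..T}. Y t \<omega> = gt \<omega> (X T \<omega>)
        + integral {t..T} (\<lambda>s. ft \<omega> s (X s \<omega>, Y s \<omega>, Z s \<omega>)) - (IY T \<omega> - IY t \<omega>)"
begin

abbreviation pm :: "'d omega set \<Rightarrow> ennreal" where "pm A \<equiv> emeasure P A"

lemma X_cont: "\<omega> \<in> Omega T \<Longrightarrow> continuous_on {0..T} (\<lambda>t. X t \<omega>)"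
  using X_proc(1) unfolding cont_paths_def by simp

lemma Y_cont: "\<omega> \<in> Omega T \<Longrightarrow> continuous_on {0..T} (\<lambda>t. Y t \<omega>)"
  using Y_S2 unfolding S2_def cont_paths_def by simp

lemma X_Filt: "t \<in> {0..T} \<Longrightarrow> X t \<in> borel_measurable (F t)"
  using X_proc(2) unfolding adapted_def by simp

lemma Y_Filt: "t \<in> {0..T} \<Longrightarrow> Y t \<in> borel_measurable (F t)"
  using Y_S2 unfolding S2_def adapted_def by simp

lemma X_meas: "t \<in> {0..T} \<Longrightarrow> X t \<in> borel_measurable P"
  using measurable_Filt_P[OF X_Filt] by simp

lemma Y_meas: "t \<in> {0..T} \<Longrightarrow> Y t \<in> borel_measurable P"
  using measurable_Filt_P[OF Y_Filt] by simp

lemma I_meas: "t \<in> {0..T} \<Longrightarrow> IX j t \<in> borel_measurable P" "t \<in> {0..T} \<Longrightarrow> IY t \<in> borel_measurable P"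
  by (auto intro: is_ito_measurable[OF X_ito] is_ito_measurable[OF Y_ito])

lemma jm_X: "jm X" by (rule jm_continuous[OF X_meas X_cont])
lemma jm_Y: "jm Y" by (rule jm_continuous[OF Y_meas Y_cont])
lemma jm_Z: "jm Z" using Z_L2 unfolding L2_def by (intro jm_progressive) simp

lemma continuous_LT: "continuous_on {0..T} h \<Longrightarrow> h \<in> borel_measurable LT" for h :: "real \<Rightarrow> 'b::topological_space"
proof -
  assume "continuous_on {0..T} h"
  then have "h \<in> borel_measurable (restrict_space borel {0..T})" by (rule borel_measurable_continuous_on_restrict)
  then show ?thesis by (subst measurable_cong_sets[OF sets_restrict_space_cong]) auto
qed

text \<open>\<open>Z\<close> is merely measurable in time, so the joint continuity of
  \<open>ft\<close> in time and state is what makes the composition measurable.\<close>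

lemma ft_path_measurable:
  assumes "\<omega> \<in> Omega T" "x \<in> borel_measurable LT" "y \<in> borel_measurable LT" "z \<in> borel_measurable LT"
  shows "(\<lambda>s. ft \<omega> s (x s, y s, z s)) \<in> borel_measurable LT"
proof -
  have "continuous_on ({0..T} \<times> UNIV) (\<lambda>(s, x). ft \<omega> s x)" by (rule ft_cont[OF assms(1)])
  then have m: "(\<lambda>(s, x). ft \<omega> s x) \<in> borel_measurable (restrict_space borel ({0..T} \<times> UNIV))"
    by (rule borel_measurable_continuous_on_restrict)
  have "(\<lambda>s. (s, x s, y s, z s)) \<in> LT \<rightarrow>\<^sub>M restrict_space borel ({0..T} \<times> UNIV)"
  proof (rule measurable_restrict_space2)
    have "(\<lambda>s. s) \<in> borel_measurable LT" by (rule measurable_LT) simp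
    then show "(\<lambda>s. (s, x s, y s, z s)) \<in> borel_measurable LT"
      using assms(2-) by (intro borel_measurable_Pair)
  qed auto
  from measurable_compose[OF this m] show ?thesis by simp
qed

lemma bt_path_cont:
  assumes "\<omega> \<in> Omega T" "\<omega>' \<in> Omega T" shows "continuous_on {0..T} (\<lambda>s. bt \<omega> s (X s \<omega>'))"
  by (rule continuous_on_path[OF bt_cont[OF assms(1)] X_cont[OF assms(2)]])

lemma ft_path_LT:
  assumes "\<omega> \<in> Omega T" "\<omega>' \<in> Omega T"
  shows "(\<lambda>s. ft \<omega> s (X s \<omega>', Y s \<omega>', Z s \<omega>')) \<in> borel_measurable LT"
  by (rule ft_path_measurable[OF assms(1)]) (use assms(2) continuous_LT[OF X_cont] continuous_LT[OF Y_cont] jm_section[OF jm_Z] in auto)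

lemma bounded_LT_integrable:
  fixes h :: "real \<Rightarrow> 'b::euclidean_space"
  assumes "h \<in> borel_measurable LT" "\<And>s. s \<in> {0..T} \<Longrightarrow> norm (h s) \<le> C" "0 \<le> e" "s \<le> T"
  shows "h integrable_on {e..s}"
proof -
  interpret LTf: finite_measure LT by (rule finite_measure_LT)
  have "integrable LT h" by (rule LTf.integrable_const_bound[of _ C]) (use assms in auto)
  then have "set_integrable lborel {0..T} h"
    using integrable_restrict_space[of "{0..T}" lborel h] unfolding set_integrable_def by simp
  then have "h integrable_on {0..T}" by (rule set_borel_integral_eq_integral(1))
  then show ?thesis by (rule integrable_on_subinterval) (use assms in auto)
qed

text \<open>A single null set serves all pairs of times, so the identity can be reflected once and
  for all by \<open>AE_flip\<close>.\<close>

lemma X_increment: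
  "AE \<omega> in P. \<forall>e\<in>{0..T}. \<forall>s\<in>{e..T}. X s \<omega> - X e \<omega> =
     integral {e..s} (\<lambda>v. bt \<omega> v (X v \<omega>)) + (\<chi> j. IX j s \<omega> - IX j e \<omega>)"
proof -
  have "AE \<omega> in P. \<omega> \<in> Omega T" by (rule AE_I2) simp
  with X_eq show ?thesis
  proof eventually_elim
    fix \<omega> assume eq: "\<forall>t\<in>{0..T}. X t \<omega> = x0 + integral {0..t} (\<lambda>s. bt \<omega> s (X s \<omega>)) + (\<chi> j. IX j t \<omega>)"
      and \<omega>: "\<omega> \<in> Omega T"
    show "\<forall>e\<in>{0..T}. \<forall>s\<in>{e..T}. X s \<omega> - X e \<omega> = integral {e..s} (\<lambda>v. bt \<omega> v (X v \<omega>)) + (\<chi> j. IX j s \<omega> - IX j e \<omega>)"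
    proof (intro ballI)
      fix e s assume es: "e \<in> {0..T}" "s \<in> {e..T}"
      have "(\<lambda>v. bt \<omega> v (X v \<omega>)) integrable_on {0..s}"
        using es by (intro bounded_LT_integrable[of _ B] continuous_LT bt_path_cont \<omega> bt_bound) auto
      from Henstock_Kurzweil_Integration.integral_combine[OF _ _ this, of e]
      have i: "integral {0..s} (\<lambda>v. bt \<omega> v (X v \<omega>)) = integral {0..e} (\<lambda>v. bt \<omega> v (X v \<omega>)) + integral {e..s} (\<lambda>v. bt \<omega> v (X v \<omega>))"
        using es by simp
      have "(\<chi> j. IX j s \<omega> - IX j e \<omega>) = (\<chi> j. IX j s \<omega>) - (\<chi> j. IX j e \<omega>)" by (simp add: vec_eq_iff)
      then show "X s \<omega> - X e \<omega> = integral {e..s} (\<lambda>v. bt \<omega> v (X v \<omega>)) + (\<chi> j. IX j s \<omega> - IX j e \<omega>)"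
        using eq es i by simp
    qed
  qed
qed

text \<open>The value at the earlier time and the later stochastic integral stand on one side: they
  are orthogonal, and \<open>ito_on_ortho_bounds\<close> applies to their sum.\<close>

lemma Y_increment:
  "AE \<omega> in P. \<forall>s\<in>{0..T}. \<forall>e\<in>{s..T}. Y s \<omega> + (IY e \<omega> - IY s \<omega>) =
     Y e \<omega> + integral {s..e} (\<lambda>v. ft \<omega> v (X v \<omega>, Y v \<omega>, Z v \<omega>))"
proof -
  have "AE \<omega> in P. \<omega> \<in> Omega T" by (rule AE_I2) simp
  with Y_eq show ?thesis
  proof eventually_elim
    fix \<omega> assume eq: "\<forall>t\<in>{0..T}. Y t \<omega> = gt \<omega> (X T \<omega>)
        + integral {t..T} (\<lambda>s. ft \<omega> s (X s \<omega>, Y s \<omega>, Z s \<omega>)) - (IY T \<omega> - IY t \<omega>)"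
      and \<omega>: "\<omega> \<in> Omega T"
    show "\<forall>s\<in>{0..T}. \<forall>e\<in>{s..T}. Y s \<omega> + (IY e \<omega> - IY s \<omega>) = Y e \<omega> + integral {s..e} (\<lambda>v. ft \<omega> v (X v \<omega>, Y v \<omega>, Z v \<omega>))"
    proof (intro ballI)
      fix s e assume se: "s \<in> {0..T}" "e \<in> {s..T}"
      have "(\<lambda>v. ft \<omega> v (X v \<omega>, Y v \<omega>, Z v \<omega>)) integrable_on {s..T}"
        using se by (intro bounded_LT_integrable[of _ B] ft_path_LT \<omega> ft_bound) auto
      from Henstock_Kurzweil_Integration.integral_combine[OF _ _ this, of e]
      have "integral {s..T} (\<lambda>v. ft \<omega> v (X v \<omega>, Y v \<omega>, Z v \<omega>)) =
          integral {s..e} (\<lambda>v. ft \<omega> v (X v \<omega>, Y v \<omega>, Z v \<omega>)) + integral {e..T} (\<lambda>v. ft \<omega> v (X v \<omega>, Y v \<omega>, Z v \<omega>))"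
        using se by simp
      moreover have "Y s \<omega> = gt \<omega> (X T \<omega>) + integral {s..T} (\<lambda>s. ft \<omega> s (X s \<omega>, Y s \<omega>, Z s \<omega>)) - (IY T \<omega> - IY s \<omega>)"
        "Y e \<omega> = gt \<omega> (X T \<omega>) + integral {e..T} (\<lambda>s. ft \<omega> s (X s \<omega>, Y s \<omega>, Z s \<omega>)) - (IY T \<omega> - IY e \<omega>)"
        using eq se by auto
      ultimately show "Y s \<omega> + (IY e \<omega> - IY s \<omega>) = Y e \<omega> + integral {s..e} (\<lambda>v. ft \<omega> v (X v \<omega>, Y v \<omega>, Z v \<omega>))"
        by linarith
    qed
  qed
qed

text \<open>The drift contributes \<open>2 B^2 (s - e)^2 \<le> 2 B^2 T (s - e)\<close>, and each of
  the \<open>d\<close> coordinates of the stochastic integral contributes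
  \<open>2 * 4 * B^2 (s - e)\<close>, the 4 being that of \<open>ito_on_bounds\<close>.\<close>

definition C0 :: real where "C0 = 2 * B\<^sup>2 * T + 8 * real CARD('d) * B\<^sup>2"

lemma C0_nonneg: "0 \<le> C0"
  using T_pos by (simp add: C0_def)

lemma X_increment_E2:
  assumes es: "0 \<le> e" "e \<le> s" "s \<le> T" and A: "A \<in> sets (F e)"
  shows "E2 (\<lambda>\<omega>. indicator A \<omega> *\<^sub>R (X s \<omega> - X e \<omega>)) \<le> ennreal (C0 * (s - e)) * pm A"
proof -
  let ?J = "\<lambda>j \<omega>. indicator A \<omega> * (IX j s \<omega> - IX j e \<omega>)"
  have AF: "(indicator A :: _ \<Rightarrow> real) \<in> borel_measurable (F e)" using A by simp
  have AP: "A \<in> sets P" using A sets_Filt_subset[of e] es by auto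
  have Im: "?J j \<in> borel_measurable P" for j
    using AP I_meas(1)[of s j] I_meas(1)[of e j] es by (intro borel_measurable_times borel_measurable_diff) auto
  have Vm: "(\<lambda>\<omega>. \<chi> j. ?J j \<omega>) \<in> borel_measurable P" by (intro borel_measurable_vec_lambda Im)
  have cm: "(\<lambda>\<omega>. indicator A \<omega> *\<^sub>R (B * (s - e))) \<in> borel_measurable P" using AP by simp
  have "E2 (\<lambda>\<omega>. indicator A \<omega> *\<^sub>R (X s \<omega> - X e \<omega>)) \<le> 2 * E2 (\<lambda>\<omega>. indicator A \<omega> *\<^sub>R (B * (s - e))) + 2 * E2 (\<lambda>\<omega>. \<chi> j. ?J j \<omega>)"
  proof (rule E2_triangle_AE[OF cm Vm])
    have "AE \<omega> in P. \<omega> \<in> Omega T" by (rule AE_I2) simp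
    with X_increment show "AE \<omega> in P. norm (indicator A \<omega> *\<^sub>R (X s \<omega> - X e \<omega>)) \<le> norm (indicator A \<omega> *\<^sub>R (B * (s - e))) + norm (\<chi> j. ?J j \<omega>)"
    proof eventually_elim
      fix \<omega> assume eq: "\<forall>e\<in>{0..T}. \<forall>s\<in>{e..T}. X s \<omega> - X e \<omega> =
         integral {e..s} (\<lambda>v. bt \<omega> v (X v \<omega>)) + (\<chi> j. IX j s \<omega> - IX j e \<omega>)" and \<omega>: "\<omega> \<in> Omega T"
      have "continuous_on {e..s} (\<lambda>v. bt \<omega> v (X v \<omega>))"
        by (rule continuous_on_subset[OF bt_path_cont[OF \<omega> \<omega>]]) (use es in auto)
      then have "norm (integral {e..s} (\<lambda>v. bt \<omega> v (X v \<omega>))) \<le> B * (s - e)"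
        using es by (intro integral_bound) (auto intro: bt_bound \<omega>)
      moreover have "(\<chi> j. ?J j \<omega>) = indicator A \<omega> *\<^sub>R (\<chi> j. IX j s \<omega> - IX j e \<omega>)" by (simp add: vec_eq_iff)
      moreover have "X s \<omega> - X e \<omega> = integral {e..s} (\<lambda>v. bt \<omega> v (X v \<omega>)) + (\<chi> j. IX j s \<omega> - IX j e \<omega>)"
        using eq es by auto
      ultimately show "norm (indicator A \<omega> *\<^sub>R (X s \<omega> - X e \<omega>)) \<le> norm (indicator A \<omega> *\<^sub>R (B * (s - e))) + norm (\<chi> j. ?J j \<omega>)"
        using norm_triangle_ineq[of "integral {e..s} (\<lambda>v. bt \<omega> v (X v \<omega>))" "\<chi> j. IX j s \<omega> - IX j e \<omega>"]
          B0 es by (auto split: split_indicator)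
    qed
  qed
  also have "E2 (\<lambda>\<omega>. indicator A \<omega> *\<^sub>R (B * (s - e))) = ennreal (B\<^sup>2 * (s - e)\<^sup>2) * pm A"
    unfolding E2_indicator[OF AP] by (simp add: power_mult_distrib)
  also have "E2 (\<lambda>\<omega>. \<chi> j. ?J j \<omega>) = (\<Sum>j\<in>UNIV. E2 (?J j))" by (rule E2_vec[OF Im])
  also have "\<dots> \<le> (\<Sum>j\<in>(UNIV :: 'd set). ennreal (4 * B\<^sup>2 * (s - e)) * pm A)"
  proof (rule sum_mono)
    fix j :: 'd
    have "ito_on e s (\<lambda>v \<omega>. indicator A \<omega> *\<^sub>R (st \<omega> v (X v \<omega>) $ j)) (?J j)"
      by (rule ito_on_scale[OF es ito_on_of_is_ito[OF es X_ito] AF]) (auto split: split_indicator)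
    from ito_on_bounds(1)[OF es this] have "E2 (?J j) \<le> 4 * N2 e s (\<lambda>v \<omega>. indicator A \<omega> *\<^sub>R (st \<omega> v (X v \<omega>) $ j))" .
    also have "N2 e s (\<lambda>v \<omega>. indicator A \<omega> *\<^sub>R (st \<omega> v (X v \<omega>) $ j)) \<le> N2 e s (\<lambda>v \<omega>. indicator A \<omega> *\<^sub>R B)"
    proof (rule N2_mono)
      fix v and \<omega> :: "'d omega" assume "v \<in> {0..T}" "\<omega> \<in> Omega T"
      then have "norm (st \<omega> v (X v \<omega>) $ j) \<le> B"
        using Finite_Cartesian_Product.norm_nth_le[of "st \<omega> v (X v \<omega>)" j] st_bound[of \<omega> v "X v \<omega>"] by linarith
      then show "norm (indicator A \<omega> *\<^sub>R (st \<omega> v (X v \<omega>) $ j)) \<le> norm (indicator A \<omega> *\<^sub>R B)"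
        by (auto split: split_indicator)
    qed
    also have "\<dots> = ennreal (s - e) * (ennreal (B\<^sup>2) * pm A)"
      using N2_indicator[OF AP es, of "\<lambda>_. B"] E2_indicator[OF AP, of B] by simp
    finally have "E2 (?J j) \<le> 4 * (ennreal (s - e) * (ennreal (B\<^sup>2) * pm A))" by (simp add: mult_left_mono)
    then show "E2 (?J j) \<le> ennreal (4 * B\<^sup>2 * (s - e)) * pm A"
      using es by (simp add: ennreal_mult ac_simps)
  qed
  also have "\<dots> = ennreal (real CARD('d) * (4 * B\<^sup>2 * (s - e))) * pm A"
    using es by (subst ennreal_mult) (auto simp: ennreal_of_nat_eq_real_of_nat mult.assoc)
  finally have "E2 (\<lambda>\<omega>. indicator A \<omega> *\<^sub>R (X s \<omega> - X e \<omega>))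
     \<le> 2 * (ennreal (B\<^sup>2 * (s - e)\<^sup>2) * pm A) + 2 * (ennreal (real CARD('d) * (4 * B\<^sup>2 * (s - e))) * pm A)"
    by (simp add: add_left_mono mult_left_mono)
  also have "\<dots> = (ennreal (2 * (B\<^sup>2 * (s - e)\<^sup>2)) + ennreal (2 * (real CARD('d) * (4 * B\<^sup>2 * (s - e))))) * pm A"
    using es by (subst (1 2) numeral_ennreal_mult) (auto simp: distrib_right)
  also have "\<dots> = ennreal (2 * (B\<^sup>2 * (s - e)\<^sup>2) + 2 * (real CARD('d) * (4 * B\<^sup>2 * (s - e)))) * pm A"
    using es by (subst ennreal_plus) auto
  also have "\<dots> \<le> ennreal (C0 * (s - e)) * pm A"
  proof (intro mult_right_mono ennreal_leI)
    have "(s - e)\<^sup>2 \<le> T * (s - e)" using es by (simp add: power2_eq_square mult_right_mono)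
    then have "B\<^sup>2 * (s - e)\<^sup>2 \<le> B\<^sup>2 * (T * (s - e))" by (intro mult_left_mono) auto
    then show "2 * (B\<^sup>2 * (s - e)\<^sup>2) + 2 * (real CARD('d) * (4 * B\<^sup>2 * (s - e))) \<le> C0 * (s - e)"
      unfolding C0_def by (simp add: algebra_simps)
  qed simp
  finally show ?thesis .
qed

text \<open>\<open>K1\<close> is the coefficient produced by \<open>D_step\<close>. The length
  \<open>dX\<close> makes \<open>K1 * dX\<close> at most one half, so that absorption costs a factor
  4 per short interval; \<open>CX\<close> chains these factors over \<open>T\<close>, starting from
  the value \<open>4 * C0\<close> of \<open>D_E2_crude\<close> at time \<open>r\<close>.\<close>

definition K1 :: real where "K1 = 4 * T * L\<^sup>2 + 16 * real CARD('d) * L\<^sup>2"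
definition dX :: real where "dX = 1 / (2 * (K1 + 1))"
definition CX :: real where "CX = 4 ^ nat \<lceil>T / dX\<rceil> * (4 * C0)"

lemma K1_nonneg: "0 \<le> K1"
  using T_pos by (simp add: K1_def)

lemma dX: "0 < dX" "K1 * dX \<le> 1 / 2"
  using K1_nonneg by (auto simp: dX_def field_simps)

lemma CX_nonneg: "0 \<le> CX"
  using C0_nonneg by (simp add: CX_def)

end

section \<open>Comparison of the solution with its reflection\<close>

context fbsde begin

text \<open>On intervals of length \<open>dYt\<close> half of the unknown in \<open>dY_step\<close>
  can be absorbed, at a factor 72 per interval. In \<open>CY\<close> the term \<open>L^2\<close>
  comes from the terminal condition and the 1 from the forward error. \<open>CZ\<close> is 4 times
  \<open>2 * CY + 8 * T * B^2\<close>, by \<open>ito_on_bounds\<close> in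
  \<open>Z_symmetrized_N2\<close>.\<close>

definition dYt :: real where "dYt = 1 / (72 * L\<^sup>2 + 1)"
definition CY :: real where "CY = 72 ^ nat \<lceil>T / dYt\<rceil> * ((L\<^sup>2 + 1) * CX)"
definition CZ :: real where "CZ = 8 * CY + 32 * T * B\<^sup>2"

lemma dYt: "0 < dYt" "dYt \<le> 1" "36 * dYt * L\<^sup>2 \<le> 1 / 2"
  by (auto simp: dYt_def field_simps add_pos_nonneg add_nonneg_pos)

lemma CY_nonneg: "0 \<le> CY"
  using CX_nonneg by (simp add: CY_def)

lemma CZ_nonneg: "0 \<le> CZ"
  using CY_nonneg T_pos by (simp add: CZ_def)

definition supY :: ennreal where
  "supY = (\<integral>\<^sup>+\<omega>. (SUP t\<in>{0..T}. ennreal ((norm (Y t \<omega>))\<^sup>2)) \<partial>P)"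

lemma supY_finite: "supY < \<infinity>"
  using Y_S2 unfolding S2_def supY_def by blast

lemma E2_Y_le: "s \<in> {0..T} \<Longrightarrow> E2 (Y s) \<le> supY"
  unfolding E2_def supY_def by (intro nn_integral_mono SUP_upper)

lemma N2_Z_finite: "N2 0 T Z < \<infinity>"
proof -
  have "N2 0 T Z \<le> (\<integral>\<^sup>+\<omega>. (\<integral>\<^sup>+s\<in>{0..T}. ennreal ((norm (Z s \<omega>))\<^sup>2) \<partial>lborel) \<partial>P)"
    unfolding N2_def
  proof (rule nn_integral_mono)
    fix \<omega>
    have "(N1 0 T (\<lambda>s. Z s \<omega>)) \<le> (\<integral>\<^sup>+s. ennreal ((norm (Z s \<omega>))\<^sup>2) \<partial>LT)"
      by (intro nn_integral_mono) (auto split: split_indicator)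
    then show "(N1 0 T (\<lambda>s. Z s \<omega>)) \<le> (\<integral>\<^sup>+s\<in>{0..T}. ennreal ((norm (Z s \<omega>))\<^sup>2) \<partial>lborel)"
      by (simp add: nn_integral_restrict_space)
  qed
  also have "\<dots> < \<infinity>" using Z_L2 unfolding L2_def by blast
  finally show ?thesis .
qed

context
  fixes t r :: real and A :: "'d omega set"
  assumes tr: "0 \<le> t" "t < r" "r \<le> T" and A: "A \<in> sets (F t)"
begin

abbreviation \<phi> :: "'d omega \<Rightarrow> 'd omega" where "\<phi> \<equiv> flip T t r"

lemma coeff_flip:
  assumes "\<omega> \<in> Omega T"
  shows "bt (\<phi> \<omega>) = bt \<omega>" "st (\<phi> \<omega>) = st \<omega>" "gt (\<phi> \<omega>) = gt \<omega>" "ft (\<phi> \<omega>) = ft \<omega>"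
  using invariant[OF flip_Omega[OF tr assms] assms] flip_other[of _ T t r \<omega>] by auto

definition D :: "real \<Rightarrow> 'd omega \<Rightarrow> real^'d" where "D s \<omega> = X s (\<phi> \<omega>) - X s \<omega>"
definition dY :: "real \<Rightarrow> 'd omega \<Rightarrow> real" where "dY s \<omega> = Y s (\<phi> \<omega>) - Y s \<omega>"
definition dZ :: "real \<Rightarrow> 'd omega \<Rightarrow> real^'d" where "dZ s \<omega> = Z s (\<phi> \<omega>) - Z s \<omega>"

abbreviation iA :: "'d omega \<Rightarrow> real" where "iA \<equiv> indicator A"

abbreviation iD :: "real \<Rightarrow> 'd omega \<Rightarrow> real^'d" where "iD s \<omega> \<equiv> iA \<omega> *\<^sub>R D s \<omega>"
abbreviation iY :: "real \<Rightarrow> 'd omega \<Rightarrow> real" where "iY s \<omega> \<equiv> iA \<omega> *\<^sub>R dY s \<omega>"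
abbreviation iZ :: "real \<Rightarrow> 'd omega \<Rightarrow> real^'d" where "iZ s \<omega> \<equiv> iA \<omega> *\<^sub>R dZ s \<omega>"

lemma A_P: "A \<in> sets P"
  using A sets_Filt_subset[of t] tr by auto

lemma A_Filt: "t \<le> s \<Longrightarrow> A \<in> sets (F s)"
  using A sets_Filt_mono[of t s] by auto

lemma iA_Filt: "t \<le> s \<Longrightarrow> iA \<in> borel_measurable (F s)"
  using A_Filt[of s] by simp

lemma iA_P: "iA \<in> borel_measurable P"
  using A_P by simp

lemma iA_le_1: "\<bar>iA \<omega>\<bar> \<le> 1"
  by (auto split: split_indicator)

lemma jm_D: "jm iD" and jm_dY: "jm iY"
  and jm_dZ: "jm iZ"
  unfolding D_def dY_def dZ_def by (intro jm_scale iA_P jm_diff jm_flip[OF tr] jm_X jm_Y jm_Z)+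

lemma D_meas: "s \<in> {0..T} \<Longrightarrow> (iD s) \<in> borel_measurable P"
  using jm_section2[OF jm_D] by simp

lemma dY_meas: "s \<in> {0..T} \<Longrightarrow> (iY s) \<in> borel_measurable P"
  using jm_section2[OF jm_dY] by simp

text \<open>\<open>X t\<close> is invariant under the reflection, so the difference is that of two
  increments over \<open>[t, s]\<close> with equal law. At \<open>s = r\<close> it is the initial
  value of the chaining; for later \<open>s\<close> it only supplies the finiteness needed for
  absorption.\<close>

lemma D_E2_crude:
  assumes s: "t \<le> s" "s \<le> T"
  shows "E2 (iD s) \<le> ennreal (4 * C0 * (s - t)) * pm A"
proof -
  let ?V = "\<lambda>\<omega>. X s \<omega> - X t \<omega>"
  have Vm: "?V \<in> borel_measurable P" using X_meas s tr by (intro borel_measurable_diff) auto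
  note fP = flip_P(1)[OF tr]
  have "E2 (iD s) \<le> 2 * E2 (\<lambda>\<omega>. iA \<omega> *\<^sub>R ?V (\<phi> \<omega>)) + 2 * E2 (\<lambda>\<omega>. iA \<omega> *\<^sub>R ?V \<omega>)"
  proof (rule E2_triangle_AE)
    show "(\<lambda>\<omega>. iA \<omega> *\<^sub>R ?V (\<phi> \<omega>)) \<in> borel_measurable P"
      by (intro borel_measurable_scaleR iA_P measurable_compose[OF fP Vm])
    show "(\<lambda>\<omega>. iA \<omega> *\<^sub>R ?V \<omega>) \<in> borel_measurable P" by (intro borel_measurable_scaleR iA_P Vm)
    have "AE \<omega> in P. X t (\<phi> \<omega>) = X t \<omega>" by (rule flip_invariant_fun[OF tr X_Filt]) (use tr in auto)
    then show "AE \<omega> in P. norm (iD s \<omega>) \<le> norm (iA \<omega> *\<^sub>R ?V (\<phi> \<omega>)) + norm (iA \<omega> *\<^sub>R ?V \<omega>)"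
    proof eventually_elim
      fix \<omega> assume e: "X t (\<phi> \<omega>) = X t \<omega>"
      have "D s \<omega> = ?V (\<phi> \<omega>) - ?V \<omega>" unfolding D_def e by simp
      then show "norm (iD s \<omega>) \<le> norm (iA \<omega> *\<^sub>R ?V (\<phi> \<omega>)) + norm (iA \<omega> *\<^sub>R ?V \<omega>)"
        by (metis norm_triangle_ineq4 scaleR_diff_right)
    qed
  qed
  also have "E2 (\<lambda>\<omega>. iA \<omega> *\<^sub>R ?V (\<phi> \<omega>)) = E2 (\<lambda>\<omega>. iA \<omega> *\<^sub>R ?V \<omega>)"
    by (rule E2_indicator_flip[OF tr A Vm])
  also have "2 * E2 (\<lambda>\<omega>. iA \<omega> *\<^sub>R ?V \<omega>) + 2 * E2 (\<lambda>\<omega>. iA \<omega> *\<^sub>R ?V \<omega>) \<le>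
      2 * (ennreal (C0 * (s - t)) * pm A) + 2 * (ennreal (C0 * (s - t)) * pm A)"
    using tr s by (intro add_mono mult_left_mono X_increment_E2 A) auto
  also have "\<dots> = 4 * (ennreal (C0 * (s - t)) * pm A)"
    by (simp add: distrib_right[symmetric])
  also have "\<dots> = ennreal (4 * C0 * (s - t)) * pm A"
    using s C0_nonneg by (simp add: ennreal_mult mult.assoc)
  finally show ?thesis .
qed

lemma flip_after: "r \<le> a \<Longrightarrow> a \<le> b \<Longrightarrow> b \<le> T \<Longrightarrow>
    \<phi> \<omega> [] b - \<phi> \<omega> [] a = 1 *\<^sub>R (\<omega> [] b - \<omega> [] a)"
  using tr by (subst flip_increment_after) auto

text \<open>After \<open>r\<close> the reflection leaves the increments of \<open>W\<^sup>0\<close>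
  and the random coefficients unchanged, so \<open>X\<close> and its reflection solve the same
  equation there and the Lipschitz bounds apply to their difference.\<close>

lemma D_step:
  assumes es: "r \<le> e" "e \<le> s" "s \<le> T"
  shows "E2 (iD s) \<le> 2 * E2 (iD e) + ennreal K1 * N2 e s iD"
proof -
  let ?ND = "N2 e s iD"
  have es': "0 \<le> e" "e \<le> s" "s \<le> T" using es tr by auto
  let ?J = "\<lambda>j \<omega>. iA \<omega> * ((IX j s (\<phi> \<omega>) - IX j e (\<phi> \<omega>)) - (IX j s \<omega> - IX j e \<omega>))"
  let ?S = "\<lambda>j v \<omega>. st \<omega> v (X v \<omega>) $ j"
  have J_ito: "ito_on e s (\<lambda>v \<omega>. iA \<omega> *\<^sub>R (?S j v (\<phi> \<omega>) - ?S j v \<omega>)) (?J j)" for j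
  proof -
    note I = ito_on_of_is_ito[OF es' X_ito[of j]]
    have "ito_on e s (\<lambda>v \<omega>. ?S j v (\<phi> \<omega>)) (\<lambda>\<omega>. 1 * (IX j s (\<phi> \<omega>) - IX j e (\<phi> \<omega>)))"
      by (rule ito_on_flip[OF es' tr I]) (use es flip_after in auto)
    from ito_on_diff[OF es' this I] show ?thesis
      unfolding mult_1 by (rule ito_on_scale[OF es' _ iA_Filt]) (use es tr iA_le_1 in auto)
  qed
  have Jm: "?J j \<in> borel_measurable P" for j using J_ito[of j] unfolding ito_on_def by blast
  have Vm: "(\<lambda>\<omega>. \<chi> j. ?J j \<omega>) \<in> borel_measurable P" by (intro borel_measurable_vec_lambda Jm)
  have EV: "E2 (\<lambda>\<omega>. \<chi> j. ?J j \<omega>) \<le> ennreal (4 * real CARD('d) * L\<^sup>2) * ?ND"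
  proof -
    have "E2 (\<lambda>\<omega>. \<chi> j. ?J j \<omega>) = (\<Sum>j\<in>UNIV. E2 (?J j))" by (rule E2_vec[OF Jm])
    also have "\<dots> \<le> (\<Sum>j\<in>(UNIV::'d set). 4 * (ennreal (L\<^sup>2) * ?ND))"
    proof (rule sum_mono)
      fix j :: 'd
      have "E2 (?J j) \<le> 4 * N2 e s (\<lambda>v \<omega>. iA \<omega> *\<^sub>R (?S j v (\<phi> \<omega>) - ?S j v \<omega>))"
        by (rule ito_on_bounds(1)[OF es' J_ito])
      also have "N2 e s (\<lambda>v \<omega>. iA \<omega> *\<^sub>R (?S j v (\<phi> \<omega>) - ?S j v \<omega>)) \<le> N2 e s (\<lambda>v \<omega>. L *\<^sub>R (iD v \<omega>))"
      proof (rule N2_mono)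
        fix v and \<omega> :: "'d omega" assume v: "v \<in> {0..T}" and \<omega>: "\<omega> \<in> Omega T"
        have "norm (?S j v (\<phi> \<omega>) - ?S j v \<omega>) \<le> norm (st \<omega> v (X v (\<phi> \<omega>)) - st \<omega> v (X v \<omega>))"
          unfolding coeff_flip[OF \<omega>] vector_minus_component[symmetric] by (rule Finite_Cartesian_Product.norm_nth_le)
        also have "\<dots> \<le> L * norm (D v \<omega>)" unfolding D_def by (rule st_lip[OF \<omega> v])
        finally show "norm (iA \<omega> *\<^sub>R (?S j v (\<phi> \<omega>) - ?S j v \<omega>)) \<le> norm (L *\<^sub>R (iD v \<omega>))"
          using L0 by (auto split: split_indicator)
      qed
      also have "\<dots> = ennreal (L\<^sup>2) * ?ND" by (rule N2_cmult[OF jm_D])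
      finally show "E2 (?J j) \<le> 4 * (ennreal (L\<^sup>2) * ?ND)" by (simp add: mult_left_mono)
    qed
    also have "\<dots> = ennreal (4 * real CARD('d) * L\<^sup>2) * ?ND"
      by (simp add: ennreal_mult ennreal_of_nat_eq_real_of_nat ac_simps)
    finally show ?thesis .
  qed
  let ?g = "\<lambda>v \<omega>. iA \<omega> *\<^sub>R (bt \<omega> v (X v (\<phi> \<omega>)) - bt \<omega> v (X v \<omega>))"
  let ?Q = "\<lambda>\<omega>. iD s \<omega> - iD e \<omega>"
  have Qm: "?Q \<in> borel_measurable P" using es' by (intro borel_measurable_diff D_meas) auto
  have AEO: "AE \<omega> in P. \<omega> \<in> Omega T" by (rule AE_I2) simp
  have Eg: "E2 (\<lambda>\<omega>. integral {e..s} (\<lambda>v. ?g v \<omega>)) \<le> ennreal ((s - e) * L\<^sup>2) * ?ND"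
  proof (rule E2_integral_le[OF es' jm_D _ L0, of _ "2 * B"])
    show "AE \<omega> in P. (\<lambda>v. ?g v \<omega>) \<in> borel_measurable LT \<and> (\<forall>v\<in>{0..T}. norm (?g v \<omega>) \<le> 2 * B) \<and>
         (\<forall>v\<in>{e..s}. norm (?g v \<omega>) \<le> L * norm (iD v \<omega>))"
      using AEO
    proof (eventually_elim, intro conjI ballI)
      fix \<omega> :: "'d omega" assume \<omega>: "\<omega> \<in> Omega T"
      note \<omega>' = flip_Omega[OF tr \<omega>]
      show "(\<lambda>v. ?g v \<omega>) \<in> borel_measurable LT"
        by (intro continuous_LT continuous_intros bt_path_cont \<omega> \<omega>')
      fix v
      show "norm (?g v \<omega>) \<le> 2 * B" if v: "v \<in> {0..T}"
      proof -
        have "norm (bt \<omega> v (X v (\<phi> \<omega>)) - bt \<omega> v (X v \<omega>)) \<le> B + B"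
          by (rule order_trans[OF norm_triangle_ineq4]) (intro add_mono bt_bound \<omega> v)
        then show ?thesis using B0 by (auto split: split_indicator)
      qed
      show "norm (?g v \<omega>) \<le> L * norm (iD v \<omega>)" if v: "v \<in> {e..s}"
        using bt_lip[OF \<omega>, of v "X v (\<phi> \<omega>)" "X v \<omega>"] v es' by (auto simp: D_def split: split_indicator)
    qed
  qed
  \<comment> \<open>Subtracting the two equations isolates the drift difference; the stochastic part
    \<open>?J\<close> is estimated separately by the isometry bound.\<close>
  have Qeq: "AE \<omega> in P. ?Q \<omega> - (\<chi> j. ?J j \<omega>) = integral {e..s} (\<lambda>v. ?g v \<omega>)"
    using X_increment AE_flip[OF tr X_increment] AEO
  proof eventually_elim
    fix \<omega> assume \<omega>: "\<omega> \<in> Omega T"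
      and 1: "\<forall>e\<in>{0..T}. \<forall>s\<in>{e..T}. X s \<omega> - X e \<omega> = integral {e..s} (\<lambda>v. bt \<omega> v (X v \<omega>)) + (\<chi> j. IX j s \<omega> - IX j e \<omega>)"
      and 2: "\<forall>e\<in>{0..T}. \<forall>s\<in>{e..T}. X s (\<phi> \<omega>) - X e (\<phi> \<omega>) = integral {e..s} (\<lambda>v. bt (\<phi> \<omega>) v (X v (\<phi> \<omega>))) + (\<chi> j. IX j s (\<phi> \<omega>) - IX j e (\<phi> \<omega>))"
    note \<omega>' = flip_Omega[OF tr \<omega>]
    have eq1: "X s \<omega> - X e \<omega> = integral {e..s} (\<lambda>v. bt \<omega> v (X v \<omega>)) + (\<chi> j. IX j s \<omega> - IX j e \<omega>)"
      using 1 es' by auto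
    have eq2: "X s (\<phi> \<omega>) - X e (\<phi> \<omega>) = integral {e..s} (\<lambda>v. bt \<omega> v (X v (\<phi> \<omega>))) + (\<chi> j. IX j s (\<phi> \<omega>) - IX j e (\<phi> \<omega>))"
      using 2 es' unfolding coeff_flip[OF \<omega>] by auto
    have i1: "(\<lambda>v. bt \<omega> v (X v \<omega>)) integrable_on {e..s}"
      using es' by (intro bounded_LT_integrable[of _ B] continuous_LT bt_path_cont \<omega> bt_bound) auto
    have i2: "(\<lambda>v. bt \<omega> v (X v (\<phi> \<omega>))) integrable_on {e..s}"
      using es' by (intro bounded_LT_integrable[of _ B] continuous_LT bt_path_cont \<omega> \<omega>' bt_bound) auto
    have "integral {e..s} (\<lambda>v. ?g v \<omega>) = iA \<omega> *\<^sub>R (integral {e..s} (\<lambda>v. bt \<omega> v (X v (\<phi> \<omega>))) - integral {e..s} (\<lambda>v. bt \<omega> v (X v \<omega>)))"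
      using Henstock_Kurzweil_Integration.integral_diff[OF i2 i1] by simp
    also have "\<dots> = iA \<omega> *\<^sub>R (((X s (\<phi> \<omega>) - X e (\<phi> \<omega>)) - (\<chi> j. IX j s (\<phi> \<omega>) - IX j e (\<phi> \<omega>))) - ((X s \<omega> - X e \<omega>) - (\<chi> j. IX j s \<omega> - IX j e \<omega>)))"
      unfolding eq1 eq2 by simp
    also have "\<dots> = ?Q \<omega> - (\<chi> j. ?J j \<omega>)"
      by (simp add: vec_eq_iff D_def algebra_simps)
    finally show "?Q \<omega> - (\<chi> j. ?J j \<omega>) = integral {e..s} (\<lambda>v. ?g v \<omega>)" by simp
  qed
  have "E2 ?Q \<le> 2 * E2 (\<lambda>\<omega>. ?Q \<omega> - (\<chi> j. ?J j \<omega>)) + 2 * E2 (\<lambda>\<omega>. \<chi> j. ?J j \<omega>)"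
  proof (rule E2_triangle_AE[OF borel_measurable_diff[OF Qm Vm] Vm])
    have "norm x \<le> norm (x - y) + norm y" for x y :: "real^'d" using norm_triangle_ineq[of "x - y" y] by simp
    then show "AE \<omega> in P. norm (?Q \<omega>) \<le> norm (?Q \<omega> - (\<chi> j. ?J j \<omega>)) + norm (\<chi> j. ?J j \<omega>)" by auto
  qed
  also have "E2 (\<lambda>\<omega>. ?Q \<omega> - (\<chi> j. ?J j \<omega>)) = E2 (\<lambda>\<omega>. integral {e..s} (\<lambda>v. ?g v \<omega>))"
    by (rule E2_cong_AE) (use Qeq in eventually_elim, simp)
  finally have "E2 ?Q \<le> 2 * (ennreal ((s - e) * L\<^sup>2) * ?ND) + 2 * (ennreal (4 * real CARD('d) * L\<^sup>2) * ?ND)"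
    by (rule order_trans) (intro add_mono mult_left_mono Eg EV; simp)
  also have "\<dots> = (ennreal (2 * ((s - e) * L\<^sup>2)) + ennreal (2 * (4 * real CARD('d) * L\<^sup>2))) * ?ND"
    using es by (simp add: ennreal_mult distrib_right mult.assoc)
  also have "\<dots> = ennreal (2 * ((s - e) * L\<^sup>2) + 2 * (4 * real CARD('d) * L\<^sup>2)) * ?ND"
    using es by (subst ennreal_plus) auto
  finally have EQ: "E2 ?Q \<le> ennreal (2 * ((s - e) * L\<^sup>2) + 2 * (4 * real CARD('d) * L\<^sup>2)) * ?ND" .
  have "E2 (iD s) \<le> 2 * E2 (iD e) + 2 * E2 ?Q"
  proof (rule E2_triangle_AE[OF D_meas Qm])
    have "norm x \<le> norm y + norm (x - y)" for x y :: "real^'d" using norm_triangle_ineq[of y "x - y"] by simp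
    then show "AE \<omega> in P. norm (iD s \<omega>) \<le> norm (iD e \<omega>) + norm (?Q \<omega>)"
      by (intro AE_I2)
  qed (use es' in auto)
  also have "2 * E2 ?Q \<le> 2 * (ennreal (2 * ((s - e) * L\<^sup>2) + 2 * (4 * real CARD('d) * L\<^sup>2)) * ?ND)"
    by (intro mult_left_mono EQ) simp
  also have "\<dots> = ennreal (2 * (2 * ((s - e) * L\<^sup>2) + 2 * (4 * real CARD('d) * L\<^sup>2))) * ?ND"
    using es by (intro numeral_ennreal_mult) auto
  also have "\<dots> \<le> ennreal K1 * ?ND"
  proof (intro mult_right_mono ennreal_leI)
    have "(s - e) * L\<^sup>2 \<le> T * L\<^sup>2" using es' by (intro mult_right_mono) auto
    then show "2 * (2 * ((s - e) * L\<^sup>2) + 2 * (4 * real CARD('d) * L\<^sup>2)) \<le> K1" unfolding K1_def by simp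
  qed simp
  finally show ?thesis by (simp add: add_left_mono)
qed

text \<open>A Gronwall argument in discrete form: on a short interval the supremum of the second
  moments is absorbed, then the intervals are chained.\<close>

lemma D_E2:
  assumes s: "r \<le> s" "s \<le> T"
  shows "E2 (iD s) \<le> ennreal (CX * (r - t)) * pm A"
proof -
  let ?f = "\<lambda>s. E2 (iD s)"
  have step: "?f s \<le> 4 * ?f e" if es: "r \<le> e" "e \<le> s" "s \<le> T" "s - e \<le> dX" for e s
  proof -
    define S where "S = (SUP v\<in>{e..s}. ?f v)"
    have up: "?f v \<le> S" if "v \<in> {e..s}" for v unfolding S_def using that by (rule SUP_upper)
    \<comment> \<open>The crude bound makes the supremum finite, as absorption requires.\<close>
    have "S \<le> ennreal (4 * C0 * T) * pm A"
      unfolding S_def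
    proof (rule SUP_least)
      fix v assume v: "v \<in> {e..s}"
      have "?f v \<le> ennreal (4 * C0 * (v - t)) * pm A" using v es tr by (intro D_E2_crude) auto
      also have "\<dots> \<le> ennreal (4 * C0 * T) * pm A"
        using v es tr C0_nonneg by (intro mult_right_mono ennreal_leI mult_left_mono) auto
      finally show "?f v \<le> ennreal (4 * C0 * T) * pm A" .
    qed
    also have "\<dots> < \<infinity>" by (simp add: ennreal_mult_less_top P.emeasure_eq_measure)
    finally have fin: "S < \<infinity>" .
    have "S \<le> 2 * ?f e + ennreal (1/2) * S"
      unfolding S_def
    proof (rule SUP_least, fold S_def)
      fix v assume v: "v \<in> {e..s}"
      have "?f v \<le> 2 * ?f e + ennreal K1 * N2 e v iD"
        using v es by (intro D_step) auto
      also have "ennreal K1 * N2 e v iD \<le> ennreal K1 * (ennreal (v - e) * S)"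
        using v es tr up by (intro mult_left_mono N2_le_sup jm_D) auto
      also have "\<dots> = ennreal (K1 * (v - e)) * S" using K1_nonneg v by (simp add: ennreal_mult mult.assoc)
      also have "\<dots> \<le> ennreal (1/2) * S"
      proof (intro mult_right_mono ennreal_leI)
        have "K1 * (v - e) \<le> K1 * dX" using v es K1_nonneg by (intro mult_left_mono) auto
        then show "K1 * (v - e) \<le> 1/2" using dX(2) by linarith
      qed simp
      finally show "?f v \<le> 2 * ?f e + ennreal (1/2) * S" by (simp add: add_left_mono)
    qed
    from ennreal_absorb_half[OF this fin] have "S \<le> 4 * ?f e" by (simp add: mult.assoc[symmetric])
    then show ?thesis using up[of s] es by auto
  qed
  have "s - r \<le> T" using s tr by auto
  also have "T \<le> real (nat \<lceil>T / dX\<rceil>) * dX"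
    using real_nat_ceiling_ge[of "T / dX"] dX(1) by (simp add: field_simps)
  finally have n: "s - r \<le> real (nat \<lceil>T / dX\<rceil>) * dX" .
  have "?f s \<le> 4 ^ nat \<lceil>T / dX\<rceil> * ?f r"
    by (rule iterate_forward[of r T dX ?f 4 s "nat \<lceil>T / dX\<rceil>", OF step dX(1) s n])
  also have "\<dots> \<le> 4 ^ nat \<lceil>T / dX\<rceil> * (ennreal (4 * C0 * (r - t)) * pm A)"
    using tr by (intro mult_left_mono D_E2_crude) auto
  also have "\<dots> = ennreal (CX * (r - t)) * pm A"
  proof -
    have "(4::ennreal) ^ n = ennreal (4 ^ n)" for n by (simp add: ennreal_power[symmetric])
    then show ?thesis unfolding CX_def using C0_nonneg tr by (simp add: ennreal_mult mult.assoc)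
  qed
  finally show ?thesis .
qed

lemma dY_E2_finite: "s \<in> {0..T} \<Longrightarrow> E2 (iY s) \<le> 4 * supY"
proof -
  assume s: "s \<in> {0..T}"
  have "E2 (iY s) \<le> 2 * E2 (\<lambda>\<omega>. Y s (\<phi> \<omega>)) + 2 * E2 (Y s)"
    by (rule E2_triangle_AE[OF measurable_compose[OF flip_P(1)[OF tr] Y_meas[OF s]] Y_meas[OF s]])
       (auto simp: dY_def split: split_indicator)
  also have "E2 (\<lambda>\<omega>. Y s (\<phi> \<omega>)) = E2 (Y s)" by (rule E2_flip[OF tr Y_meas[OF s]])
  also have "2 * E2 (Y s) + 2 * E2 (Y s) \<le> 2 * supY + 2 * supY"
    by (intro add_mono mult_left_mono E2_Y_le s) auto
  also have "\<dots> = 4 * supY" by (simp add: distrib_right[symmetric])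
  finally show ?thesis .
qed

lemma dZ_N2_finite: "N2 0 T iZ < \<infinity>"
proof -
  have "N2 0 T iZ \<le> 2 * N2 0 T (\<lambda>s \<omega>. Z s (\<phi> \<omega>)) + 2 * N2 0 T Z"
    by (rule N2_triangle[OF jm_flip[OF tr jm_Z] jm_Z]) (auto simp: dZ_def norm_triangle_ineq4 split: split_indicator)
  also have "N2 0 T (\<lambda>s \<omega>. Z s (\<phi> \<omega>)) = N2 0 T Z" by (rule N2_flip[OF tr jm_Z])
  also have "2 * N2 0 T Z + 2 * N2 0 T Z < \<infinity>" using N2_Z_finite by (simp add: ennreal_mult_less_top)
  finally show ?thesis .
qed

text \<open>Over a short interval the orthogonality of \<open>Y\<^sub>v\<close> and the stochastic integral replaces the
  usual application of Ito's formula.\<close>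

lemma Y_basic:
  assumes ve: "r \<le> v" "v \<le> e" "e \<le> T"
  defines "R \<equiv> 2 * E2 (iY e) + 2 * (ennreal ((e - v) * L\<^sup>2) *
     (N2 v e iD + (N2 v e iY + N2 v e iZ)))"
  shows "E2 (iY v) \<le> 2 * R" "N2 v e iZ \<le> 16 * R"
proof -
  have ve': "0 \<le> v" "v \<le> e" "e \<le> T" using ve tr by auto
  let ?H = "\<lambda>w \<omega>. (iD w \<omega>, iY w \<omega>, iZ w \<omega>)"
  have jmH: "jm ?H" by (intro jm_Pair jm_D jm_dY jm_dZ)
  have NH: "N2 v e ?H = N2 v e iD + (N2 v e iY + N2 v e iZ)"
    by (subst N2_Pair[OF jm_D jm_Pair[OF jm_dY jm_dZ]]) (subst N2_Pair[OF jm_dY jm_dZ], rule refl)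
  let ?J = "\<lambda>\<omega>. iA \<omega> * ((IY e (\<phi> \<omega>) - IY v (\<phi> \<omega>)) - (IY e \<omega> - IY v \<omega>))"
  note I = ito_on_of_is_ito[OF ve' Y_ito]
  have "ito_on v e (\<lambda>w \<omega>. Z w (\<phi> \<omega>)) (\<lambda>\<omega>. 1 * (IY e (\<phi> \<omega>) - IY v (\<phi> \<omega>)))"
    by (rule ito_on_flip[OF ve' tr I]) (use ve flip_after in auto)
  from ito_on_diff[OF ve' this I] have J_ito: "ito_on v e iZ ?J"
    unfolding mult_1 dZ_def by (rule ito_on_scale[OF ve' _ iA_Filt]) (use ve tr iA_le_1 in auto)
  then have Jm: "?J \<in> borel_measurable P" unfolding ito_on_def by blast
  let ?\<eta> = "\<lambda>\<omega>. iY v \<omega>"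
  have vT: "v \<in> {0..T}" "e \<in> {0..T}" using ve' by auto
  \<comment> \<open>Adaptedness of the reflected \<open>Y\<close> rests on the reflection being
    non-anticipating.\<close>
  have \<eta>: "?\<eta> \<in> borel_measurable (F v)"
    unfolding dY_def using ve tr vT(1)
    by (intro borel_measurable_scaleR iA_Filt borel_measurable_diff Y_Filt measurable_compose[OF flip_Filt[OF tr] Y_Filt]) auto
  have \<eta>fin: "E2 ?\<eta> < \<infinity>"
    by (rule le_less_trans[OF dY_E2_finite[OF vT(1)]]) (use supY_finite in \<open>simp add: ennreal_mult_less_top\<close>)
  note m = dY_meas[OF vT(1)] dY_meas[OF vT(2)]
  have AEO: "AE \<omega> in P. \<omega> \<in> Omega T" by (rule AE_I2) simp
  let ?\<Lambda> = "\<lambda>w \<omega>. (X w \<omega>, Y w \<omega>, Z w \<omega>)"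
  let ?g = "\<lambda>w \<omega>. iA \<omega> *\<^sub>R (ft \<omega> w (?\<Lambda> w (\<phi> \<omega>)) - ft \<omega> w (?\<Lambda> w \<omega>))"
  have Eg: "E2 (\<lambda>\<omega>. integral {v..e} (\<lambda>w. ?g w \<omega>)) \<le> ennreal ((e - v) * L\<^sup>2) * N2 v e ?H"
  proof (rule E2_integral_le[OF ve' jmH _ L0, of _ "2 * B"])
    show "AE \<omega> in P. (\<lambda>w. ?g w \<omega>) \<in> borel_measurable LT \<and> (\<forall>w\<in>{0..T}. norm (?g w \<omega>) \<le> 2 * B) \<and>
         (\<forall>w\<in>{v..e}. norm (?g w \<omega>) \<le> L * norm (?H w \<omega>))"
      using AEO
    proof (eventually_elim, intro conjI ballI)
      fix \<omega> :: "'d omega" assume \<omega>: "\<omega> \<in> Omega T"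
      note \<omega>' = flip_Omega[OF tr \<omega>]
      show "(\<lambda>w. ?g w \<omega>) \<in> borel_measurable LT"
        by (intro borel_measurable_scaleR borel_measurable_const borel_measurable_diff ft_path_LT \<omega> \<omega>')
      fix w
      show "norm (?g w \<omega>) \<le> 2 * B" if w: "w \<in> {0..T}"
      proof -
        have "norm (ft \<omega> w (?\<Lambda> w (\<phi> \<omega>)) - ft \<omega> w (?\<Lambda> w \<omega>)) \<le> B + B"
          by (rule order_trans[OF norm_triangle_ineq4]) (intro add_mono ft_bound \<omega> w)
        then show ?thesis using B0 by (auto split: split_indicator)
      qed
      show "norm (?g w \<omega>) \<le> L * norm (?H w \<omega>)" if w: "w \<in> {v..e}"
      proof -
        have "?H w \<omega> = iA \<omega> *\<^sub>R (?\<Lambda> w (\<phi> \<omega>) - ?\<Lambda> w \<omega>)" by (simp add: D_def dY_def dZ_def)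
        moreover have "norm (ft \<omega> w (?\<Lambda> w (\<phi> \<omega>)) - ft \<omega> w (?\<Lambda> w \<omega>)) \<le> L * norm (?\<Lambda> w (\<phi> \<omega>) - ?\<Lambda> w \<omega>)"
          using w ve' by (intro ft_lip \<omega>) auto
        ultimately show ?thesis by (cases "\<omega> \<in> A") (simp_all only: indicator_simps scaleR_one scaleR_zero_left norm_zero mult_zero_right order_refl not_False_eq_True simp_thms)
      qed
    qed
  qed
  \<comment> \<open>By \<open>Y_increment\<close> for both paths this is the integral of the
    generator difference, which is Lipschitz in the triple \<open>?H\<close>.\<close>
  let ?Q = "\<lambda>\<omega>. ?\<eta> \<omega> + ?J \<omega> - iY e \<omega>"
  have Qm: "?Q \<in> borel_measurable P" by (intro borel_measurable_diff borel_measurable_add m Jm)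
  have Qeq: "AE \<omega> in P. ?Q \<omega> = integral {v..e} (\<lambda>w. ?g w \<omega>)"
    using Y_increment AE_flip[OF tr Y_increment] AEO
  proof eventually_elim
    fix \<omega> assume \<omega>: "\<omega> \<in> Omega T"
      and 1: "\<forall>s\<in>{0..T}. \<forall>e\<in>{s..T}. Y s \<omega> + (IY e \<omega> - IY s \<omega>) = Y e \<omega> + integral {s..e} (\<lambda>w. ft \<omega> w (?\<Lambda> w \<omega>))"
      and 2: "\<forall>s\<in>{0..T}. \<forall>e\<in>{s..T}. Y s (\<phi> \<omega>) + (IY e (\<phi> \<omega>) - IY s (\<phi> \<omega>)) = Y e (\<phi> \<omega>) + integral {s..e} (\<lambda>w. ft (\<phi> \<omega>) w (?\<Lambda> w (\<phi> \<omega>)))"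
    note \<omega>' = flip_Omega[OF tr \<omega>]
    have eq1: "Y v \<omega> + (IY e \<omega> - IY v \<omega>) = Y e \<omega> + integral {v..e} (\<lambda>w. ft \<omega> w (?\<Lambda> w \<omega>))"
      using 1 ve' by auto
    have eq2: "Y v (\<phi> \<omega>) + (IY e (\<phi> \<omega>) - IY v (\<phi> \<omega>)) = Y e (\<phi> \<omega>) + integral {v..e} (\<lambda>w. ft \<omega> w (?\<Lambda> w (\<phi> \<omega>)))"
      using 2 ve' unfolding coeff_flip[OF \<omega>] by auto
    have i1: "(\<lambda>w. ft \<omega> w (?\<Lambda> w \<omega>)) integrable_on {v..e}"
      using ve' by (intro bounded_LT_integrable[of _ B] ft_path_LT \<omega> ft_bound) auto
    have i2: "(\<lambda>w. ft \<omega> w (?\<Lambda> w (\<phi> \<omega>))) integrable_on {v..e}"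
      using ve' by (intro bounded_LT_integrable[of _ B] ft_path_LT \<omega> \<omega>' ft_bound) auto
    have "integral {v..e} (\<lambda>w. ?g w \<omega>) = iA \<omega> *\<^sub>R (integral {v..e} (\<lambda>w. ft \<omega> w (?\<Lambda> w (\<phi> \<omega>))) - integral {v..e} (\<lambda>w. ft \<omega> w (?\<Lambda> w \<omega>)))"
      using Henstock_Kurzweil_Integration.integral_diff[OF i2 i1] by simp
    also have "integral {v..e} (\<lambda>w. ft \<omega> w (?\<Lambda> w (\<phi> \<omega>))) = Y v (\<phi> \<omega>) + (IY e (\<phi> \<omega>) - IY v (\<phi> \<omega>)) - Y e (\<phi> \<omega>)" using eq2 by simp
    also have "integral {v..e} (\<lambda>w. ft \<omega> w (?\<Lambda> w \<omega>)) = Y v \<omega> + (IY e \<omega> - IY v \<omega>) - Y e \<omega>" using eq1 by simp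
    finally show "?Q \<omega> = integral {v..e} (\<lambda>w. ?g w \<omega>)" by (simp add: dY_def algebra_simps)
  qed
  have EQ: "E2 ?Q = E2 (\<lambda>\<omega>. integral {v..e} (\<lambda>w. ?g w \<omega>))"
    by (rule E2_cong_AE) (use Qeq in eventually_elim, simp)
  have S: "E2 (\<lambda>\<omega>. ?\<eta> \<omega> + ?J \<omega>) \<le> R"
  proof -
    have "E2 (\<lambda>\<omega>. ?\<eta> \<omega> + ?J \<omega>) \<le> 2 * E2 (iY e) + 2 * E2 ?Q"
    proof (rule E2_triangle_AE[OF m(2) Qm], rule AE_I2)
      fix \<omega>
      show "norm (?\<eta> \<omega> + ?J \<omega>) \<le> norm (iY e \<omega>) + norm (?Q \<omega>)"
        using norm_triangle_ineq[of "iY e \<omega>" "?Q \<omega>"] by simp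
    qed
    also have "\<dots> \<le> R"
      unfolding R_def EQ NH[symmetric] by (intro add_left_mono mult_left_mono Eg) simp
    finally show ?thesis .
  qed
  have "E2 ?\<eta> \<le> 2 * E2 (\<lambda>\<omega>. ?\<eta> \<omega> + ?J \<omega>)" by (rule ito_on_ortho_bounds(1)[OF ve' J_ito \<eta> \<eta>fin])
  also have "\<dots> \<le> 2 * R" by (intro mult_left_mono S) simp
  finally show "E2 ?\<eta> \<le> 2 * R" .
  have "N2 v e iZ \<le> 16 * E2 (\<lambda>\<omega>. ?\<eta> \<omega> + ?J \<omega>)" by (rule ito_on_ortho_bounds(2)[OF ve' J_ito \<eta> \<eta>fin])
  also have "\<dots> \<le> 16 * R" by (intro mult_left_mono S) simp
  finally show "N2 v e iZ \<le> 16 * R" .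
qed

text \<open>The generator involves \<open>Z\<close>, so the supremum of the second moments of
  \<open>iY\<close> and the energy of \<open>iZ\<close> have to be absorbed together.\<close>

lemma dY_step:
  assumes se: "r \<le> s" "s \<le> e" "e \<le> T" "e - s \<le> dYt"
  shows "E2 (iY s) \<le> 72 * E2 (iY e) + ennreal (CX * (r - t)) * pm A"
proof -
  let ?f = "\<lambda>s. E2 (iY s)"
  define c where "c = ennreal (CX * (r - t)) * pm A"
  define S where "S = (SUP v\<in>{s..e}. ?f v)"
  define q where "q = N2 s e iZ"
  \<comment> \<open>A bound for the right-hand side of \<open>Y_basic\<close> that is uniform in the
    left end \<open>v\<close>; it uses that \<open>e - v\<close> is at most \<open>dYt\<close>,
    hence at most 1.\<close>
  define R where "R = 2 * ?f e + 2 * (ennreal (dYt * L\<^sup>2) * (c + (S + q)))"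
  have up: "?f v \<le> S" if "v \<in> {s..e}" for v unfolding S_def using that by (rule SUP_upper)
  have "S \<le> 4 * supY" unfolding S_def by (rule SUP_least, rule dY_E2_finite) (use se tr in auto)
  also have "\<dots> < \<infinity>" using supY_finite by (simp add: ennreal_mult_less_top)
  finally have Sfin: "S < \<infinity>" .
  have qfin: "q < \<infinity>"
    unfolding q_def by (rule le_less_trans[OF N2_subinterval dZ_N2_finite]) (use se tr in auto)
  have R: "2 * ?f e + 2 * (ennreal ((e - v) * L\<^sup>2) *
     (N2 v e iD + (N2 v e iY + N2 v e iZ))) \<le> R"
    if v: "v \<in> {s..e}" for v
  proof -
    have le1: "ennreal (e - v) * x \<le> x" for x
    proof -
      have "ennreal (e - v) * x \<le> ennreal 1 * x" using v se dYt by (intro mult_right_mono ennreal_leI) auto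
      then show ?thesis by simp
    qed
    have "N2 v e iD \<le> ennreal (e - v) * c"
      unfolding c_def using v se tr by (intro N2_le_sup jm_D D_E2) auto
    also have "\<dots> \<le> c" by (rule le1)
    finally have 1: "N2 v e iD \<le> c" .
    have "N2 v e iY \<le> ennreal (e - v) * S"
      using v se tr up by (intro N2_le_sup jm_dY) auto
    also have "\<dots> \<le> S" by (rule le1)
    finally have 2: "N2 v e iY \<le> S" .
    have 3: "N2 v e iZ \<le> q"
      unfolding q_def using v by (intro N2_subinterval) auto
    show ?thesis
      unfolding R_def using v se by (intro add_left_mono mult_left_mono mult_mono add_mono 1 2 3 ennreal_leI mult_right_mono) auto
  qed
  have S2: "S \<le> 2 * R"
    unfolding S_def
  proof (rule SUP_least)
    fix v assume v: "v \<in> {s..e}"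
    have "?f v \<le> 2 * (2 * ?f e + 2 * (ennreal ((e - v) * L\<^sup>2) *
     (N2 v e iD + (N2 v e iY + N2 v e iZ))))"
      by (rule Y_basic(1)) (use v se in auto)
    also have "\<dots> \<le> 2 * R" by (intro mult_left_mono R[OF v]) simp
    finally show "?f v \<le> 2 * R" .
  qed
  have q2: "q \<le> 16 * R"
  proof -
    have "q \<le> 16 * (2 * ?f e + 2 * (ennreal ((e - s) * L\<^sup>2) *
     (N2 s e iD + (N2 s e iY + N2 s e iZ))))"
      unfolding q_def by (rule Y_basic(2)) (use se in auto)
    also have "\<dots> \<le> 16 * R" by (intro mult_left_mono R) (use se in auto)
    finally show ?thesis .
  qed
  \<comment> \<open>The factors 2 and 16 of \<open>Y_basic\<close> add up to 18, the 2 in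
    \<open>R\<close> makes 36, and absorbing one half makes 72.\<close>
  have "S + q \<le> 2 * R + 16 * R" by (intro add_mono S2 q2)
  also have "\<dots> = 18 * R" by (simp add: distrib_right[symmetric])
  also have "\<dots> = 36 * ?f e + ennreal (36 * dYt * L\<^sup>2) * (c + (S + q))"
    unfolding R_def distrib_left using dYt by (simp add: mult.assoc[symmetric] ennreal_mult distrib_left)
  also have "\<dots> \<le> 36 * ?f e + ennreal (1/2) * (c + (S + q))"
    by (intro add_left_mono mult_right_mono ennreal_leI dYt(3)) simp
  also have "\<dots> = (36 * ?f e + ennreal (1/2) * c) + ennreal (1/2) * (S + q)"
    by (simp only: distrib_left add.assoc)
  finally have "S + q \<le> 2 * (36 * ?f e + ennreal (1/2) * c)"
    by (rule ennreal_absorb_half) (use Sfin qfin in simp)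
  also have "\<dots> = 72 * ?f e + c"
  proof -
    have "2 * (ennreal (1/2) * c) = ennreal (2 * (1/2)) * c" by (rule numeral_ennreal_mult) simp
    then show ?thesis by (simp add: distrib_left mult.assoc[symmetric])
  qed
  finally have "S + q \<le> 72 * ?f e + c" .
  moreover have "?f s \<le> S + q" using up[of s] se by (intro add_increasing2) auto
  ultimately show ?thesis unfolding c_def by (rule order_trans[rotated])
qed

lemma dY_terminal: "E2 (iY T) \<le> ennreal (L\<^sup>2 * (CX * (r - t))) * pm A"
proof -
  have AEO: "AE \<omega> in P. \<omega> \<in> Omega T" by (rule AE_I2) simp
  have "E2 (iY T) \<le> E2 (\<lambda>\<omega>. L *\<^sub>R (iD T \<omega>))"
  proof (rule E2_mono_AE)
    show "AE \<omega> in P. norm (iY T \<omega>) \<le> norm (L *\<^sub>R (iD T \<omega>))"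
      using Y_eq AE_flip[OF tr Y_eq] AEO
    proof eventually_elim
      fix \<omega> assume \<omega>: "\<omega> \<in> Omega T"
       and 1: "\<forall>t\<in>{0..T}. Y t \<omega> = gt \<omega> (X T \<omega>) + integral {t..T} (\<lambda>s. ft \<omega> s (X s \<omega>, Y s \<omega>, Z s \<omega>)) - (IY T \<omega> - IY t \<omega>)"
       and 2: "\<forall>t\<in>{0..T}. Y t (\<phi> \<omega>) = gt (\<phi> \<omega>) (X T (\<phi> \<omega>)) + integral {t..T} (\<lambda>s. ft (\<phi> \<omega>) s (X s (\<phi> \<omega>), Y s (\<phi> \<omega>), Z s (\<phi> \<omega>))) - (IY T (\<phi> \<omega>) - IY t (\<phi> \<omega>))"
      have "Y T \<omega> = gt \<omega> (X T \<omega>)" "Y T (\<phi> \<omega>) = gt \<omega> (X T (\<phi> \<omega>))"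
        using bspec[OF 1, of T] bspec[OF 2, of T] T_pos coeff_flip(3)[OF \<omega>] by auto
      then have "norm (dY T \<omega>) \<le> L * norm (D T \<omega>)"
        unfolding dY_def D_def using gt_lip[OF \<omega>] by simp
      then show "norm (iY T \<omega>) \<le> norm (L *\<^sub>R (iD T \<omega>))"
        using L0 by (auto split: split_indicator)
    qed
  qed
  also have "\<dots> = ennreal (L\<^sup>2) * E2 (iD T)"
  proof -
    have "(\<lambda>\<omega>. ennreal ((norm (iD T \<omega>))\<^sup>2)) \<in> borel_measurable P"
    proof -
      have [measurable]: "(iD T) \<in> borel_measurable P" using D_meas[of T] T_pos by simp
      show ?thesis by measurable
    qed
    from nn_integral_cmult[OF this, of "ennreal (L\<^sup>2)"] show ?thesis
      unfolding E2_def norm_scaleR[of L] power_mult_distrib by (simp add: ennreal_mult)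
  qed
  also have "\<dots> \<le> ennreal (L\<^sup>2) * (ennreal (CX * (r - t)) * pm A)"
    using tr by (intro mult_left_mono D_E2) auto
  finally show ?thesis using CX_nonneg tr by (simp add: ennreal_mult mult.assoc)
qed

lemma dY_E2: "E2 (iY r) \<le> ennreal (CY * (r - t)) * pm A"
proof -
  define c where "c = ennreal (CX * (r - t)) * pm A"
  \<comment> \<open>Adding \<open>c\<close> turns the inhomogeneous recursion into a homogeneous
    one, to which \<open>iterate_backward\<close> applies.\<close>
  let ?f = "\<lambda>s. E2 (iY s) + c"
  let ?n = "nat \<lceil>T / dYt\<rceil>"
  have step: "?f s \<le> 72 * ?f e" if "r \<le> s" "s \<le> e" "e \<le> T" "e - s \<le> dYt" for s e
  proof -
    have "?f s \<le> (72 * E2 (iY e) + c) + c"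
      unfolding c_def by (intro add_right_mono dY_step that)
    also have "\<dots> = 72 * E2 (iY e) + 2 * c"
      by (simp only: mult_2 add.assoc)
    also have "\<dots> \<le> 72 * E2 (iY e) + 72 * c"
      by (intro add_left_mono mult_right_mono) auto
    finally show ?thesis by (simp only: distrib_left)
  qed
  have "T - r \<le> T" using tr by auto
  also have "T \<le> real ?n * dYt"
    using real_nat_ceiling_ge[of "T / dYt"] dYt(1) by (simp add: field_simps)
  finally have n: "T - r \<le> real ?n * dYt" .
  have "?f r \<le> 72 ^ ?n * ?f T"
    by (rule iterate_backward[of r T dYt ?f 72 r ?n, OF step dYt(1) _ _ n]) (use tr in auto)
  also have "\<dots> \<le> 72 ^ ?n * (ennreal (L\<^sup>2 * (CX * (r - t))) * pm A + c)"
    by (intro mult_left_mono add_right_mono dY_terminal) simp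
  also have "\<dots> = ennreal (CY * (r - t)) * pm A"
  proof -
    have "(72::ennreal) ^ n = ennreal (72 ^ n)" for n by (simp add: ennreal_power[symmetric])
    moreover have "ennreal (L\<^sup>2 * (CX * (r - t))) * pm A + c = ennreal ((L\<^sup>2 + 1) * (CX * (r - t))) * pm A"
      unfolding c_def distrib_right[symmetric] using CX_nonneg tr
      by (subst ennreal_plus[symmetric]) (auto simp: distrib_right)
    ultimately show ?thesis unfolding CY_def using CX_nonneg tr by (simp add: ennreal_mult mult.assoc)
  qed
  finally have "?f r \<le> ennreal (CY * (r - t)) * pm A" .
  then show ?thesis by (rule order_trans[rotated]) (simp add: add_increasing2)
qed

text \<open>In the difference of the backward equation over \<open>[t, r]\<close> and its
  reflection, the invariant value \<open>Y t\<close> cancels. What remains is the difference at time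
  \<open>r\<close> and a generator term of size \<open>2 * B * (r - t)\<close>, whose square is
  again at most of order \<open>r - t\<close>.\<close>

lemma Z_symmetrized_N2:
  "N2 t r (\<lambda>s \<omega>. iA \<omega> *\<^sub>R (Z s \<omega> + Z s (\<phi> \<omega>))) \<le> ennreal (CZ * (r - t)) * pm A"
proof -
  have tr': "0 \<le> t" "t \<le> r" "r \<le> T" using tr by auto
  let ?I = "\<lambda>\<omega>. IY r \<omega> - IY t \<omega>"
  let ?J = "\<lambda>\<omega>. iA \<omega> * (?I \<omega> - ?I (\<phi> \<omega>))"
  note I = ito_on_of_is_ito[OF tr' Y_ito]
  have "ito_on t r (\<lambda>s \<omega>. Z s (\<phi> \<omega>)) (\<lambda>\<omega>. -1 * ?I (\<phi> \<omega>))"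
    \<comment> \<open>Here the reflected interval is the interval of integration itself, so the sign
      is -1 and subtracting the integrals adds the integrands.\<close>
    by (rule ito_on_flip[OF tr' tr I]) (use tr in \<open>auto simp: flip_increment_inside\<close>)
  from ito_on_add[OF tr' I this]
  have "ito_on t r (\<lambda>s \<omega>. Z s \<omega> + Z s (\<phi> \<omega>)) (\<lambda>\<omega>. ?I \<omega> - ?I (\<phi> \<omega>))"
    by (simp only: mult_minus1 diff_conv_add_uminus[symmetric])
  then have J: "ito_on t r (\<lambda>s \<omega>. iA \<omega> *\<^sub>R (Z s \<omega> + Z s (\<phi> \<omega>))) ?J"
    by (rule ito_on_scale[OF tr' _ iA_Filt]) (use iA_le_1 in auto)
  have AEO: "AE \<omega> in P. \<omega> \<in> Omega T" by (rule AE_I2) simp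
  have inv: "AE \<omega> in P. Y t (\<phi> \<omega>) = Y t \<omega>" by (rule flip_invariant_fun[OF tr Y_Filt]) (use tr in auto)
  have rT: "r \<in> {0..T}" using tr by auto
  have "E2 ?J \<le> 2 * E2 (iY r) + 2 * E2 (\<lambda>\<omega>. iA \<omega> *\<^sub>R (2 * B * (r - t)))"
  proof (rule E2_triangle_AE[OF dY_meas[OF rT]])
    show "AE \<omega> in P. norm (?J \<omega>) \<le> norm (iY r \<omega>) + norm (iA \<omega> *\<^sub>R (2 * B * (r - t)))"
      using Y_increment AE_flip[OF tr Y_increment] AEO inv
    proof eventually_elim
      fix \<omega> assume \<omega>: "\<omega> \<in> Omega T"
        and 1: "\<forall>s\<in>{0..T}. \<forall>e\<in>{s..T}. Y s \<omega> + (IY e \<omega> - IY s \<omega>) = Y e \<omega> + integral {s..e} (\<lambda>w. ft \<omega> w (X w \<omega>, Y w \<omega>, Z w \<omega>))"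
        and 2: "\<forall>s\<in>{0..T}. \<forall>e\<in>{s..T}. Y s (\<phi> \<omega>) + (IY e (\<phi> \<omega>) - IY s (\<phi> \<omega>)) = Y e (\<phi> \<omega>) + integral {s..e} (\<lambda>w. ft (\<phi> \<omega>) w (X w (\<phi> \<omega>), Y w (\<phi> \<omega>), Z w (\<phi> \<omega>)))"
        and 3: "Y t (\<phi> \<omega>) = Y t \<omega>"
      note \<omega>' = flip_Omega[OF tr \<omega>]
      have bd: "norm (integral {t..r} (\<lambda>w. ft \<omega>1 w (X w \<omega>1, Y w \<omega>1, Z w \<omega>1))) \<le> B * (r - t)" if \<omega>1: "\<omega>1 \<in> Omega T" for \<omega>1
      proof -
        have "(\<lambda>w. ft \<omega>1 w (X w \<omega>1, Y w \<omega>1, Z w \<omega>1)) integrable_on {t..r}"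
          using tr by (intro bounded_LT_integrable[of _ B] ft_path_LT \<omega>1 ft_bound) auto
        from integrable_bound[OF B0 this[unfolded box_real[symmetric]]]
        show ?thesis using tr ft_bound[OF \<omega>1] by (auto simp: content_real)
      qed
      have "?I \<omega> = Y r \<omega> - Y t \<omega> + integral {t..r} (\<lambda>w. ft \<omega> w (X w \<omega>, Y w \<omega>, Z w \<omega>))"
        using bspec[OF bspec[OF 1, of t], of r] tr by auto
      moreover have "?I (\<phi> \<omega>) = Y r (\<phi> \<omega>) - Y t \<omega> + integral {t..r} (\<lambda>w. ft (\<phi> \<omega>) w (X w (\<phi> \<omega>), Y w (\<phi> \<omega>), Z w (\<phi> \<omega>)))"
        using bspec[OF bspec[OF 2, of t], of r] tr 3 by auto
      ultimately have "\<bar>?I \<omega> - ?I (\<phi> \<omega>)\<bar> \<le> \<bar>dY r \<omega>\<bar> + 2 * B * (r - t)"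
        unfolding dY_def using bd[OF \<omega>] bd[OF \<omega>'] by simp
      then show "norm (?J \<omega>) \<le> norm (iY r \<omega>) + norm (iA \<omega> *\<^sub>R (2 * B * (r - t)))"
        using B0 tr by (auto split: split_indicator)
    qed
  qed (use A_P in auto)
  also have "E2 (\<lambda>\<omega>. iA \<omega> *\<^sub>R (2 * B * (r - t))) = ennreal (4 * B\<^sup>2 * (r - t)\<^sup>2) * pm A"
    unfolding E2_indicator[OF A_P] by (simp add: power_mult_distrib)
  also have "2 * E2 (iY r) + 2 * (ennreal (4 * B\<^sup>2 * (r - t)\<^sup>2) * pm A)
     \<le> 2 * (ennreal (CY * (r - t)) * pm A) + 2 * (ennreal (4 * B\<^sup>2 * T * (r - t)) * pm A)"
  proof (intro add_mono mult_left_mono dY_E2 mult_right_mono ennreal_leI)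
    have "(r - t)\<^sup>2 \<le> T * (r - t)" using tr by (simp add: power2_eq_square mult_right_mono)
    then have "4 * B\<^sup>2 * (r - t)\<^sup>2 \<le> 4 * B\<^sup>2 * (T * (r - t))" by (intro mult_left_mono) auto
    then show "4 * B\<^sup>2 * (r - t)\<^sup>2 \<le> 4 * B\<^sup>2 * T * (r - t)" by (simp add: mult.assoc)
  qed auto
  finally have "E2 ?J \<le> 2 * (ennreal (CY * (r - t)) * pm A) + 2 * (ennreal (4 * B\<^sup>2 * T * (r - t)) * pm A)" .
  then have "4 * E2 ?J \<le> 4 * (2 * (ennreal (CY * (r - t)) * pm A) + 2 * (ennreal (4 * B\<^sup>2 * T * (r - t)) * pm A))"
    by (intro mult_left_mono) auto
  also have "\<dots> = 8 * (ennreal (CY * (r - t)) * pm A) + 8 * (ennreal (4 * B\<^sup>2 * T * (r - t)) * pm A)"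
    by (simp add: distrib_left mult.assoc[symmetric])
  also have "\<dots> = ennreal (8 * (CY * (r - t))) * pm A + ennreal (8 * (4 * B\<^sup>2 * T * (r - t))) * pm A"
    using CY_nonneg tr T_pos by (subst (1 2) numeral_ennreal_mult) auto
  also have "\<dots> = ennreal (8 * (CY * (r - t)) + 8 * (4 * B\<^sup>2 * T * (r - t))) * pm A"
    using CY_nonneg tr T_pos by (subst ennreal_plus) (auto simp: distrib_right)
  also have "8 * (CY * (r - t)) + 8 * (4 * B\<^sup>2 * T * (r - t)) = CZ * (r - t)"
    unfolding CZ_def by (simp add: algebra_simps)
  finally show ?thesis using ito_on_bounds(2)[OF tr' J] by (rule order_trans[rotated])
qed

end

end

section \<open>The bound on Z\<close>

context bm_space begin

lemma N2_split:
  fixes H :: "real \<Rightarrow> 'd omega \<Rightarrow> 'b::{real_normed_vector,second_countable_topology}"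
  assumes "jm H" "a \<le> b" "b \<le> c"
  shows "N2 a c H = N2 a b H + N2 b c H"
proof -
  have [measurable]: "indicator {r<..u} \<in> borel_measurable LT" for r u by (rule measurable_LT) simp
  have "N2 a c H = (\<integral>\<^sup>+\<omega>. (N1 a b (\<lambda>s. H s \<omega>))
     + (N1 b c (\<lambda>s. H s \<omega>)) \<partial>P)"
    unfolding N2_def
  proof (rule nn_integral_cong)
    fix \<omega> assume "\<omega> \<in> space P"
    then have [measurable]: "(\<lambda>s. H s \<omega>) \<in> borel_measurable LT" using jm_section[OF assms(1)] by simp
    have "indicator {a<..c} s * ennreal ((norm (H s \<omega>))\<^sup>2) = indicator {a<..b} s * ennreal ((norm (H s \<omega>))\<^sup>2)
       + indicator {b<..c} s * ennreal ((norm (H s \<omega>))\<^sup>2)" for s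
      using assms(2,3) by (auto split: split_indicator)
    then show "(N1 a c (\<lambda>s. H s \<omega>)) =
      (N1 a b (\<lambda>s. H s \<omega>))
     + (N1 b c (\<lambda>s. H s \<omega>))"
      by (simp add: nn_integral_add)
  qed
  also have "\<dots> = N2 a b H + N2 b c H"
    unfolding N2_def by (intro nn_integral_add N2_inner_measurable assms(1))
  finally show ?thesis .
qed

lemma N2_partition:
  fixes H :: "real \<Rightarrow> 'd omega \<Rightarrow> 'b::{real_normed_vector,second_countable_topology}"
  assumes "jm H" "partition_of T n p" "m \<le> n"
  shows "N2 0 (p m) H = (\<Sum>k<m. N2 (p k) (p (Suc k)) H)"
  using assms(3)
proof (induction m)
  case 0
  have "p 0 = 0" using assms(2) by (simp add: partition_of_def)
  then show ?case by (simp add: N2_def)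
next
  case (Suc m)
  have "N2 0 (p (Suc m)) H = N2 0 (p m) H + N2 (p m) (p (Suc m)) H"
    using partition_of_range[OF assms(2), of m] partition_of_mono[OF assms(2), of m "Suc m"] Suc(2)
    by (intro N2_split assms) auto
  then show ?case using Suc by simp
qed

text \<open>\<open>N2 0 T\<close> leaves out time 0, so the slice
  \<open>{0} \<times> Omega T\<close> is discarded as a null set.\<close>

lemma AE_of_N2_eq_0:
  fixes H :: "real \<Rightarrow> 'd omega \<Rightarrow> 'b::{real_normed_vector,second_countable_topology}"
  assumes "jm H" "N2 0 T H = 0"
  shows "AE (s, \<omega>) in LT \<Otimes>\<^sub>M P. H s \<omega> = 0"
proof -
  have sfP: "sigma_finite_measure P" by (rule P.sigma_finite_measure_axioms)
  have 1: "AE x in LT \<Otimes>\<^sub>M P. indicator {0<..T} (fst x) * ennreal ((norm (H (fst x) (snd x)))\<^sup>2) = 0"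
    using assms(2) unfolding N2_swap(2)[OF assms(1)]
    by (subst (asm) nn_integral_0_iff_AE[OF N2_swap(3)[OF assms(1)]]) simp
  have z: "{0} \<in> sets LT" using T_pos by (subst sets_restrict_space_iff) auto
  have "emeasure LT {0} = 0" using T_pos by (subst emeasure_restrict_space) auto
  then have "emeasure (LT \<Otimes>\<^sub>M P) ({0} \<times> Omega T) = 0"
    using sigma_finite_measure.emeasure_pair_measure_Times[OF sfP z sets.top[of P]] by simp
  moreover have "{0} \<times> Omega T \<in> sets (LT \<Otimes>\<^sub>M P)" using z sets.top[of P] by auto
  ultimately have "AE x in LT \<Otimes>\<^sub>M P. x \<notin> {0} \<times> Omega T" by (intro AE_not_in null_setsI)
  moreover have "AE x in LT \<Otimes>\<^sub>M P. x \<in> space (LT \<Otimes>\<^sub>M P)" by (rule AE_space)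
  ultimately show ?thesis
    using 1 by eventually_elim (auto simp: space_pair_measure split: split_indicator_asm)
qed

end

context fbsde begin

text \<open>On a piece of the partition the simple approximation is frozen at time \<open>t\<close>, hence invariant under
  the flip, so that \<open>2 \<zeta> = (Z + Z \<circ> \<phi>) + (\<zeta> - Z) + (\<zeta> - Z) \<circ> \<phi>\<close>.\<close>

lemma large_Z_N2:
  assumes tr: "0 \<le> t" "t < r" "r \<le> T"
    and \<xi>: "\<xi> \<in> borel_measurable (F t)"
  defines "H \<equiv> \<lambda>s \<omega>. if norm (Z s \<omega>) > sqrt (CZ + 1) + 1 then 1 else (0::real)"
  shows "N2 t r H \<le> 6 * N2 t r (\<lambda>s \<omega>. \<xi> \<omega> - Z s \<omega>)"
proof -
  \<comment> \<open>The square of \<open>\<rho>\<close> has to dominate \<open>CZ\<close> so that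
    the term with \<open>CZ\<close> on the right can be subtracted below; the added 1 also covers
    \<open>CZ = 0\<close>.\<close>
  define \<rho> where "\<rho> = sqrt (CZ + 1)"
  have \<rho>: "\<rho>\<^sup>2 = CZ + 1" "0 \<le> \<rho>" using CZ_nonneg by (auto simp: \<rho>_def)
  define A where "A = {\<omega> \<in> Omega T. norm (\<xi> \<omega>) > \<rho>}"
  have A: "A \<in> sets (F t)"
  proof -
    have "{\<omega> \<in> space (F t). norm (\<xi> \<omega>) > \<rho>} \<in> sets (F t)" using \<xi> by measurable
    then show ?thesis by (simp add: A_def)
  qed
  have AP: "A \<in> sets P" using A sets_Filt_subset[of t] tr by auto
  then have iAP: "(indicator A :: _ \<Rightarrow> real) \<in> borel_measurable P" by simp
  have \<xi>P: "\<xi> \<in> borel_measurable P" using measurable_Filt_P[OF \<xi>] tr by simp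
  let ?\<phi> = "flip T t r"
  let ?iA = "indicator A :: 'd omega \<Rightarrow> real"
  let ?V = "\<lambda>s \<omega>. \<xi> \<omega> - Z s \<omega>"
  have tr': "0 \<le> t" "t \<le> r" "r \<le> T" using tr by auto
  have j\<xi>: "jm (\<lambda>s. \<xi>)" unfolding jm_def case_prod_beta' by (rule measurable_compose[OF measurable_snd \<xi>P])
  have jV: "jm ?V" by (intro jm_diff j\<xi> jm_Z)
  let ?h = "ennreal (r - t)" and ?nV = "N2 t r ?V"
  have "N2 t r (\<lambda>s \<omega>. ?iA \<omega> *\<^sub>R (2 * \<rho>)) \<le> N2 t r (\<lambda>s \<omega>. ?iA \<omega> *\<^sub>R (2 *\<^sub>R \<xi> \<omega>))"
    by (rule N2_mono) (auto simp: A_def \<rho>(2) split: split_indicator)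
  also have "\<dots> = N2 t r (\<lambda>s \<omega>. ?iA \<omega> *\<^sub>R (\<xi> \<omega> + \<xi> (?\<phi> \<omega>)))"
    by (rule N2_cong_AE) (use flip_invariant_fun[OF tr \<xi>] in eventually_elim, simp add: scaleR_2)
  also have "\<dots> \<le> 2 * N2 t r (\<lambda>s \<omega>. ?iA \<omega> *\<^sub>R (Z s \<omega> + Z s (?\<phi> \<omega>))) + 2 * N2 t r (\<lambda>s \<omega>. ?iA \<omega> *\<^sub>R (?V s \<omega> + ?V s (?\<phi> \<omega>)))"
  proof (rule N2_triangle)
    show "jm (\<lambda>s \<omega>. ?iA \<omega> *\<^sub>R (Z s \<omega> + Z s (?\<phi> \<omega>)))" "jm (\<lambda>s \<omega>. ?iA \<omega> *\<^sub>R (?V s \<omega> + ?V s (?\<phi> \<omega>)))"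
      by (intro jm_scale iAP jm_add jm_flip[OF tr] jm_Z jV)+
    fix s \<omega>
    have "?iA \<omega> *\<^sub>R (\<xi> \<omega> + \<xi> (?\<phi> \<omega>)) = ?iA \<omega> *\<^sub>R (Z s \<omega> + Z s (?\<phi> \<omega>)) + ?iA \<omega> *\<^sub>R (?V s \<omega> + ?V s (?\<phi> \<omega>))"
      by (simp add: algebra_simps)
    then show "norm (?iA \<omega> *\<^sub>R (\<xi> \<omega> + \<xi> (?\<phi> \<omega>))) \<le> norm (?iA \<omega> *\<^sub>R (Z s \<omega> + Z s (?\<phi> \<omega>))) + norm (?iA \<omega> *\<^sub>R (?V s \<omega> + ?V s (?\<phi> \<omega>)))"
      by (simp only: norm_triangle_ineq)
  qed
  also have "\<dots> \<le> 2 * (ennreal (CZ * (r - t)) * pm A) + 2 * (4 * ?nV)"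
  proof (intro add_mono mult_left_mono Z_symmetrized_N2[OF tr A])
    have "N2 t r (\<lambda>s \<omega>. ?iA \<omega> *\<^sub>R (?V s \<omega> + ?V s (?\<phi> \<omega>))) \<le> 2 * N2 t r (\<lambda>s \<omega>. ?iA \<omega> *\<^sub>R ?V s \<omega>) + 2 * N2 t r (\<lambda>s \<omega>. ?iA \<omega> *\<^sub>R ?V s (?\<phi> \<omega>))"
      by (rule N2_triangle) (intro jm_scale iAP jV jm_flip[OF tr], intro jm_scale iAP jV jm_flip[OF tr jV], simp only: scaleR_add_right norm_triangle_ineq)
    also have "N2 t r (\<lambda>s \<omega>. ?iA \<omega> *\<^sub>R ?V s (?\<phi> \<omega>)) = N2 t r (\<lambda>s \<omega>. ?iA \<omega> *\<^sub>R ?V s \<omega>)"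
      by (rule N2_indicator_flip[OF tr A jV])
    also have "2 * N2 t r (\<lambda>s \<omega>. ?iA \<omega> *\<^sub>R ?V s \<omega>) + 2 * N2 t r (\<lambda>s \<omega>. ?iA \<omega> *\<^sub>R ?V s \<omega>) = 4 * N2 t r (\<lambda>s \<omega>. ?iA \<omega> *\<^sub>R ?V s \<omega>)"
      by (simp only: distrib_right[symmetric]) simp
    also have "\<dots> \<le> 4 * ?nV"
      by (intro mult_left_mono N2_mono) (auto split: split_indicator)
    finally show "N2 t r (\<lambda>s \<omega>. ?iA \<omega> *\<^sub>R (?V s \<omega> + ?V s (?\<phi> \<omega>))) \<le> 4 * ?nV" .
  qed auto
  finally have main: "N2 t r (\<lambda>s \<omega>. ?iA \<omega> *\<^sub>R (2 * \<rho>)) \<le> 2 * (ennreal (CZ * (r - t)) * pm A) + 8 * ?nV"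
    by (simp add: mult.assoc[symmetric])
  have hA: "?h * pm A \<le> 2 * ?nV"
  proof (cases "?nV = \<infinity>")
    case True
    then show ?thesis by (simp add: ennreal_mult_top)
  next
    case False
    then obtain v where v: "?nV = ennreal v" "0 \<le> v" by (cases ?nV) auto
    define x where "x = (r - t) * P.prob A"
    have x0: "0 \<le> x" using tr by (simp add: x_def)
    have pA: "pm A = ennreal (P.prob A)" by (rule P.emeasure_eq_measure)
    have "(norm (2 * \<rho>))\<^sup>2 = 4 * (CZ + 1)" using \<rho> by (simp add: power_mult_distrib)
    then have "N2 t r (\<lambda>s \<omega>. ?iA \<omega> *\<^sub>R (2 * \<rho>)) = ?h * (ennreal (4 * (CZ + 1)) * ennreal (P.prob A))"
      by (simp only: N2_indicator[OF AP tr' borel_measurable_const] E2_indicator[OF AP] pA)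
    also have "\<dots> = ennreal ((r - t) * (4 * (CZ + 1) * P.prob A))"
      using tr CZ_nonneg by (subst ennreal_mult, simp, simp) (subst ennreal_mult[of "4 * (CZ + 1)"], auto)
    also have "(r - t) * (4 * (CZ + 1) * P.prob A) = 4 * (CZ + 1) * x" by (simp add: x_def)
    finally have "N2 t r (\<lambda>s \<omega>. ?iA \<omega> *\<^sub>R (2 * \<rho>)) = ennreal (4 * (CZ + 1) * x)" .
    moreover have "2 * (ennreal (CZ * (r - t)) * pm A) + 8 * ?nV = ennreal (2 * CZ * x + 8 * v)"
    proof -
      have "2 * (ennreal (CZ * (r - t)) * pm A) = ennreal (2 * CZ * x)"
        unfolding pA x_def using tr CZ_nonneg by (simp add: ennreal_mult ac_simps)
      moreover have "8 * ?nV = ennreal (8 * v)" using v by (simp add: ennreal_mult)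
      ultimately show ?thesis using x0 v CZ_nonneg by (simp add: ennreal_plus)
    qed
    ultimately have "ennreal (4 * (CZ + 1) * x) \<le> ennreal (2 * CZ * x + 8 * v)" using main by (simp only:)
    \<comment> \<open>The left side exceeds the \<open>CZ\<close> term by at least
      \<open>4 * x\<close>, which leaves \<open>x \<le> 2 * v\<close>.\<close>
    then have "4 * (CZ + 1) * x \<le> 2 * CZ * x + 8 * v"
      using x0 v CZ_nonneg by (subst (asm) ennreal_le_iff) auto
    moreover have "0 \<le> CZ * x" using x0 CZ_nonneg by simp
    ultimately have "x \<le> 2 * v" by (simp add: algebra_simps)
    moreover have "?h * pm A = ennreal x" unfolding x_def pA using tr by (simp add: ennreal_mult)
    moreover have "2 * ?nV = ennreal (2 * v)" using v by (simp add: ennreal_mult)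
    ultimately show ?thesis by (simp add: ennreal_leI)
  qed
  have "N2 t r H \<le> 2 * N2 t r (\<lambda>s \<omega>. ?iA \<omega> *\<^sub>R (1::real)) + 2 * ?nV"
  proof (rule N2_triangle[OF _ jV])
    show "jm (\<lambda>s \<omega>. ?iA \<omega> *\<^sub>R (1::real))"
      unfolding jm_def case_prod_beta' using measurable_compose[OF measurable_snd iAP] by simp
    fix s and \<omega> :: "'d omega" assume \<omega>: "\<omega> \<in> Omega T"
    show "norm (H s \<omega>) \<le> norm (?iA \<omega> *\<^sub>R (1::real)) + norm (?V s \<omega>)"
    proof (cases "norm (Z s \<omega>) > \<rho> + 1 \<and> \<omega> \<notin> A")
      case True
      then have "norm (\<xi> \<omega>) \<le> \<rho>" using \<omega> by (auto simp: A_def)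
      then have "1 \<le> norm (?V s \<omega>)" using True norm_triangle_ineq2[of "Z s \<omega>" "\<xi> \<omega>"] by (simp add: norm_minus_commute)
      then show ?thesis using True by (simp add: H_def)
    next
      case False
      then show ?thesis by (auto simp: H_def \<rho>_def)
    qed
  qed
  also have "N2 t r (\<lambda>s \<omega>. ?iA \<omega> *\<^sub>R (1::real)) = ?h * pm A"
    using N2_indicator[OF AP tr', of "\<lambda>_. 1::real"] E2_indicator[OF AP, of "1::real"] by simp
  also have "2 * (?h * pm A) + 2 * ?nV \<le> 2 * (2 * ?nV) + 2 * ?nV"
    by (intro add_right_mono mult_left_mono hA) simp
  also have "\<dots> = 6 * ?nV" by (simp only: mult.assoc[symmetric] distrib_right[symmetric]) simp
  finally show ?thesis .
qed

text \<open>On every piece the set where \<open>Z\<close> is large has measure at most 6 times the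
  squared approximation error. The factor does not depend on the piece, so the sum is bounded by 6
  times the total error, which tends to 0.\<close>

lemma Z_bounded: "AE (s, \<omega>) in LT \<Otimes>\<^sub>M P. norm (Z s \<omega>) \<le> sqrt (CZ + 1) + 1"
proof -
  define H where "H = (\<lambda>s \<omega>. if norm (Z s \<omega>) > sqrt (CZ + 1) + 1 then 1 else (0::real))"
  have jH: "jm H"
  proof -
    have [measurable]: "(\<lambda>x. Z (fst x) (snd x)) \<in> borel_measurable (LT \<Otimes>\<^sub>M P)"
      using jm_Z by (simp add: jm_def case_prod_beta')
    show ?thesis unfolding jm_def H_def case_prod_beta' by measurable
  qed
  \<comment> \<open>The approximating simple processes are those that define the stochastic integral
    of \<open>Z\<close>.\<close>
  obtain n p \<xi> where ok: "\<And>m::nat. simple_ok T P (n m) (p m) (\<xi> m)"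
    and cv: "(\<lambda>m. \<integral>\<^sup>+\<omega>. (\<integral>\<^sup>+s\<in>{0..T}. ennreal ((norm (simple_proc (n m) (p m) (\<xi> m) s \<omega> - Z s \<omega>))\<^sup>2) \<partial>lborel) \<partial>P) \<longlonglongrightarrow> 0"
    using Y_ito unfolding is_ito_def by blast
  let ?e = "\<lambda>m. \<integral>\<^sup>+\<omega>. (\<integral>\<^sup>+s\<in>{0..T}. ennreal ((norm (simple_proc (n m) (p m) (\<xi> m) s \<omega> - Z s \<omega>))\<^sup>2) \<partial>lborel) \<partial>P"
  let ?\<zeta> = "\<lambda>m. simple_proc (n m) (p m) (\<xi> m)"
  have part: "partition_of T (n m) (p m)" "p m (n m) = T" for m
    using ok[of m] unfolding simple_ok_def partition_of_def by auto
  have \<xi>: "\<xi> m k \<in> borel_measurable (F (p m k))" if "k < n m" for m k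
    using ok[of m] that unfolding simple_ok_def by auto
  have piece: "?\<zeta> m s \<omega> = \<xi> m k \<omega>" if k: "k < n m" and s: "s \<in> {p m k<..p m (Suc k)}" for m k s \<omega>
  proof -
    have "?\<zeta> m s \<omega> = (\<Sum>l<n m. if l = k then \<xi> m k \<omega> else 0)"
      unfolding simple_proc_def
    proof (rule sum.cong[OF refl])
      fix l assume l: "l \<in> {..<n m}"
      consider "l = k" | "l < k" | "k < l" by linarith
      then show "indicator {p m l<..p m (Suc l)} s *\<^sub>R \<xi> m l \<omega> = (if l = k then \<xi> m k \<omega> else 0)"
      proof cases
        case 2
        then have "p m (Suc l) \<le> p m k" using k by (intro partition_of_mono[OF part(1)]) auto
        then show ?thesis using s 2 by auto
      next
        case 3
        then have "p m (Suc k) \<le> p m l" using l by (intro partition_of_mono[OF part(1)]) auto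
        then show ?thesis using s 3 by auto
      qed (use s in auto)
    qed
    then show ?thesis using k by simp
  qed
  have j\<zeta>: "jm (\<lambda>s \<omega>. ?\<zeta> m s \<omega> - Z s \<omega>)" for m
  proof -
    have "jm (?\<zeta> m)"
      unfolding jm_def simple_proc_def[abs_def] case_prod_beta'
    proof (intro borel_measurable_sum borel_measurable_scaleR)
      fix k assume k: "k \<in> {..<n m}"
      show "(\<lambda>x. indicator {p m k<..p m (Suc k)} (fst x) :: real) \<in> borel_measurable (LT \<Otimes>\<^sub>M P)"
        by (rule measurable_compose[OF measurable_fst measurable_LT]) simp
      have "p m k \<le> T" using partition_of_range[OF part(1), of k m] k by simp
      then show "(\<lambda>x. \<xi> m k (snd x)) \<in> borel_measurable (LT \<Otimes>\<^sub>M P)"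
        using k by (intro measurable_compose[OF measurable_snd measurable_Filt_P[OF \<xi>]]) auto
    qed
    then show ?thesis by (rule jm_diff[OF _ jm_Z])
  qed
  have "N2 0 T H \<le> 6 * ?e m + 0 * ?e m" for m
  proof -
    have "N2 0 T H = (\<Sum>k<n m. N2 (p m k) (p m (Suc k)) H)"
      using N2_partition[OF jH part(1) order_refl, of m] part(2) by simp
    also have "\<dots> \<le> (\<Sum>k<n m. 6 * N2 (p m k) (p m (Suc k)) (\<lambda>s \<omega>. ?\<zeta> m s \<omega> - Z s \<omega>))"
    proof (rule sum_mono)
      fix k assume "k \<in> {..<n m}"
      then have k: "k < n m" by simp
      have pk: "p m k \<in> {0..T}" "p m (Suc k) \<in> {0..T}" "p m k < p m (Suc k)"
        using partition_of_range[OF part(1)] partition_of_less[OF part(1)] k by auto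
      have "N2 (p m k) (p m (Suc k)) H \<le> 6 * N2 (p m k) (p m (Suc k)) (\<lambda>s \<omega>. \<xi> m k \<omega> - Z s \<omega>)"
        unfolding H_def by (rule large_Z_N2[OF _ pk(3) _ \<xi>[OF k]]) (use pk in auto)
      also have "\<dots> \<le> 6 * N2 (p m k) (p m (Suc k)) (\<lambda>s \<omega>. ?\<zeta> m s \<omega> - Z s \<omega>)"
        using k by (intro mult_left_mono N2_mono) (simp_all add: piece)
      finally show "N2 (p m k) (p m (Suc k)) H \<le> 6 * N2 (p m k) (p m (Suc k)) (\<lambda>s \<omega>. ?\<zeta> m s \<omega> - Z s \<omega>)" .
    qed
    also have "\<dots> = 6 * N2 0 T (\<lambda>s \<omega>. ?\<zeta> m s \<omega> - Z s \<omega>)"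
      using N2_partition[OF j\<zeta> part(1) order_refl, of m m] part(2) by (simp add: sum_distrib_left[symmetric])
    also have "N2 0 T (\<lambda>s \<omega>. ?\<zeta> m s \<omega> - Z s \<omega>) \<le> ?e m"
      unfolding N2_def
    proof (rule nn_integral_mono)
      fix \<omega>
      have "(N1 0 T (\<lambda>s. ?\<zeta> m s \<omega> - Z s \<omega>)) \<le> (\<integral>\<^sup>+s. ennreal ((norm (?\<zeta> m s \<omega> - Z s \<omega>))\<^sup>2) \<partial>LT)"
        by (intro nn_integral_mono) (auto split: split_indicator)
      then show "(N1 0 T (\<lambda>s. ?\<zeta> m s \<omega> - Z s \<omega>))
         \<le> (\<integral>\<^sup>+s\<in>{0..T}. ennreal ((norm (?\<zeta> m s \<omega> - Z s \<omega>))\<^sup>2) \<partial>lborel)"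
        by (simp add: nn_integral_restrict_space)
    qed
    finally show ?thesis by (simp add: mult_left_mono)
  qed
  then have b: "N2 0 T H \<le> 0 + (6 * ?e m + 0 * ?e m)" for m by simp
  have "N2 0 T H \<le> 0"
    by (rule ennreal_le_limit[OF b tendsto_0_ennreal_lin[OF cv cv]]) auto
  then have "N2 0 T H = 0" by simp
  from AE_of_N2_eq_0[OF jH this] show ?thesis
    by eventually_elim (auto simp: H_def split: if_splits)
qed

end

section \<open>Particle system and mean-field system as instances of the common form\<close>

lemma C1b_bounded:
  assumes "C1b g" obtains B where "0 \<le> B" "\<And>x. norm (g x) \<le> B"
proof -
  obtain B where B: "\<And>x. norm (g x) \<le> B"
    using assms unfolding C1b_def bounded_iff by auto
  have "0 \<le> B" using norm_ge_zero B by (rule order_trans)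
  then show ?thesis using B that by blast
qed

lemma C1b_continuous: "C1b g \<Longrightarrow> continuous_on UNIV g"
  unfolding C1b_def by (blast intro: continuous_at_imp_continuous_on has_derivative_continuous)

lemma C1b_Lipschitz:
  assumes "C1b g" obtains L where "0 \<le> L" "\<And>x y. norm (g x - g y) \<le> L * norm (x - y)"
proof -
  obtain g' L where g': "\<And>x. (g has_derivative blinfun_apply (g' x)) (at x)" and L: "\<And>x. norm (g' x) \<le> L"
    using assms unfolding C1b_def bounded_iff by auto
  have "0 \<le> L" using norm_ge_zero L by (rule order_trans)
  moreover have "norm (g x - g y) \<le> L * norm (x - y)" for x y
    by (rule differentiable_bound[of UNIV g "\<lambda>x. blinfun_apply (g' x)"])
       (use g' L in \<open>auto simp: norm_blinfun.rep_eq[symmetric] intro: has_derivative_at_withinI\<close>)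
  ultimately show ?thesis using that by blast
qed

lemma norm_average_le:
  fixes h :: "nat \<Rightarrow> 'a::real_normed_vector"
  assumes "N \<ge> 1" "\<And>k. k \<in> {1..N} \<Longrightarrow> norm (h k) \<le> C"
  shows "norm ((1 / real N) *\<^sub>R (\<Sum>k = 1..N. h k)) \<le> C"
proof -
  have "norm (\<Sum>k = 1..N. h k) \<le> real N * C"
    using norm_sum[of h "{1..N}"] sum_mono[of "{1..N}" "\<lambda>k. norm (h k)" "\<lambda>_. C"] assms(2) by force
  then show ?thesis using assms(1) by (simp add: field_simps)
qed

lemma norm_average_Lipschitz:
  fixes h :: "'a::real_normed_vector \<times> 'b::real_normed_vector \<Rightarrow> 'c::real_normed_vector"
  assumes "N \<ge> 1" and h: "\<And>v w. norm (h v - h w) \<le> L * norm (v - w)"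
  shows "norm ((1 / real N) *\<^sub>R (\<Sum>k = 1..N. h (x, u k)) - (1 / real N) *\<^sub>R (\<Sum>k = 1..N. h (y, u k))) \<le> L * norm (x - y)"
proof -
  have "norm (h (x, u k) - h (y, u k)) \<le> L * norm (x - y)" for k
    using h[of "(x, u k)" "(y, u k)"] by (simp add: norm_Pair)
  then have "norm ((1 / real N) *\<^sub>R (\<Sum>k = 1..N. h (x, u k) - h (y, u k))) \<le> L * norm (x - y)"
    using assms(1) by (intro norm_average_le) auto
  then show ?thesis by (simp only: sum_subtractf scaleR_diff_right)
qed

lemma Theta_Omega:
  assumes "\<omega> \<in> Omega T" "k \<ge> 1" shows "Theta k \<omega> \<in> Omega T"
proof -
  have 1: "k # i \<in> Iset" if "i \<in> Iset" for i using that assms(2) by (auto simp: Iset_def)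
  have 2: "k # i \<notin> Iset" if "i \<notin> Iset" for i using that by (auto simp: Iset_def)
  have "Theta k \<omega> i = \<omega> (k # i)" for i using assms(2) by (simp add: Theta_def)
  then show ?thesis using assms(1) 1 2 unfolding Omega_def by auto
qed

text \<open>For \<open>k \<ge> 1\<close> the shift reads only coordinates \<open>k # j\<close>,
  never \<open>[]\<close>. Hence the shifted processes do not see a change of
  \<open>W\<^sup>0\<close>.\<close>

lemma Theta_cong:
  assumes "k \<ge> 1" "\<And>i. i \<noteq> [] \<Longrightarrow> \<omega> i = \<omega>' i" shows "Theta k \<omega> = Theta k \<omega>'"
  using assms by (auto simp: Theta_def fun_eq_iff)

context bm_space begin

lemma average_continuous:
  fixes h :: "'a::topological_space \<times> 'b::topological_space \<Rightarrow> 'c::real_normed_vector"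
  assumes h: "continuous_on UNIV h" and U: "\<And>k. k \<in> {1..N} \<Longrightarrow> continuous_on {0..T} (U k)"
  shows "continuous_on ({0..T} \<times> UNIV) (\<lambda>(s, x). (1 / real N) *\<^sub>R (\<Sum>k = 1..N. h (x, U k s)))"
  unfolding case_prod_beta'
proof (intro continuous_on_scaleR continuous_on_const continuous_on_sum)
  fix k assume k: "k \<in> {1..N}"
  have "continuous_on ({0..T} \<times> UNIV) (\<lambda>x. U k (fst x))"
    by (rule continuous_on_compose2[OF U[OF k]]) (auto intro: continuous_intros)
  then show "continuous_on ({0..T} \<times> UNIV) (\<lambda>x. h (snd x, U k (fst x)))"
    by (intro continuous_on_compose2[OF h]) (auto intro!: continuous_intros)
qed

text \<open>Continuity holds jointly in time and state by dominated convergence, since the paths of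
  \<open>U\<close> are continuous and \<open>h\<close> is bounded.\<close>

lemma mean_field:
  fixes h :: "'a::{metric_space,second_countable_topology} \<times> 'b::{metric_space,second_countable_topology} \<Rightarrow> 'c::{banach,second_countable_topology}"
    and U :: "real \<Rightarrow> 'd omega \<Rightarrow> 'b"
  assumes h: "continuous_on UNIV h" and B: "\<And>x. norm (h x) \<le> B"
    and U: "\<And>s. s \<in> {0..T} \<Longrightarrow> U s \<in> borel_measurable P"
    and Uc: "\<And>\<omega>. \<omega> \<in> Omega T \<Longrightarrow> continuous_on {0..T} (\<lambda>s. U s \<omega>)"
  shows mean_field_integrable: "s \<in> {0..T} \<Longrightarrow> integrable P (\<lambda>\<omega>. h (x, U s \<omega>))"
    and mean_field_bound: "s \<in> {0..T} \<Longrightarrow> norm (\<integral>\<omega>. h (x, U s \<omega>) \<partial>P) \<le> B"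
    and mean_field_continuous: "continuous_on ({0..T} \<times> UNIV) (\<lambda>(s, x). \<integral>\<omega>. h (x, U s \<omega>) \<partial>P)"
proof -
  have m: "(\<lambda>\<omega>. h (x, U s \<omega>)) \<in> borel_measurable P" if "s \<in> {0..T}" for s x
    by (rule borel_measurable_continuous_on[OF h]) (intro borel_measurable_Pair borel_measurable_const U that)
  show int: "integrable P (\<lambda>\<omega>. h (x, U s \<omega>))" if "s \<in> {0..T}" for s x
    by (rule P.integrable_const_bound[of _ B]) (use B m that in auto)
  show "norm (\<integral>\<omega>. h (x, U s \<omega>) \<partial>P) \<le> B" if "s \<in> {0..T}" for s x
  proof -
    have "norm (\<integral>\<omega>. h (x, U s \<omega>) \<partial>P) \<le> (\<integral>\<omega>. norm (h (x, U s \<omega>)) \<partial>P)" by simp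
    also have "\<dots> \<le> (\<integral>\<omega>. B \<partial>P)" by (rule integral_mono) (use int that B in auto)
    finally show ?thesis using P.prob_space by simp
  qed
  show "continuous_on ({0..T} \<times> UNIV) (\<lambda>(s, x). \<integral>\<omega>. h (x, U s \<omega>) \<partial>P)"
    unfolding continuous_on_sequentially comp_def
  proof (intro allI ballI impI)
    fix q :: "nat \<Rightarrow> real \<times> 'a" and a assume "a \<in> {0..T} \<times> (UNIV::'a set)"
      and q: "(\<forall>n. q n \<in> {0..T} \<times> UNIV) \<and> q \<longlonglongrightarrow> a"
    then have a: "fst a \<in> {0..T}" and q1: "\<And>n. fst (q n) \<in> {0..T}" by (auto simp: mem_Times_iff)
    have "(\<lambda>n. \<integral>\<omega>. h (snd (q n), U (fst (q n)) \<omega>) \<partial>P) \<longlonglongrightarrow> (\<integral>\<omega>. h (snd a, U (fst a) \<omega>) \<partial>P)"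
    proof (rule integral_dominated_convergence[where w="\<lambda>_. B"])
      show "AE \<omega> in P. (\<lambda>n. h (snd (q n), U (fst (q n)) \<omega>)) \<longlonglongrightarrow> h (snd a, U (fst a) \<omega>)"
      proof (rule AE_I2)
        fix \<omega> assume "\<omega> \<in> space P"
        then have \<omega>: "\<omega> \<in> Omega T" by simp
        have "(\<lambda>n. fst (q n)) \<longlonglongrightarrow> fst a" using q by (intro tendsto_fst) auto
        then have "(\<lambda>n. U (fst (q n)) \<omega>) \<longlonglongrightarrow> U (fst a) \<omega>"
          by (rule continuous_on_tendsto_compose[OF Uc[OF \<omega>]]) (use a q1 in auto)
        then have "(\<lambda>n. (snd (q n), U (fst (q n)) \<omega>)) \<longlonglongrightarrow> (snd a, U (fst a) \<omega>)"
          using q by (intro tendsto_Pair tendsto_snd) auto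
        then show "(\<lambda>n. h (snd (q n), U (fst (q n)) \<omega>)) \<longlonglongrightarrow> h (snd a, U (fst a) \<omega>)"
          by (rule continuous_on_tendsto_compose[OF h]) auto
      qed
    qed (use m a q1 B in auto)
    then show "(\<lambda>n. case q n of (s, x) \<Rightarrow> \<integral>\<omega>. h (x, U s \<omega>) \<partial>P) \<longlonglongrightarrow> (case a of (s, x) \<Rightarrow> \<integral>\<omega>. h (x, U s \<omega>) \<partial>P)"
      by (simp add: case_prod_beta')
  qed
qed

lemma mean_field_Lipschitz:
  fixes h :: "'a::real_normed_vector \<times> 'b::real_normed_vector \<Rightarrow> 'c::{banach,second_countable_topology}"
  assumes "integrable P (\<lambda>\<omega>. h (x, u \<omega>))" "integrable P (\<lambda>\<omega>. h (y, u \<omega>))"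
    and L: "\<And>v w. norm (h v - h w) \<le> L * norm (v - w)"
  shows "norm ((\<integral>\<omega>. h (x, u \<omega>) \<partial>P) - (\<integral>\<omega>. h (y, u \<omega>) \<partial>P)) \<le> L * norm (x - y)"
proof -
  have "norm ((\<integral>\<omega>. h (x, u \<omega>) \<partial>P) - (\<integral>\<omega>. h (y, u \<omega>) \<partial>P)) = norm (\<integral>\<omega>. h (x, u \<omega>) - h (y, u \<omega>) \<partial>P)"
    using assms by simp
  also have "\<dots> \<le> (\<integral>\<omega>. norm (h (x, u \<omega>) - h (y, u \<omega>)) \<partial>P)" by simp
  also have "\<dots> \<le> (\<integral>\<omega>. L * norm (x - y) \<partial>P)"
  proof (rule integral_mono)
    show "norm (h (x, u \<omega>) - h (y, u \<omega>)) \<le> L * norm (x - y)" for \<omega>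
      using L[of "(x, u \<omega>)" "(y, u \<omega>)"] by (simp add: norm_Pair)
  qed (use assms in auto)
  finally show ?thesis using P.prob_space by simp
qed

end

theorem lemma4p3:
  fixes T :: real and x0 :: "real^'d::finite"
    and b :: "(real^'d) \<times> (real^'d) \<Rightarrow> real^'d"
    and \<sigma> :: "(real^'d) \<times> (real^'d) \<Rightarrow> real^'d^'d"
    and \<Phi> :: "(real^'d) \<times> (real^'d) \<Rightarrow> real"
    and f :: "((real^'d) \<times> real \<times> (real^'d)) \<times> ((real^'d) \<times> real \<times> (real^'d)) \<Rightarrow> real"
    and M0 P :: "'d omega measure"
    and XN :: "nat \<Rightarrow> real \<Rightarrow> 'd omega \<Rightarrow> real^'d"
    and YN :: "nat \<Rightarrow> real \<Rightarrow> 'd omega \<Rightarrow> real"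
    and ZN :: "nat \<Rightarrow> real \<Rightarrow> 'd omega \<Rightarrow> real^'d"
    and X :: "real \<Rightarrow> 'd omega \<Rightarrow> real^'d"
    and Y :: "real \<Rightarrow> 'd omega \<Rightarrow> real"
    and Z :: "real \<Rightarrow> 'd omega \<Rightarrow> real^'d"
  assumes T_pos: "T > 0"
    and M0: "canonical_BM_measure T M0"
    and P_def: "P = completion M0"
    and b_reg: "C1b b" and \<sigma>_reg: "C1b \<sigma>" and \<Phi>_reg: "C1b \<Phi>" and f_reg: "C1b f"
    and f_indep: "\<And>x y z x' y' z1 z2. f ((x, y, z), (x', y', z1)) = f ((x, y, z), (x', y', z2))"
    and XN_sol: "\<And>N. N \<ge> 1 \<Longrightarrow> cont_paths T P (XN N) \<and> adapted T P (XN N) \<and>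
      (\<exists>I :: 'd \<Rightarrow> real \<Rightarrow> 'd omega \<Rightarrow> real.
         (\<forall>j. is_ito T P (\<lambda>s \<omega>. ((1 / real N) *\<^sub>R (\<Sum>k = 1..N. \<sigma> (XN N s \<omega>, XN N s (Theta k \<omega>)))) $ j) (I j)) \<and>
         (AE \<omega> in P. \<forall>t\<in>{0..T}. XN N t \<omega> = x0
             + integral {0..t} (\<lambda>s. (1 / real N) *\<^sub>R (\<Sum>k = 1..N. b (XN N s \<omega>, XN N s (Theta k \<omega>))))
             + (\<chi> j. I j t \<omega>)))"
    and YZN_sol: "\<And>N. N \<ge> 1 \<Longrightarrow> S2 T P (YN N) \<and> L2 T P (ZN N) \<and>
      (\<exists>I. is_ito T P (ZN N) I \<and>
         (AE \<omega> in P. \<forall>t\<in>{0..T}. YN N t \<omega> =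
             (1 / real N) * (\<Sum>k = 1..N. \<Phi> (XN N T \<omega>, XN N T (Theta k \<omega>)))
             + integral {t..T} (\<lambda>s. (1 / real N) * (\<Sum>k = 1..N.
                  f ((XN N s \<omega>, YN N s \<omega>, ZN N s \<omega>),
                     (XN N s (Theta k \<omega>), YN N s (Theta k \<omega>), ZN N s (Theta k \<omega>)))))
             - (I T \<omega> - I t \<omega>)))"
    and X_sol: "cont_paths T P X \<and> adapted T P X \<and>
      (\<exists>I :: 'd \<Rightarrow> real \<Rightarrow> 'd omega \<Rightarrow> real.
         (\<forall>j. is_ito T P (\<lambda>s \<omega>. (\<integral>\<omega>'. \<sigma> (X s \<omega>, X s \<omega>') \<partial>P) $ j) (I j)) \<and>
         (AE \<omega> in P. \<forall>t\<in>{0..T}. X t \<omega> = x0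
             + integral {0..t} (\<lambda>s. \<integral>\<omega>'. b (X s \<omega>, X s \<omega>') \<partial>P)
             + (\<chi> j. I j t \<omega>)))"
    and YZ_sol: "S2 T P Y \<and> L2 T P Z \<and>
      (\<exists>I. is_ito T P Z I \<and>
         (AE \<omega> in P. \<forall>t\<in>{0..T}. Y t \<omega> =
             (\<integral>\<omega>'. \<Phi> (X T \<omega>, X T \<omega>') \<partial>P)
             + integral {t..T} (\<lambda>s. \<integral>\<omega>'. f ((X s \<omega>, Y s \<omega>, Z s \<omega>), (X s \<omega>', Y s \<omega>', Z s \<omega>')) \<partial>P)
             - (I T \<omega> - I t \<omega>)))"
  shows "\<exists>C. (AE (t, \<omega>) in restrict_space lborel {0..T} \<Otimes>\<^sub>M P. norm (Z t \<omega>) \<le> C) \<and>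
             (\<forall>N\<ge>1. AE (t, \<omega>) in restrict_space lborel {0..T} \<Otimes>\<^sub>M P. norm (ZN N t \<omega>) \<le> C)"
proof -
  interpret bm_space T M0 P by unfold_locales (use T_pos M0 P_def in auto)
  obtain B1 B2 B3 where B1: "0 \<le> B1" "\<And>x. norm (b x) \<le> B1" and B2: "0 \<le> B2" "\<And>x. norm (\<sigma> x) \<le> B2"
    and B3: "0 \<le> B3" "\<And>x. norm (f x) \<le> B3"
    using C1b_bounded[OF b_reg] C1b_bounded[OF \<sigma>_reg] C1b_bounded[OF f_reg] by metis
  obtain B4 where B4: "0 \<le> B4" "\<And>x. norm (\<Phi> x) \<le> B4" using C1b_bounded[OF \<Phi>_reg] by metis
  obtain L1 L2 where L1: "0 \<le> L1" "\<And>x y. norm (b x - b y) \<le> L1 * norm (x - y)"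
    and L2: "0 \<le> L2" "\<And>x y. norm (\<sigma> x - \<sigma> y) \<le> L2 * norm (x - y)"
    using C1b_Lipschitz[OF b_reg] C1b_Lipschitz[OF \<sigma>_reg] by metis
  obtain L3 L4 where L3: "0 \<le> L3" "\<And>x y. norm (f x - f y) \<le> L3 * norm (x - y)"
    and L4: "0 \<le> L4" "\<And>x y. norm (\<Phi> x - \<Phi> y) \<le> L4 * norm (x - y)"
    using C1b_Lipschitz[OF f_reg] C1b_Lipschitz[OF \<Phi>_reg] by metis
  \<comment> \<open>Common constants for both systems and for every \<open>N\<close>: averages and
    expectations do not enlarge them.\<close>
  define B where "B = B1 + B2 + B3"
  define L where "L = L1 + L2 + L3 + L4"
  have B0: "0 \<le> B" and L0: "0 \<le> L" using B1 B2 B3 L1 L2 L3 L4 by (auto simp: B_def L_def)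
  have bB: "norm (b x) \<le> B" and sB: "norm (\<sigma> y) \<le> B" and fB: "norm (f z) \<le> B" for x y z
    using B1(2)[of x] B2(2)[of y] B3(2)[of z] B1(1) B2(1) B3(1) unfolding B_def by linarith+
  have bL: "norm (b x - b y) \<le> L * norm (x - y)" for x y using L1(2)[of x y] L1(1) L2(1) L3(1) L4(1)
    by (intro order_trans[OF L1(2)] mult_right_mono) (auto simp: L_def)
  have sL: "norm (\<sigma> x - \<sigma> y) \<le> L * norm (x - y)" for x y using L1(1) L2(1) L3(1) L4(1)
    by (intro order_trans[OF L2(2)] mult_right_mono) (auto simp: L_def)
  have fL: "norm (f x - f y) \<le> L * norm (x - y)" for x y using L1(1) L2(1) L3(1) L4(1)
    by (intro order_trans[OF L3(2)] mult_right_mono) (auto simp: L_def)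
  have pL: "norm (\<Phi> x - \<Phi> y) \<le> L * norm (x - y)" for x y using L1(1) L2(1) L3(1) L4(1)
    by (intro order_trans[OF L4(2)] mult_right_mono) (auto simp: L_def)
  note bC = C1b_continuous[OF b_reg] and sC = C1b_continuous[OF \<sigma>_reg]
    and fC = C1b_continuous[OF f_reg] and pC = C1b_continuous[OF \<Phi>_reg]
  \<comment> \<open>The foreign \<open>Z\<close> is replaced by 0. The second slot then consists of
    the continuous processes \<open>X\<close> and \<open>Y\<close>, which makes the averaged
    generator jointly continuous in time and own state.\<close>
  have f0: "f (l, x', y', z') = f (l, x', y', 0)" for l x' y' z'
    using f_indep by (metis prod.exhaust)
  \<comment> \<open>\<open>CZ\<close> is built from \<open>T\<close>, \<open>B\<close>,
    \<open>L\<close> and the dimension alone, so that one \<open>C\<close> serves all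
    systems.\<close>
  define C where "C = sqrt (fbsde.CZ TYPE('d) T B L + 1) + 1"
  have "AE (t, \<omega>) in restrict_space lborel {0..T} \<Otimes>\<^sub>M P. norm (Z t \<omega>) \<le> C"
  proof -
    obtain IX where IX: "\<And>j. is_ito T P (\<lambda>s \<omega>. (\<integral>\<omega>'. \<sigma> (X s \<omega>, X s \<omega>') \<partial>P) $ j) (IX j)"
      "AE \<omega> in P. \<forall>t\<in>{0..T}. X t \<omega> = x0 + integral {0..t} (\<lambda>s. \<integral>\<omega>'. b (X s \<omega>, X s \<omega>') \<partial>P) + (\<chi> j. IX j t \<omega>)"
      using X_sol by blast
    obtain IY where IY: "is_ito T P Z IY"
      "AE \<omega> in P. \<forall>t\<in>{0..T}. Y t \<omega> = (\<integral>\<omega>'. \<Phi> (X T \<omega>, X T \<omega>') \<partial>P)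
         + integral {t..T} (\<lambda>s. \<integral>\<omega>'. f ((X s \<omega>, Y s \<omega>, Z s \<omega>), (X s \<omega>', Y s \<omega>', Z s \<omega>')) \<partial>P) - (IY T \<omega> - IY t \<omega>)"
      using YZ_sol by blast
    have Xm: "X s \<in> borel_measurable P" if "s \<in> {0..T}" for s
      using X_sol that measurable_Filt_P[of "X s" s] unfolding adapted_def by auto
    have Ym: "Y s \<in> borel_measurable P" if "s \<in> {0..T}" for s
      using YZ_sol that measurable_Filt_P[of "Y s" s] unfolding S2_def adapted_def by auto
    have Xc: "continuous_on {0..T} (\<lambda>s. X s \<omega>)" if "\<omega> \<in> Omega T" for \<omega>
      using X_sol that unfolding cont_paths_def by auto
    have Yc: "continuous_on {0..T} (\<lambda>s. Y s \<omega>)" if "\<omega> \<in> Omega T" for \<omega>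
      using YZ_sol that unfolding S2_def cont_paths_def by auto
    let ?U = "\<lambda>s \<omega>. (X s \<omega>, Y s \<omega>, 0 :: real^'d)"
    have Um: "?U s \<in> borel_measurable P" if "s \<in> {0..T}" for s
      using Xm Ym that by (intro borel_measurable_Pair) auto
    have Uc: "continuous_on {0..T} (\<lambda>s. ?U s \<omega>)" if "\<omega> \<in> Omega T" for \<omega>
      using Xc Yc that by (intro continuous_intros) auto
    note mb = mean_field[OF bC bB Xm Xc] and ms = mean_field[OF sC sB Xm Xc]
      and mf = mean_field[OF fC fB Um Uc] and mp = mean_field[OF pC B4(2) Xm Xc]
    have "fbsde T M0 P B L x0 (\<lambda>\<omega> s x. \<integral>\<omega>'. b (x, X s \<omega>') \<partial>P) (\<lambda>\<omega> s x. \<integral>\<omega>'. \<sigma> (x, X s \<omega>') \<partial>P)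
       (\<lambda>\<omega> x. \<integral>\<omega>'. \<Phi> (x, X T \<omega>') \<partial>P) (\<lambda>\<omega> s l. \<integral>\<omega>'. f (l, ?U s \<omega>') \<partial>P) X Y Z IX IY"
    proof (rule fbsde.intro[OF bm_space_axioms fbsde_axioms.intro], goal_cases)
      case (4 \<omega> s x) then show ?case by (intro mb(2))
    next
      case (5 \<omega> s x) then show ?case by (intro ms(2))
    next
      case (6 \<omega> s l) then show ?case by (intro mf(2))
    next
      case (7 \<omega> s x y) then show ?case by (intro mean_field_Lipschitz mb(1) bL)
    next
      case (8 \<omega> s x y) then show ?case by (intro mean_field_Lipschitz ms(1) sL)
    next
      case (9 \<omega> x y) show ?case using T_pos by (intro mean_field_Lipschitz mp(1) pL) auto
    next
      case (10 \<omega> s l l') then show ?case by (intro mean_field_Lipschitz mf(1) fL)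
    next
      case 11 show ?case by (rule mb(3))
    next
      case 12 show ?case by (rule mf(3))
    next
      \<comment> \<open>The given equation contains the foreign \<open>Z\<close>; rewriting with
        \<open>f0\<close> brings it to the form with 0 in that slot.\<close>
      case 20 show ?case using IY(2) by (simp only: f0[of _ _ _ "Z _ _"])
    qed (use B0 L0 IX IY(1) X_sol YZ_sol in auto)
    from fbsde.Z_bounded[OF this] show ?thesis unfolding C_def .
  qed
  moreover have "AE (t, \<omega>) in restrict_space lborel {0..T} \<Otimes>\<^sub>M P. norm (ZN N t \<omega>) \<le> C" if N: "N \<ge> 1" for N
  proof -
    obtain IX where IX: "\<And>j. is_ito T P (\<lambda>s \<omega>. ((1 / real N) *\<^sub>R (\<Sum>k = 1..N. \<sigma> (XN N s \<omega>, XN N s (Theta k \<omega>)))) $ j) (IX j)"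
      "AE \<omega> in P. \<forall>t\<in>{0..T}. XN N t \<omega> = x0
             + integral {0..t} (\<lambda>s. (1 / real N) *\<^sub>R (\<Sum>k = 1..N. b (XN N s \<omega>, XN N s (Theta k \<omega>)))) + (\<chi> j. IX j t \<omega>)"
      using XN_sol[OF N] by blast
    obtain IY where IY: "is_ito T P (ZN N) IY"
      "AE \<omega> in P. \<forall>t\<in>{0..T}. YN N t \<omega> =
             (1 / real N) * (\<Sum>k = 1..N. \<Phi> (XN N T \<omega>, XN N T (Theta k \<omega>)))
             + integral {t..T} (\<lambda>s. (1 / real N) * (\<Sum>k = 1..N.
                  f ((XN N s \<omega>, YN N s \<omega>, ZN N s \<omega>),
                     (XN N s (Theta k \<omega>), YN N s (Theta k \<omega>), ZN N s (Theta k \<omega>)))))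
             - (IY T \<omega> - IY t \<omega>)"
      using YZN_sol[OF N] by blast
    let ?U = "\<lambda>s \<omega>. (XN N s \<omega>, YN N s \<omega>, 0 :: real^'d)"
    have Xc: "continuous_on {0..T} (\<lambda>s. XN N s (Theta k \<omega>))" if "\<omega> \<in> Omega T" "k \<in> {1..N}" for \<omega> k
      using XN_sol[OF N] Theta_Omega[OF that(1), of k] that(2) unfolding cont_paths_def by auto
    have Yc: "continuous_on {0..T} (\<lambda>s. YN N s (Theta k \<omega>))" if "\<omega> \<in> Omega T" "k \<in> {1..N}" for \<omega> k
      using YZN_sol[OF N] Theta_Omega[OF that(1), of k] that(2) unfolding S2_def cont_paths_def by auto
    have Uc: "continuous_on {0..T} (\<lambda>s. ?U s (Theta k \<omega>))" if "\<omega> \<in> Omega T" "k \<in> {1..N}" for \<omega> k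
      using Xc Yc that by (intro continuous_intros) auto
    have "fbsde T M0 P B L x0 (\<lambda>\<omega> s x. (1 / real N) *\<^sub>R (\<Sum>k = 1..N. b (x, XN N s (Theta k \<omega>))))
       (\<lambda>\<omega> s x. (1 / real N) *\<^sub>R (\<Sum>k = 1..N. \<sigma> (x, XN N s (Theta k \<omega>))))
       (\<lambda>\<omega> x. (1 / real N) *\<^sub>R (\<Sum>k = 1..N. \<Phi> (x, XN N T (Theta k \<omega>))))
       (\<lambda>\<omega> s l. (1 / real N) *\<^sub>R (\<Sum>k = 1..N. f (l, ?U s (Theta k \<omega>)))) (XN N) (YN N) (ZN N) IX IY"
    proof (rule fbsde.intro[OF bm_space_axioms fbsde_axioms.intro], goal_cases)
      \<comment> \<open>The random coefficients depend on the path only through its shifts, which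
        ignore \<open>W\<^sup>0\<close>.\<close>
      case (3 \<omega> \<omega>')
      then have "Theta k \<omega> = Theta k \<omega>'" if "k \<in> {1..N}" for k using that by (intro Theta_cong) auto
      then show ?case
        by (intro conjI ext arg_cong[where f="\<lambda>x. (1 / real N) *\<^sub>R x"] sum.cong refl) simp_all
    next
      case (4 \<omega> s x) show ?case by (intro norm_average_le N bB)
    next
      case (5 \<omega> s x) show ?case by (intro norm_average_le N sB)
    next
      case (6 \<omega> s l) show ?case by (intro norm_average_le N fB)
    next
      case (7 \<omega> s x y) show ?case by (rule norm_average_Lipschitz[OF N bL])
    next
      case (8 \<omega> s x y) show ?case by (rule norm_average_Lipschitz[OF N sL])
    next
      case (9 \<omega> x y) show ?case by (rule norm_average_Lipschitz[OF N pL])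
    next
      case (10 \<omega> s l l') show ?case by (rule norm_average_Lipschitz[OF N fL])
    next
      case (11 \<omega>) then show ?case by (intro average_continuous[OF bC] Xc)
    next
      case (12 \<omega>) then show ?case by (intro average_continuous[OF fC] Uc)
    next
      case 20 show ?case using IY(2) by (simp only: f0[of _ _ _ "ZN N _ _"] real_scaleR_def)
    qed (use B0 L0 IX IY(1) XN_sol[OF N] YZN_sol[OF N] in auto)
    from fbsde.Z_bounded[OF this] show ?thesis unfolding C_def .
  qed
  ultimately show ?thesis by blast
qed

end
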